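(* Let $J_1$ and $J_2$ be open intervals in $\mathbb{R}$ and let $f\in C^m(J_1\times J_2,\mathbb{R})$, with induced matrix function $F$. Let $(S,T)=(S(t),T(t))$ be a $C^m$ curve in $CS^2_n$ defined on an interval $I$ with joint eigenvalues in $J_1\times J_2$. Then for $1\le l\le m$ and $t^*\in I$, the derivative $\frac{d^l}{dt^l}F(S,T)|_{t=t^*}$ exists and $$\tfrac{d^l}{dt^l}F(S,T)\big|_{t=t^*}=U\Big(\sum_{I_l}\ \sum_{s_2,\dots,s_j=1}^n\frac{l!}{i_1!\cdots i_j!}\Big[f^{[k,j-k]}(x_{s_1},\dots,x_{s_{k+1}};\,y_{s_{k+1}},\dots,y_{s_{j+1}})\Big]_{s_1,s_{j+1}=1}^n\odot\Big[\Gamma^{i_1}_{s_1s_2}\cdots\Gamma^{i_k}_{s_ks_{k+1}}\Delta^{i_{k+1}}_{s_{k+1}s_{k+2}}\cdots\Delta^{i_j}_{s_js_{j+1}}\Big]_{s_1,s_{j+1}=1}^n\Big)U^*,$$ where $U$, $U^*$, $\Gamma^i$, $\Delta^i$, $x_q$ and $y_r$ are evaluated at $t^*$.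
   Context: $CS^2_n$ is the set of pairs $(S,T)$ of commuting $n\times n$ self-adjoint (complex Hermitian) matrices; a curve in it is $C^m$ if it is $m$-times continuously differentiable as a map into pairs of self-adjoint matrices. If $V$ is unitary with $S=V\operatorname{diag}(x_1,\dots,x_n)V^*$ and $T=V\operatorname{diag}(y_1,\dots,y_n)V^*$, the joint eigenvalues of $(S,T)$ are $(x_i,y_i)$, $1\le i\le n$, and the matrix function induced by $f$ is $F(S,T):=V\operatorname{diag}(f(x_1,y_1),\dots,f(x_n,y_n))V^*$. Notation for the curve $(S(t),T(t))$: the joint eigenvalues are represented on $I$ by Lipschitz functions $(x_s(t),y_s(t))$, $1\le s\le n$, and $U=U(t)$ is a unitary matrix with $U^*S(t)U=\operatorname{diag}(x_1(t),\dots,x_n(t))$ and $U^*T(t)U=\operatorname{diag}(y_1(t),\dots,y_n(t))$; $x_s=x_s(t)$, $y_s=y_s(t)$. For $1\le i\le m$, $\Gamma^i:=U^*S^{(i)}(t)U$ and $\Delta^i:=U^*T^{(i)}(t)U$, where $S^{(i)},T^{(i)}$ are $i$-th derivatives (so superscripts on $\Gamma,\Delta$ are derivative orders, not powers). Index set: $I_l:=\{(i_1,\dots,i_k)\cup(i_{k+1},\dots,i_j): i_1+\dots+i_j=l,\ i_q\in\mathbb{N},\ i_q\ge1\}$, the set of ordered pairs of index tuples, where $j\ge1$ and $0\le k\le j$ vary and either tuple may be empty; e.g. $I_2=\{(2)\cup\emptyset,(1,1)\cup\emptyset,(1)\cup(1),\emptyset\cup(1,1),\emptyset\cup(2)\}$.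 When $j=1$ the inner sum over $s_2,\dots,s_j$ is a single term. Divided differences: $f^{[k,j-k]}(x_1,\dots,x_{k+1};y_1,\dots,y_{j-k+1})$ is the divided difference of $f$ taken $k$ times in the first variable and $j-k$ times in the second variable, at the given points; the one-variable divided differences are $g^{[0]}(x_1)=g(x_1)$ and $g^{[k]}(x_1,\dots,x_{k+1})=\frac{g^{[k-1]}(x_1,\dots,x_k)-g^{[k-1]}(x_2,\dots,x_{k+1})}{x_1-x_{k+1}}$ for distinct points, extended by continuity to coinciding points. $\odot$ is the Schur (entrywise) product, and $[a_{s_1,s_{j+1}}]_{s_1,s_{j+1}=1}^n$ is the matrix with row index $s_1$ and column index $s_{j+1}$. *)

theory Defs
  imports "HOL-Analysis.Analysis"
begin

definition cadjoint :: "complex^'n^'m \<Rightarrow> complex^'m^'n" where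
  "cadjoint A = (\<chi> i j. cnj (A $ j $ i))"

definition hermitian :: "complex^'n^'n \<Rightarrow> bool" where
  "hermitian A \<longleftrightarrow> cadjoint A = A"

definition unitary :: "complex^'n^'n \<Rightarrow> bool" where
  "unitary U \<longleftrightarrow> cadjoint U ** U = mat 1 \<and> U ** cadjoint U = mat 1"

definition diag :: "('n \<Rightarrow> real) \<Rightarrow> complex^'n^'n" where
  "diag d = (\<chi> i j. if i = j then complex_of_real (d i) else 0)"

definition schur :: "complex^'n^'m \<Rightarrow> complex^'n^'m \<Rightarrow> complex^'n^'m" (infixl "\<odot>" 70) where
  "A \<odot> B = (\<chi> i j. A $ i $ j * B $ i $ j)"

definition CS2 :: "((complex^'n^'n) \<times> (complex^'n^'n)) set" where
  "CS2 = {(S, T). hermitian S \<and> hermitian T \<and> S ** T = T ** S}"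

text \<open>On \<open>CS2\<close> the matrix described here exists and does not depend on the
  diagonalization chosen.\<close>

definition matfun ::
  "(real \<times> real \<Rightarrow> real) \<Rightarrow> (complex^'n^'n) \<times> (complex^'n^'n) \<Rightarrow> complex^'n^'n" where
  "matfun f = (\<lambda>(S, T). THE M. \<exists>V x y. unitary V \<and>
     S = V ** diag x ** cadjoint V \<and> T = V ** diag y ** cadjoint V \<and>
     M = V ** diag (\<lambda>i. f (x i, y i)) ** cadjoint V)"

text \<open>Derivatives along an interval \<open>I\<close> are taken within \<open>I\<close>, so they are one-sided at
  endpoints belonging to \<open>I\<close>. The values are meaningful only under
  \<open>times_differentiable_on\<close> below, and for \<open>I\<close> with more than one point.\<close>

primrec higher_vderiv ::
  "nat \<Rightarrow> real set \<Rightarrow> (real \<Rightarrow> 'a::real_normed_vector) \<Rightarrow> real \<Rightarrow> 'a" where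
  "higher_vderiv 0 I g = g"
| "higher_vderiv (Suc k) I g = (\<lambda>t. vector_derivative (higher_vderiv k I g) (at t within I))"

definition times_differentiable_on ::
  "nat \<Rightarrow> real set \<Rightarrow> (real \<Rightarrow> 'a::real_normed_vector) \<Rightarrow> bool" where
  "times_differentiable_on m I g \<longleftrightarrow>
     (\<forall>k<m. \<forall>t\<in>I. higher_vderiv k I g differentiable (at t within I))"

definition Cm_curve :: "nat \<Rightarrow> real set \<Rightarrow> (real \<Rightarrow> 'a::real_normed_vector) \<Rightarrow> bool" where
  "Cm_curve m I g \<longleftrightarrow> times_differentiable_on m I g \<and> continuous_on I (higher_vderiv m I g)"

text \<open>\<open>C\<^sup>m\<close> functions on an open subset \<open>D\<close> of a finite-dimensional space: all iterated
  directional derivatives of order up to \<open>m\<close> exist and are continuous.\<close>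

primrec Cm_on ::
  "nat \<Rightarrow> 'a::euclidean_space set \<Rightarrow> ('a \<Rightarrow> 'b::real_normed_vector) \<Rightarrow> bool" where
  "Cm_on 0 D f \<longleftrightarrow> continuous_on D f"
| "Cm_on (Suc m) D f \<longleftrightarrow> (\<forall>p\<in>D. f differentiable (at p)) \<and>
     (\<forall>v. Cm_on m D (\<lambda>p. frechet_derivative f (at p) v))"

text \<open>The points are given as a sequence \<open>x\<close>, of which only \<open>x 0, \<dots>, x k\<close> matter.\<close>

primrec divdiff_distinct :: "nat \<Rightarrow> (real \<Rightarrow> real) \<Rightarrow> (nat \<Rightarrow> real) \<Rightarrow> real" where
  "divdiff_distinct 0 g x = g (x 0)"
| "divdiff_distinct (Suc k) g x =
     (divdiff_distinct k g x - divdiff_distinct k g (\<lambda>i. x (Suc i))) / (x 0 - x (Suc k))"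

text \<open>Extension by continuity to coinciding points; the limit is taken in the product topology
  on sequences.\<close>

definition divdiff :: "nat \<Rightarrow> (real \<Rightarrow> real) \<Rightarrow> (nat \<Rightarrow> real) \<Rightarrow> real" where
  "divdiff k g x =
     (if inj_on x {..k} then divdiff_distinct k g x
      else Lim (at x within {z. inj_on z {..k}}) (divdiff_distinct k g))"

definition divdiff2 ::
  "nat \<Rightarrow> nat \<Rightarrow> (real \<times> real \<Rightarrow> real) \<Rightarrow> (nat \<Rightarrow> real) \<Rightarrow> (nat \<Rightarrow> real) \<Rightarrow> real" where
  "divdiff2 k r f x y = divdiff k (\<lambda>u. divdiff r (\<lambda>v. f (u, v)) y) x"

text \<open>A pair \<open>(a, b)\<close> of lists stands for \<open>(i\<^sub>1,\<dots>,i\<^sub>k) \<union> (i\<^sub>k\<^sub>+\<^sub>1,\<dots>,i\<^sub>j)\<close>,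
  with \<open>k = length a\<close> and \<open>j = length a + length b\<close>.\<close>

definition index_set :: "nat \<Rightarrow> (nat list \<times> nat list) set" where
  "index_set l = {(a, b). length a + length b \<ge> 1 \<and> sum_list a + sum_list b = l \<and>
     (\<forall>i \<in> set a \<union> set b. i \<ge> 1)}"

text \<open>In the next two definitions \<open>w\<close> is the list \<open>s\<^sub>1, \<dots>, s\<^sub>j\<^sub>+\<^sub>1\<close>, indexed from \<open>0\<close>.\<close>

definition dd_entry ::
  "(real \<times> real \<Rightarrow> real) \<Rightarrow> ('n \<Rightarrow> real) \<Rightarrow> ('n \<Rightarrow> real) \<Rightarrow> nat \<Rightarrow> nat \<Rightarrow> 'n list \<Rightarrow> real" where
  "dd_entry f x y k j w =
     divdiff2 k (j - k) f (\<lambda>i. x (w ! i)) (\<lambda>i. y (w ! (k + i)))"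

definition deriv_entry ::
  "(nat \<Rightarrow> complex^'n^'n) \<Rightarrow> (nat \<Rightarrow> complex^'n^'n) \<Rightarrow> nat list \<Rightarrow> nat list \<Rightarrow> 'n list \<Rightarrow> complex" where
  "deriv_entry \<Gamma> \<Delta> a b w =
     (\<Prod>q<length a. \<Gamma> (a ! q) $ (w ! q) $ (w ! Suc q)) *
     (\<Prod>q<length b. \<Delta> (b ! q) $ (w ! (length a + q)) $ (w ! Suc (length a + q)))"

end

theory Submission
  imports Defs
begin

text \<open>Let \<open>p\<^sub>a = (x\<^sub>a, y\<^sub>a)\<close> be the joint eigenvalues and
  \<open>P\<^sub>a\<close> the matching spectral projections, so that \<open>F(S, T) =
  \<Sum>\<^sub>a f(p\<^sub>a) P\<^sub>a\<close>. Along the curve neither the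
  \<open>p\<^sub>a\<close> nor the \<open>P\<^sub>a\<close> need be differentiable, so this sum
  cannot be differentiated term by term. Differences of such sums can nevertheless be computed
  exactly. If primes denote a second commuting pair, then \<open>P'\<^sub>a (S' - S) P\<^sub>b =
  (x'\<^sub>a - x\<^sub>b) P'\<^sub>a P\<^sub>b\<close>, likewise for \<open>T\<close>, and both
  families of projections sum to the identity. Writing \<open>f(p'\<^sub>a) - f(p\<^sub>b)\<close>
  as \<open>(x'\<^sub>a - x\<^sub>b) f[x'\<^sub>a, x\<^sub>b; y\<^sub>b] + (y'\<^sub>a - y\<^sub>b)
  f[x'\<^sub>a; y'\<^sub>a, y\<^sub>b]\<close> therefore gives \<open>F(S', T') - F(S, T) =
  \<Sum>\<^sub>a\<^sub>b f[x'\<^sub>a, x\<^sub>b; y\<^sub>b] P'\<^sub>a (S' - S) P\<^sub>b +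
  \<Sum>\<^sub>a\<^sub>b f[x'\<^sub>a; y'\<^sub>a, y\<^sub>b] P'\<^sub>a (T' - T) P\<^sub>b\<close>.

  The same identity holds at each position of a spectral sum \<open>\<Sum> \<Phi>(p\<^sub>a\<^sub>0,
  \<dots>, p\<^sub>a\<^sub>j) P\<^sub>a\<^sub>0 X\<^sub>1 P\<^sub>a\<^sub>1 \<cdots> X\<^sub>j
  P\<^sub>a\<^sub>j\<close> whose symbol \<open>\<Phi>\<close> is a divided difference
  (\<open>spectral_sum_perturb\<close>). After division by \<open>t - t\<^sub>0\<close>, the limit \<open>t
  \<rightarrow> t\<^sub>0\<close> uses only that symbols are continuous
  (\<open>spectral_sum_curve_tendsto\<close>): unitary matrices form a compact set, so every sequence of
  times has a subsequence along which the eigenvectors converge to some diagonalization of the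
  limiting pair, and the value of a spectral sum does not depend on the diagonalization
  (\<open>spectral_sum_unique\<close>). Hence a spectral sum is differentiable, and its derivative arises by
  inserting \<open>S'\<close> or \<open>T'\<close> between two factors, with the corresponding
  higher divided difference as symbol, or by differentiating one of the factors
  (\<open>spectral_sum_at_has_derivative\<close>). An induction on \<open>l\<close> now yields the
  formula. Each step inserts a part \<open>1\<close> into, or increases a part of, a pair of
  compositions of \<open>l\<close>, and the multinomial weights count the ways to arrive at a given
  pair of compositions of \<open>l + 1\<close> (\<open>sum_composition_pairs_Suc\<close>). The Schur products
  appear when the spectral sum is written entrywise in the eigenbasis
  (\<open>conj_formula_term_nth\<close>).

  What this requires of a divided difference is continuity and the insertion identity, at coinciding
  points too. For distinct points the divided difference is the Lagrange sum, which makes the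
  identity plain. Continuity comes from the Hermite--Genocchi formula, here in the recursive form
  \<open>g[x\<^sub>0, \<dots>, x\<^sub>k\<^sub>+\<^sub>1] = \<integral>\<^sub>0\<^sup>1 s\<^sup>k
  g'[(1 - s) x\<^sub>0 + s x\<^sub>1, \<dots>, (1 - s) x\<^sub>0 + s x\<^sub>k\<^sub>+\<^sub>1]
  ds\<close>, applied in both variables. The integral is continuous wherever it is defined and
  agrees with the Lagrange sum on the dense set of distinct points, so the identity and the
  definition by limits extend to it (\<open>hg_integral_distinct\<close>, \<open>hg_integral_diff_x\<close>,
  \<open>hg_integral_diff_y\<close>, \<open>divdiff2_eq_hg_integral\<close>).\<close>

section \<open>The Lagrange form of divided differences\<close>

text \<open>Indexing by a finite set of points, rather than by a sequence, makes the symmetry of divided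
  differences automatic.\<close>

definition lagrange :: "(real \<Rightarrow> real) \<Rightarrow> real set \<Rightarrow> real" where
  "lagrange g A = (\<Sum>a\<in>A. g a / (\<Prod>b\<in>A - {a}. a - b))"

text \<open>Dropping \<open>b\<close> removes the factor \<open>c - b\<close> from each denominator. The
  term for \<open>c = b\<close>, although absent on the left, is harmless on the right because it
  vanishes. All the sums being over the same set \<open>A\<close>, they can be subtracted termwise.\<close>

lemma lagrange_remove:
  assumes "finite A" "b \<in> A"
  shows "lagrange g (A - {b}) = (\<Sum>c\<in>A. g c * (c - b) / (\<Prod>d\<in>A - {c}. c - d))"
proof -
  have "g c * (c - b) / (\<Prod>d\<in>A - {c}. c - d) = g c / (\<Prod>d\<in>A - {b} - {c}. c - d)"
    if c: "c \<in> A - {b}" for c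
  proof -
    have "(\<Prod>d\<in>A - {c}. c - d) = (c - b) * (\<Prod>d\<in>A - {c} - {b}. c - d)"
      using assms c by (subst prod.remove[of _ b]) auto
    moreover have "A - {c} - {b} = A - {b} - {c}" by auto
    ultimately show ?thesis using c by auto
  qed
  then have "lagrange g (A - {b}) = (\<Sum>c\<in>A - {b}. g c * (c - b) / (\<Prod>d\<in>A - {c}. c - d))"
    unfolding lagrange_def by (intro sum.cong) auto
  also have "\<dots> = (\<Sum>c\<in>A. g c * (c - b) / (\<Prod>d\<in>A - {c}. c - d))"
    using assms by (subst (2) sum.remove[of _ b]) auto
  finally show ?thesis .
qed

text \<open>The recursion of divided differences in which any two of the points may be singled out. The
  form in the definition of \<open>divdiff_distinct\<close> only allows the first and the last one.\<close>

lemma lagrange_diff: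
  assumes "finite A" "a \<in> A" "b \<in> A"
  shows "lagrange g (A - {b}) - lagrange g (A - {a}) = (a - b) * lagrange g A"
  unfolding lagrange_remove[OF assms(1,3)] lagrange_remove[OF assms(1,2)]
  unfolding lagrange_def sum_subtractf[symmetric] sum_distrib_left
  by (intro sum.cong) (auto simp: diff_divide_distrib[symmetric] algebra_simps)

lemma lagrange_const:
  assumes "finite A" "card A = Suc (Suc n)"
  shows "lagrange (\<lambda>_. 1) A = 0"
  using assms
proof (induction n arbitrary: A)
  case 0
  then obtain a b where "A = {a, b}" "a \<noteq> b"
    by (metis card_2_iff numeral_2_eq_2)
  moreover have "{a, b} - {a} = {b}" "{a, b} - {b} = {a}" using \<open>a \<noteq> b\<close> by auto
  ultimately show ?case by (simp add: lagrange_def field_simps)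
next
  case (Suc n)
  then obtain a b where ab: "a \<in> A" "b \<in> A" "a \<noteq> b"
    by (metis card_Suc_eq insertCI)
  have "lagrange (\<lambda>_. 1) (A - {b}) = 0" "lagrange (\<lambda>_. 1) (A - {a}) = 0"
    using Suc ab by (auto intro!: Suc.IH)
  with lagrange_diff[OF Suc.prems(1) ab(1,2), of "\<lambda>_. 1"] ab show ?case by auto
qed

lemma lagrange_image:
  assumes "inj_on x K"
  shows "lagrange g (x ` K) = (\<Sum>i\<in>K. g (x i) / (\<Prod>j\<in>K - {i}. x i - x j))"
proof -
  have "(\<Prod>b\<in>x ` K - {x i}. x i - b) = (\<Prod>j\<in>K - {i}. x i - x j)" if "i \<in> K" for i
  proof -
    have "x ` K - {x i} = x ` (K - {i})" using assms that by (auto simp: inj_on_def)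
    then show ?thesis
      using assms by (simp add: prod.reindex inj_on_diff)
  qed
  then show ?thesis
    unfolding lagrange_def using assms by (simp add: sum.reindex)
qed

lemma lagrange_singleton [simp]: "lagrange g {a} = g a"
  by (simp add: lagrange_def)

lemma divdiff_distinct_eq_lagrange:
  "inj_on x {..k} \<Longrightarrow> divdiff_distinct k g x = lagrange g (x ` {..k})"
proof (induction k arbitrary: x)
  case 0
  then show ?case by simp
next
  case (Suc k)
  have 1: "x ` {..k} = x ` {..Suc k} - {x (Suc k)}"
    using Suc.prems by (auto simp: inj_on_def atMost_Suc)
  have 2: "(\<lambda>i. x (Suc i)) ` {..k} = x ` {..Suc k} - {x 0}"
  proof -
    have "(\<lambda>i. x (Suc i)) ` {..k} = x ` (Suc ` {..k})" by auto
    also have "Suc ` {..k} = {..Suc k} - {0}"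
      by (auto simp: atMost_Suc_eq_insert_0)
    also have "x ` \<dots> = x ` {..Suc k} - {x 0}" using Suc.prems by (auto simp: inj_on_def)
    finally show ?thesis .
  qed
  have "inj_on x {..k}" "inj_on (\<lambda>i. x (Suc i)) {..k}"
    using Suc.prems by (auto simp: inj_on_def)
  moreover have "x 0 \<noteq> x (Suc k)" using Suc.prems by (auto simp: inj_on_def)
  ultimately show ?case
    using lagrange_diff[of "x ` {..Suc k}" "x 0" "x (Suc k)" g]
    by (simp only: divdiff_distinct.simps Suc.IH 1 2) (auto simp: field_simps)
qed

text \<open>The points \<open>x\<^sub>1, x\<^sub>2, \<dots>\<close> shrunk towards
  \<open>x\<^sub>0\<close> by the factor \<open>s\<close>: the nodes of the inner divided difference
  in the recursive Hermite--Genocchi formula.\<close>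

definition contract :: "real \<Rightarrow> (nat \<Rightarrow> real) \<Rightarrow> nat \<Rightarrow> real" where
  "contract s x = (\<lambda>i. (1 - s) * x 0 + s * x (Suc i))"

lemma contract_in:
  assumes "is_interval J" "\<forall>i\<le>Suc k. x i \<in> J" "s \<in> {0..1}" "i \<le> k"
  shows "contract s x i \<in> J"
  using assms convexD[of J "x 0" "x (Suc i)" "1 - s" s]
  by (simp add: contract_def is_interval_convex_1)

text \<open>All differences of contracted points carry a factor \<open>s\<close>, so \<open>s ^ k\<close>
  cancels against the denominators and the integrand is a combination of the functions \<open>g'
  (x\<^sub>0 + s (x\<^sub>i - x\<^sub>0))\<close> with constant coefficients. Each integrates to
  \<open>(g x\<^sub>i - g x\<^sub>0) / (x\<^sub>i - x\<^sub>0)\<close>, and the coefficients of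
  \<open>g x\<^sub>0\<close> add up correctly because the Lagrange sum of a constant is zero.\<close>

lemma hermite_genocchi_step:
  assumes inj: "inj_on x {..Suc k}" and J: "is_interval J" and x: "\<forall>i\<le>Suc k. x i \<in> J"
    and g: "\<And>u. u \<in> J \<Longrightarrow> (g has_real_derivative g' u) (at u)"
  shows "((\<lambda>s. s ^ k * lagrange g' (contract s x ` {..k})) has_integral
            lagrange g (x ` {..Suc k})) {0..1}"
proof -
  define w where "w i = (\<Prod>j\<in>{..k} - {i}. x (Suc i) - x (Suc j))" for i
  have ne: "x (Suc i) \<noteq> x 0" if "i \<le> k" for i using inj that by (auto simp: inj_on_def)
  have split: "lagrange h (x ` {..Suc k}) =
     h (x 0) / (\<Prod>j\<in>{..Suc k} - {0}. x 0 - x j) + (\<Sum>i\<le>k. h (x (Suc i)) / ((x (Suc i) - x 0) * w i))" for h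
  proof -
    have "(\<Prod>j\<in>{..Suc k} - {Suc i}. x (Suc i) - x j) = (x (Suc i) - x 0) * w i" if "i \<le> k" for i
    proof -
      have "(\<Prod>j\<in>{..Suc k} - {Suc i}. x (Suc i) - x j)
          = (x (Suc i) - x 0) * (\<Prod>j\<in>{..Suc k} - {Suc i} - {0}. x (Suc i) - x j)"
        by (subst prod.remove[of _ 0]) auto
      also have "{..Suc k} - {Suc i} - {0} = Suc ` ({..k} - {i})"
        by (auto simp: atMost_Suc_eq_insert_0)
      also have "(\<Prod>j\<in>\<dots>. x (Suc i) - x j) = w i"
        unfolding w_def by (subst prod.reindex) auto
      finally show ?thesis .
    qed
    then show ?thesis
      by (subst lagrange_image[OF inj], subst sum.atMost_Suc_shift) auto
  qed
  have "lagrange (\<lambda>_. 1) (x ` {..Suc k}) = 0"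
    using inj by (intro lagrange_const[of _ k]) (auto simp: card_image)
  \<comment> \<open>The vanishing Lagrange sum of the constant 1, solved for the term of the base
    point.\<close>
  then have w0: "1 / (\<Prod>j\<in>{..Suc k} - {0}. x 0 - x j) = - (\<Sum>i\<le>k. 1 / ((x (Suc i) - x 0) * w i))"
    unfolding split by linarith
  have int: "((\<lambda>s. g' (contract s x i)) has_integral (g (x (Suc i)) - g (x 0)) / (x (Suc i) - x 0)) {0..1}"
    if "i \<le> k" for i
  proof -
    have "((\<lambda>s. g (contract s x i) / (x (Suc i) - x 0)) has_vector_derivative g' (contract s x i))
            (at s within {0..1})" if s: "s \<in> {0..1}" for s
    proof -
      have "contract s x i \<in> J"
        using contract_in[OF J x s \<open>i \<le> k\<close>] .
      from g[OF this] have "((\<lambda>s. g (contract s x i)) has_real_derivative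
          g' (contract s x i) * (x (Suc i) - x 0)) (at s)"
        by (rule DERIV_chain2) (auto simp: contract_def intro!: derivative_eq_intros)
      then have "((\<lambda>s. g (contract s x i) / (x (Suc i) - x 0)) has_real_derivative
          g' (contract s x i) * (x (Suc i) - x 0) / (x (Suc i) - x 0)) (at s)"
        by (rule DERIV_cdivide)
      then show ?thesis using ne[OF \<open>i \<le> k\<close>]
        by (simp add: has_real_derivative_iff_has_vector_derivative has_vector_derivative_at_within)
    qed
    from fundamental_theorem_of_calculus[OF _ this] show ?thesis
      by (simp add: contract_def diff_divide_distrib)
  qed
  have "((\<lambda>s. \<Sum>i\<le>k. g' (contract s x i) / w i) has_integral
          (\<Sum>i\<le>k. (g (x (Suc i)) - g (x 0)) / (x (Suc i) - x 0) / w i)) {0..1}"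
    by (intro has_integral_sum has_integral_divide int) auto
  also have "(\<Sum>i\<le>k. (g (x (Suc i)) - g (x 0)) / (x (Suc i) - x 0) / w i) = lagrange g (x ` {..Suc k})"
  proof -
    have "g (x 0) / (\<Prod>j\<in>{..Suc k} - {0}. x 0 - x j) = g (x 0) * (1 / (\<Prod>j\<in>{..Suc k} - {0}. x 0 - x j))"
      by simp
    also have "\<dots> = - (\<Sum>i\<le>k. g (x 0) / ((x (Suc i) - x 0) * w i))"
      unfolding w0 by (simp add: sum_distrib_left)
    finally show ?thesis
      unfolding split by (simp add: diff_divide_distrib sum_subtractf)
  qed
  finally show ?thesis
  proof (rule has_integral_spike_finite[of "{0}", rotated 2])
    \<comment> \<open>At \<open>s = 0\<close> all contracted points coincide and the Lagrange sum
      is meaningless, but one point has measure zero.\<close>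
    fix s :: real assume "s \<in> {0..1} - {0}"
    then have s: "s \<noteq> 0" by auto
    have inj': "inj_on (contract s x) {..k}"
      using inj s by (auto simp: inj_on_def contract_def)
    have "g' (contract s x i) / (\<Prod>j\<in>{..k} - {i}. contract s x i - contract s x j)
        = g' (contract s x i) / w i / s ^ k" if "i \<le> k" for i
    proof -
      have "(\<Prod>j\<in>{..k} - {i}. contract s x i - contract s x j)
         = (\<Prod>j\<in>{..k} - {i}. s * (x (Suc i) - x (Suc j)))"
        by (simp add: contract_def algebra_simps)
      also have "\<dots> = s ^ k * w i"
        using that by (simp add: prod.distrib w_def)
      finally show ?thesis by simp
    qed
    then have "lagrange g' (contract s x ` {..k}) = (\<Sum>i\<le>k. g' (contract s x i) / w i / s ^ k)"
      unfolding lagrange_image[OF inj'] by (intro sum.cong) auto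
    then show "s ^ k * lagrange g' (contract s x ` {..k}) = (\<Sum>i\<le>k. g' (contract s x i) / w i)"
      using s by (simp add: sum_distrib_left)
  qed auto
qed

section \<open>Two-variable divided differences as iterated integrals\<close>

definition partial_x :: "(real \<times> real \<Rightarrow> real) \<Rightarrow> real \<times> real \<Rightarrow> real" where
  "partial_x f p = frechet_derivative f (at p) (1, 0)"

definition partial_y :: "(real \<times> real \<Rightarrow> real) \<Rightarrow> real \<times> real \<Rightarrow> real" where
  "partial_y f p = frechet_derivative f (at p) (0, 1)"

lemma Cm_on_partial_x: "Cm_on (Suc m) D f \<Longrightarrow> Cm_on m D (partial_x f)"
  and Cm_on_partial_y: "Cm_on (Suc m) D f \<Longrightarrow> Cm_on m D (partial_y f)"
  unfolding partial_x_def[abs_def] partial_y_def[abs_def] by simp_all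

lemma Cm_on_SucD: "Cm_on (Suc m) D f \<Longrightarrow> Cm_on m D f"
  by (induction m arbitrary: f)
    (auto intro!: continuous_at_imp_continuous_on differentiable_imp_continuous_within)

lemma Cm_on_le: "Cm_on m D f \<Longrightarrow> k \<le> m \<Longrightarrow> Cm_on k D f"
  by (induction m) (auto simp: le_Suc_eq dest: Cm_on_SucD simp del: Cm_on.simps)

lemma Cm_on_has_partial_x:
  assumes "Cm_on (Suc m) D f" "(u, v) \<in> D"
  shows "((\<lambda>u. f (u, v)) has_real_derivative partial_x f (u, v)) (at u)"
proof -
  have "(f has_derivative frechet_derivative f (at (u, v))) (at (u, v))"
    using assms by (auto simp: frechet_derivative_works[symmetric])
  then have "((\<lambda>u. f (u, v)) has_derivative (\<lambda>h. frechet_derivative f (at (u, v)) (h, 0))) (at u)"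
    by (rule has_derivative_compose[rotated]) (auto intro!: derivative_eq_intros)
  moreover have "frechet_derivative f (at (u, v)) (h, 0) = partial_x f (u, v) * h" for h
  proof -
    have "linear (frechet_derivative f (at (u, v)))"
      using assms by (auto intro!: linear_frechet_derivative)
    from linear_scale[OF this, of h "(1, 0)"] show ?thesis by (simp add: partial_x_def)
  qed
  then have "(\<lambda>h. frechet_derivative f (at (u, v)) (h, 0)) = (*) (partial_x f (u, v))" by (rule ext)
  ultimately show ?thesis by (simp add: has_field_derivative_def)
qed

lemma Cm_on_has_partial_y:
  assumes "Cm_on (Suc m) D f" "(u, v) \<in> D"
  shows "((\<lambda>v. f (u, v)) has_real_derivative partial_y f (u, v)) (at v)"
proof -
  have "(f has_derivative frechet_derivative f (at (u, v))) (at (u, v))"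
    using assms by (auto simp: frechet_derivative_works[symmetric])
  then have "((\<lambda>v. f (u, v)) has_derivative (\<lambda>h. frechet_derivative f (at (u, v)) (0, h))) (at v)"
    by (rule has_derivative_compose[rotated]) (auto intro!: derivative_eq_intros)
  moreover have "frechet_derivative f (at (u, v)) (0, h) = partial_y f (u, v) * h" for h
  proof -
    have "linear (frechet_derivative f (at (u, v)))"
      using assms by (auto intro!: linear_frechet_derivative)
    from linear_scale[OF this, of h "(0, 1)"] show ?thesis by (simp add: partial_y_def)
  qed
  then have "(\<lambda>h. frechet_derivative f (at (u, v)) (0, h)) = (*) (partial_y f (u, v))" by (rule ext)
  ultimately show ?thesis by (simp add: has_field_derivative_def)
qed

text \<open>The \<open>x\<close>-derivatives are taken first and the \<open>y\<close>-derivatives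
  afterwards. With this order the comparison with Lagrange sums needs only derivatives of finite
  sums, and never the interchange of two partial derivatives or the differentiation of an integral.\<close>

fun hg_integral :: "nat \<Rightarrow> nat \<Rightarrow> (real \<times> real \<Rightarrow> real) \<Rightarrow> (nat \<Rightarrow> real) \<Rightarrow> (nat \<Rightarrow> real) \<Rightarrow> real" where
  "hg_integral 0 0 f x y = f (x 0, y 0)"
| "hg_integral 0 (Suc r) f x y = integral {0..1} (\<lambda>s. s ^ r * hg_integral 0 r (partial_y f) x (contract s y))"
| "hg_integral (Suc k) r f x y = integral {0..1} (\<lambda>s. s ^ k * hg_integral k r (partial_x f) (contract s x) y)"

lemma hg_integral_cong:
  "(\<And>i. i \<le> k \<Longrightarrow> x i = x' i) \<Longrightarrow> (\<And>i. i \<le> r \<Longrightarrow> y i = y' i) \<Longrightarrow> hg_integral k r f x y = hg_integral k r f x' y'"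
proof (induction k r f x y arbitrary: x' y' rule: hg_integral.induct)
  case (1 f x y)
  then show ?case by simp
next
  case (2 r f x y)
  have "hg_integral 0 r (partial_y f) x (contract s y) = hg_integral 0 r (partial_y f) x' (contract s y')" for s
    using "2.prems" by (intro "2.IH") (auto simp: contract_def)
  then show ?case by simp
next
  case (3 k r f x y)
  have "hg_integral k r (partial_x f) (contract s x) y = hg_integral k r (partial_x f) (contract s x') y'" for s
    using "3.prems" by (intro "3.IH") (auto simp: contract_def)
  then show ?case by simp
qed

text \<open>Only the first coordinates of each sequence are constrained, so the set is open in the
  product topology and the sequences may be spread or truncated freely.\<close>

definition grid :: "real set \<Rightarrow> real set \<Rightarrow> nat \<Rightarrow> nat \<Rightarrow> ((nat \<Rightarrow> real) \<times> (nat \<Rightarrow> real)) set" where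
  "grid J1 J2 k r = {(x, y). (\<forall>i\<le>k. x i \<in> J1) \<and> (\<forall>i\<le>r. y i \<in> J2)}"

lemma continuous_on_fst_coordinate:
  "continuous_on A (\<lambda>p :: (nat \<Rightarrow> real) \<times> 'b :: topological_space. fst p i)"
  by (rule continuous_on_product_then_coordinatewise[OF continuous_on_fst[OF continuous_on_id]])

lemma continuous_on_snd_coordinate:
  "continuous_on A (\<lambda>p :: 'b :: topological_space \<times> (nat \<Rightarrow> real). snd p i)"
  by (rule continuous_on_product_then_coordinatewise[OF continuous_on_snd[OF continuous_on_id]])

lemma continuous_on_contract:
  "continuous_on A (\<lambda>(x, s). contract s x)"
  unfolding contract_def case_prod_beta
  by (intro continuous_on_coordinatewise_then_product continuous_on_add continuous_on_mult
     continuous_on_diff continuous_on_const continuous_on_snd continuous_on_id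
     continuous_on_fst_coordinate)

text \<open>The recursion consists of parameter integrals over a compact interval, so continuity of the
  partial derivatives is passed on from one level to the next.\<close>

lemma hg_integral_continuous:
  assumes J: "is_interval J1" "is_interval J2"
  shows "Cm_on (k + r) (J1 \<times> J2) f \<Longrightarrow> continuous_on (grid J1 J2 k r) (\<lambda>(x, y). hg_integral k r f x y)"
proof (induction k arbitrary: f)
  case 0
  then show ?case
  proof (induction r arbitrary: f)
    case 0
    have cf: "continuous_on (J1 \<times> J2) f" using 0 by simp
    have "continuous_on (grid J1 J2 0 0) (\<lambda>p. f (fst p 0, snd p 0))"
      by (rule continuous_on_compose2[OF cf continuous_on_Pair[OF continuous_on_fst_coordinate
           continuous_on_snd_coordinate]]) (auto simp: grid_def)
    then show ?case by (simp add: case_prod_beta)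
  next
    case (Suc r)
    have IH: "continuous_on (grid J1 J2 0 r) (\<lambda>(x, y). hg_integral 0 r (partial_y f) x y)"
      using Suc.prems by (intro Suc.IH) (auto intro: Cm_on_partial_y simp del: Cm_on.simps)
    have "continuous_on (grid J1 J2 0 (Suc r) \<times> {0..1})
      (\<lambda>q. (fst (fst q), case (snd (fst q), snd q) of (y, s) \<Rightarrow> contract s y))"
      by (rule continuous_on_Pair continuous_on_fst continuous_on_snd continuous_on_id
           continuous_on_compose2[OF continuous_on_contract[of UNIV]] subset_UNIV)+
    note cont = continuous_on_compose2[OF IH this]
    have "continuous_on (grid J1 J2 0 (Suc r) \<times> {0..1})
      (\<lambda>q. hg_integral 0 r (partial_y f) (fst (fst q)) (contract (snd q) (snd (fst q))))"
      using cont[unfolded case_prod_beta] J by (simp add: image_subset_iff) (auto simp: grid_def contract_in)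
    then have "continuous_on (grid J1 J2 0 (Suc r) \<times> cbox 0 1)
      (\<lambda>(p, s). s ^ r * hg_integral 0 r (partial_y f) (fst p) (contract s (snd p)))"
      by (auto simp: case_prod_beta intro!: continuous_on_mult continuous_on_power continuous_on_snd continuous_on_id)
    from integral_continuous_on_param[OF this] show ?case
      by (simp add: case_prod_beta)
  qed
next
  case (Suc k)
  have IH: "continuous_on (grid J1 J2 k r) (\<lambda>(x, y). hg_integral k r (partial_x f) x y)"
    using Suc.prems by (intro Suc.IH) (auto intro: Cm_on_partial_x simp del: Cm_on.simps)
  have "continuous_on (grid J1 J2 (Suc k) r \<times> {0..1})
    (\<lambda>q. (case (fst (fst q), snd q) of (x, s) \<Rightarrow> contract s x, snd (fst q)))"
    by (rule continuous_on_Pair continuous_on_fst continuous_on_snd continuous_on_id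
           continuous_on_compose2[OF continuous_on_contract[of UNIV]] subset_UNIV)+
  note cont = continuous_on_compose2[OF IH this]
  have "continuous_on (grid J1 J2 (Suc k) r \<times> {0..1})
    (\<lambda>q. hg_integral k r (partial_x f) (contract (snd q) (fst (fst q))) (snd (fst q)))"
    using cont[unfolded case_prod_beta] J by (simp add: image_subset_iff) (auto simp: grid_def contract_in)
  then have "continuous_on (grid J1 J2 (Suc k) r \<times> cbox 0 1)
    (\<lambda>(p, s). s ^ k * hg_integral k r (partial_x f) (contract s (fst p)) (snd p))"
    by (auto simp: case_prod_beta intro!: continuous_on_mult continuous_on_power continuous_on_snd continuous_on_id)
  from integral_continuous_on_param[OF this] show ?case
    by (simp add: case_prod_beta)
qed

lemma inj_on_contract:
  assumes "inj_on x {..Suc k}" "s \<noteq> 0"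
  shows "inj_on (contract s x) {..k}"
  using assms by (auto simp: inj_on_def contract_def)

text \<open>For fixed distinct \<open>y\<close>, the inner Lagrange sum is a finite combination of the
  functions \<open>u \<mapsto> f (u, b)\<close>, whose derivative is the same combination of partial
  derivatives. So the one-variable step applies in each variable in turn.\<close>

lemma hg_integral_distinct:
  assumes J: "is_interval J1" "is_interval J2"
  shows "Cm_on (k + r) (J1 \<times> J2) f \<Longrightarrow> (x, y) \<in> grid J1 J2 k r \<Longrightarrow> inj_on x {..k} \<Longrightarrow> inj_on y {..r} \<Longrightarrow>
    hg_integral k r f x y = lagrange (\<lambda>u. lagrange (\<lambda>v. f (u, v)) (y ` {..r})) (x ` {..k})"
proof (induction k arbitrary: f x)
  case 0
  then show ?case
  proof (induction r arbitrary: f y)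
    case 0
    then show ?case by simp
  next
    case (Suc r)
    have y: "\<forall>i\<le>Suc r. y i \<in> J2" and x: "x 0 \<in> J1" using Suc.prems by (auto simp: grid_def)
    have "((\<lambda>s. s ^ r * lagrange (\<lambda>v. partial_y f (x 0, v)) (contract s y ` {..r})) has_integral
            lagrange (\<lambda>v. f (x 0, v)) (y ` {..Suc r})) {0..1}"
      using Suc.prems x
      by (intro hermite_genocchi_step[OF Suc.prems(4) J(2) y] Cm_on_has_partial_y[of r "J1 \<times> J2"]) auto
    then have "((\<lambda>s. s ^ r * hg_integral 0 r (partial_y f) x (contract s y)) has_integral
            lagrange (\<lambda>v. f (x 0, v)) (y ` {..Suc r})) {0..1}"
    proof (rule has_integral_spike_finite[of "{0}", rotated 2])
      fix s :: real assume s: "s \<in> {0..1} - {0}"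
      have "hg_integral 0 r (partial_y f) x (contract s y)
          = lagrange (\<lambda>u. lagrange (\<lambda>v. partial_y f (u, v)) (contract s y ` {..r})) (x ` {..0})"
        using Suc.prems s J x y
        by (intro Suc.IH inj_on_contract) (auto intro: Cm_on_partial_y contract_in simp: grid_def simp del: Cm_on.simps)
      then show "s ^ r * hg_integral 0 r (partial_y f) x (contract s y)
          = s ^ r * lagrange (\<lambda>v. partial_y f (x 0, v)) (contract s y ` {..r})" by simp
    qed auto
    then show ?case by (simp add: integral_unique)
  qed
next
  case (Suc k)
  have x: "\<forall>i\<le>Suc k. x i \<in> J1" and y: "\<forall>i\<le>r. y i \<in> J2" using Suc.prems by (auto simp: grid_def)
  have "((\<lambda>s. s ^ k * lagrange (\<lambda>u. lagrange (\<lambda>v. partial_x f (u, v)) (y ` {..r})) (contract s x ` {..k}))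
          has_integral lagrange (\<lambda>u. lagrange (\<lambda>v. f (u, v)) (y ` {..r})) (x ` {..Suc k})) {0..1}"
  proof (rule hermite_genocchi_step[OF Suc.prems(3) J(1) x])
    fix u assume "u \<in> J1"
    then have "((\<lambda>u. f (u, b)) has_real_derivative partial_x f (u, b)) (at u)" if "b \<in> y ` {..r}" for b
      using Suc.prems that y by (intro Cm_on_has_partial_x[of "k + r" "J1 \<times> J2"]) auto
    then show "((\<lambda>u. lagrange (\<lambda>v. f (u, v)) (y ` {..r})) has_real_derivative
        lagrange (\<lambda>v. partial_x f (u, v)) (y ` {..r})) (at u)"
      unfolding lagrange_def by (intro DERIV_sum DERIV_cdivide)
  qed
  then have "((\<lambda>s. s ^ k * hg_integral k r (partial_x f) (contract s x) y)
          has_integral lagrange (\<lambda>u. lagrange (\<lambda>v. f (u, v)) (y ` {..r})) (x ` {..Suc k})) {0..1}"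
  proof (rule has_integral_spike_finite[of "{0}", rotated 2])
    fix s :: real assume s: "s \<in> {0..1} - {0}"
    have "hg_integral k r (partial_x f) (contract s x) y
        = lagrange (\<lambda>u. lagrange (\<lambda>v. partial_x f (u, v)) (y ` {..r})) (contract s x ` {..k})"
      using Suc.prems s J x y
      by (intro Suc.IH inj_on_contract) (auto intro: Cm_on_partial_x contract_in simp: grid_def simp del: Cm_on.simps)
    then show "s ^ k * hg_integral k r (partial_x f) (contract s x) y
        = s ^ k * lagrange (\<lambda>u. lagrange (\<lambda>v. partial_x f (u, v)) (y ` {..r})) (contract s x ` {..k})" by simp
  qed auto
  then show ?case by (simp add: integral_unique)
qed

section \<open>Continuity and insertion identities at coinciding points\<close>

text \<open>A perturbation that makes any finite set of nodes distinct: two coordinates meet for at most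
  one value of \<open>e\<close>. It serves to carry identities from distinct nodes to arbitrary ones
  by letting \<open>e\<close> tend to zero.\<close>

definition spread :: "(nat \<Rightarrow> real) \<Rightarrow> real \<Rightarrow> nat \<Rightarrow> real" where
  "spread x e = (\<lambda>i. x i + e * real i)"

lemma spread_tendsto: "(spread x \<longlongrightarrow> x) (at_right 0)"
proof -
  have "continuous_on UNIV (spread x)"
    unfolding spread_def by (intro continuous_on_coordinatewise_then_product continuous_on_add
      continuous_on_const continuous_on_mult continuous_on_id)
  then have "(spread x \<longlongrightarrow> spread x 0) (at 0)"
    by (simp add: continuous_on_def)
  then show ?thesis
    by (simp add: spread_def filterlim_at_split)
qed

lemma spread_tendsto_coordinate: "((\<lambda>e. spread x e i) \<longlongrightarrow> x i) (at_right 0)"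
  unfolding spread_def by (auto intro!: tendsto_eq_intros)

lemma spread_inj: "eventually (\<lambda>e. inj_on (spread x e) {..k}) (at_right 0)"
proof -
  have "eventually (\<lambda>e. spread x e i = spread x e j \<longrightarrow> i = j) (at_right 0)" for i j
  proof (cases "i = j")
    case False
    define c where "c = (x i - x j) / (real j - real i)"
    have "spread x e i = spread x e j \<longleftrightarrow> e = c" for e
      using False by (auto simp: spread_def c_def field_simps)
    moreover have "eventually (\<lambda>e. e \<noteq> c) (at_right 0)"
    proof (cases "c > 0")
      case True
      from eventually_at_right_real[OF this] show ?thesis by eventually_elim auto
    next
      case False
      have "eventually (\<lambda>e::real. e > 0) (at_right 0)" by (simp add: eventually_at_right_less)
      then show ?thesis by eventually_elim (use False in auto)
    qed
    ultimately show ?thesis using False by (simp add: not_frequently)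
  qed simp
  then have "eventually (\<lambda>e. \<forall>i\<in>{..k}. \<forall>j\<in>{..k}. spread x e i = spread x e j \<longrightarrow> i = j) (at_right 0)"
    by (intro eventually_ball_finite ballI) auto
  then show ?thesis by (simp add: inj_on_def)
qed

lemma open_grid:
  assumes "open J1" "open J2"
  shows "open (grid J1 J2 k r)"
proof -
  have "grid J1 J2 k r = (\<Inter>i\<in>{..k}. (\<lambda>p. fst p i) -` J1) \<inter> (\<Inter>i\<in>{..r}. (\<lambda>p. snd p i) -` J2)"
    by (auto simp: grid_def)
  moreover have "open ((\<lambda>p :: (nat \<Rightarrow> real) \<times> (nat \<Rightarrow> real). fst p i) -` J1)"
     "open ((\<lambda>p :: (nat \<Rightarrow> real) \<times> (nat \<Rightarrow> real). snd p i) -` J2)" for i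
    using assms
    by (auto intro!: open_vimage continuous_on_fst_coordinate continuous_on_snd_coordinate)
  ultimately show ?thesis by (auto intro!: open_Int open_INT)
qed

text \<open>Continuity in a form that lets the nodes converge along any filter.\<close>

lemma hg_integral_tendsto:
  assumes J: "is_interval J1" "is_interval J2" "open J1" "open J2"
    and f: "Cm_on (k + r) (J1 \<times> J2) f"
    and p: "(X \<longlongrightarrow> x) F" "(Y \<longlongrightarrow> y) F" "(x, y) \<in> grid J1 J2 k r"
  shows "((\<lambda>n. hg_integral k r f (X n) (Y n)) \<longlongrightarrow> hg_integral k r f x y) F"
proof -
  have "isCont (\<lambda>(x, y). hg_integral k r f x y) (x, y)"
    using hg_integral_continuous[OF J(1,2) f] open_grid[OF J(3,4)] p(3)
    by (simp add: continuous_on_eq_continuous_at)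
  from isCont_tendsto_compose[OF this tendsto_Pair[OF p(1,2)]] show ?thesis by simp
qed

lemma tendsto_compose_seq:
  assumes "(X \<longlongrightarrow> (x :: nat \<Rightarrow> real)) F"
  shows "((\<lambda>e i. X e (h i)) \<longlongrightarrow> (\<lambda>i. x (h i))) F"
proof -
  have "continuous_on UNIV (\<lambda>z :: nat \<Rightarrow> real. (\<lambda>i. z (h i)))"
    by (intro continuous_on_coordinatewise_then_product continuous_on_product_then_coordinatewise[of _ id, simplified] continuous_on_id)
  then have "((\<lambda>z i. z (h i)) \<longlongrightarrow> (\<lambda>i. x (h i))) (at x)"
    by (simp add: continuous_on_def)
  from tendsto_compose[OF this assms] show ?thesis .
qed

text \<open>The increasing enumeration of the indices other than \<open>i\<close>, so that \<open>x
  \<circ> skip i\<close> is \<open>x\<close> with its entry \<open>i\<close> removed.\<close>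

definition skip :: "nat \<Rightarrow> nat \<Rightarrow> nat" where
  "skip i j = (if j < i then j else Suc j)"

lemma skip_image: "i \<le> Suc k \<Longrightarrow> skip i ` {..k} = {..Suc k} - {i}"
proof (intro equalityI subsetI)
  fix j assume i: "i \<le> Suc k" and j: "j \<in> {..Suc k} - {i}"
  have "j = skip i (if j < i then j else j - 1)" "(if j < i then j else j - 1) \<in> {..k}"
    using i j by (auto simp: skip_def)
  then show "j \<in> skip i ` {..k}" by (rule image_eqI)
qed (auto simp: skip_def split: if_splits)

lemma inj_skip: "inj (skip i)"
  by (auto simp: skip_def inj_def)

lemma skip_points:
  assumes "inj_on x {..Suc k}" "i \<le> Suc k"
  shows "inj_on (\<lambda>j. x (skip i j)) {..k}" "(\<lambda>j. x (skip i j)) ` {..k} = x ` {..Suc k} - {x i}"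
proof -
  have "inj_on (x \<circ> skip i) {..k}"
    using assms by (intro comp_inj_on) (auto simp: skip_image inj_on_diff intro: inj_on_subset[OF inj_skip])
  then show "inj_on (\<lambda>j. x (skip i j)) {..k}" by (simp add: comp_def)
  have "(\<lambda>j. x (skip i j)) ` {..k} = x ` (skip i ` {..k})" by auto
  also have "\<dots> = x ` {..Suc k} - {x i}"
    using assms by (auto simp: skip_image inj_on_def)
  finally show "(\<lambda>j. x (skip i j)) ` {..k} = x ` {..Suc k} - {x i}" .
qed

lemma lagrange_diff_left:
  "lagrange (\<lambda>u. g u - h u) A = lagrange g A - lagrange h A"
  "lagrange (\<lambda>u. c * g u) A = c * lagrange g A"
  by (simp_all add: lagrange_def diff_divide_distrib sum_subtractf sum_distrib_left)

text \<open>Both sides are continuous in the nodes, so it suffices to compare them for distinct nodes,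
  where the claim is the Lagrange recursion.\<close>

lemma hg_integral_diff_x:
  assumes J: "is_interval J1" "is_interval J2" "open J1" "open J2"
    and f: "Cm_on (Suc k + r) (J1 \<times> J2) f"
    and xy: "(x, y) \<in> grid J1 J2 (Suc k) r" and i: "i \<le> k"
  shows "hg_integral k r f (\<lambda>j. x (skip (Suc i) j)) y - hg_integral k r f (\<lambda>j. x (skip i j)) y
    = (x i - x (Suc i)) * hg_integral (Suc k) r f x y"
proof (rule tendsto_unique[of "at_right (0::real)"])
  let ?x = "spread x" and ?y = "spread y"
  have f': "Cm_on (k + r) (J1 \<times> J2) f" using f by (auto dest: Cm_on_SucD simp del: Cm_on.simps)
  have g: "(\<lambda>j. x (skip i' j), y) \<in> grid J1 J2 k r" for i'
    using xy by (auto simp: grid_def skip_def)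
  have t: "(?x \<longlongrightarrow> x) (at_right 0)" "(?y \<longlongrightarrow> y) (at_right 0)" by (rule spread_tendsto)+
  show "((\<lambda>e. hg_integral k r f (\<lambda>j. ?x e (skip (Suc i) j)) (?y e) - hg_integral k r f (\<lambda>j. ?x e (skip i j)) (?y e))
    \<longlongrightarrow> hg_integral k r f (\<lambda>j. x (skip (Suc i) j)) y - hg_integral k r f (\<lambda>j. x (skip i j)) y) (at_right 0)"
    by (rule tendsto_diff[OF hg_integral_tendsto[OF J f' tendsto_compose_seq[OF t(1)] t(2) g]
        hg_integral_tendsto[OF J f' tendsto_compose_seq[OF t(1)] t(2) g]])
  have "((\<lambda>e. (?x e i - ?x e (Suc i)) * hg_integral (Suc k) r f (?x e) (?y e))
    \<longlongrightarrow> (x i - x (Suc i)) * hg_integral (Suc k) r f x y) (at_right 0)"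
    by (rule tendsto_mult[OF tendsto_diff[OF spread_tendsto_coordinate spread_tendsto_coordinate]
        hg_integral_tendsto[OF J f t xy]])
  moreover have "eventually (\<lambda>e. (?x e, ?y e) \<in> grid J1 J2 (Suc k) r) (at_right 0)"
    using topological_tendstoD[OF tendsto_Pair[OF t] open_grid[OF J(3,4)] xy] .
  then have "eventually (\<lambda>e. hg_integral k r f (\<lambda>j. ?x e (skip (Suc i) j)) (?y e) - hg_integral k r f (\<lambda>j. ?x e (skip i j)) (?y e)
    = (?x e i - ?x e (Suc i)) * hg_integral (Suc k) r f (?x e) (?y e)) (at_right 0)"
    using spread_inj[of x "Suc k"] spread_inj[of y r]
  proof eventually_elim
    case (elim e)
    have "(\<lambda>j. ?x e (skip i' j), ?y e) \<in> grid J1 J2 k r" for i'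
      using elim by (auto simp: grid_def skip_def)
    then show ?case
      using elim i lagrange_diff[of "?x e ` {..Suc k}" "?x e i" "?x e (Suc i)"]
      by (simp add: hg_integral_distinct[OF J(1,2) f] hg_integral_distinct[OF J(1,2) f'] skip_points del: hg_integral.simps Cm_on.simps)
  qed
  ultimately show "((\<lambda>e. hg_integral k r f (\<lambda>j. ?x e (skip (Suc i) j)) (?y e) - hg_integral k r f (\<lambda>j. ?x e (skip i j)) (?y e))
    \<longlongrightarrow> (x i - x (Suc i)) * hg_integral (Suc k) r f x y) (at_right 0)"
    by (simp add: tendsto_cong del: hg_integral.simps)
qed simp

lemma hg_integral_diff_y:
  assumes J: "is_interval J1" "is_interval J2" "open J1" "open J2"
    and f: "Cm_on (k + Suc r) (J1 \<times> J2) f"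
    and xy: "(x, y) \<in> grid J1 J2 k (Suc r)" and i: "i \<le> r"
  shows "hg_integral k r f x (\<lambda>j. y (skip (Suc i) j)) - hg_integral k r f x (\<lambda>j. y (skip i j))
    = (y i - y (Suc i)) * hg_integral k (Suc r) f x y"
proof (rule tendsto_unique[of "at_right (0::real)"])
  let ?x = "spread x" and ?y = "spread y"
  have f': "Cm_on (k + r) (J1 \<times> J2) f" using f by (auto dest: Cm_on_SucD simp del: Cm_on.simps)
  have g: "(x, \<lambda>j. y (skip i' j)) \<in> grid J1 J2 k r" for i'
    using xy by (auto simp: grid_def skip_def)
  have t: "(?x \<longlongrightarrow> x) (at_right 0)" "(?y \<longlongrightarrow> y) (at_right 0)" by (rule spread_tendsto)+
  show "((\<lambda>e. hg_integral k r f (?x e) (\<lambda>j. ?y e (skip (Suc i) j)) - hg_integral k r f (?x e) (\<lambda>j. ?y e (skip i j)))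
    \<longlongrightarrow> hg_integral k r f x (\<lambda>j. y (skip (Suc i) j)) - hg_integral k r f x (\<lambda>j. y (skip i j))) (at_right 0)"
    by (rule tendsto_diff[OF hg_integral_tendsto[OF J f' t(1) tendsto_compose_seq[OF t(2)] g]
        hg_integral_tendsto[OF J f' t(1) tendsto_compose_seq[OF t(2)] g]])
  have "((\<lambda>e. (?y e i - ?y e (Suc i)) * hg_integral k (Suc r) f (?x e) (?y e))
    \<longlongrightarrow> (y i - y (Suc i)) * hg_integral k (Suc r) f x y) (at_right 0)"
    by (rule tendsto_mult[OF tendsto_diff[OF spread_tendsto_coordinate spread_tendsto_coordinate]
        hg_integral_tendsto[OF J f t xy]])
  moreover have "eventually (\<lambda>e. (?x e, ?y e) \<in> grid J1 J2 k (Suc r)) (at_right 0)"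
    using topological_tendstoD[OF tendsto_Pair[OF t] open_grid[OF J(3,4)] xy] .
  then have "eventually (\<lambda>e. hg_integral k r f (?x e) (\<lambda>j. ?y e (skip (Suc i) j)) - hg_integral k r f (?x e) (\<lambda>j. ?y e (skip i j))
    = (?y e i - ?y e (Suc i)) * hg_integral k (Suc r) f (?x e) (?y e)) (at_right 0)"
    using spread_inj[of x k] spread_inj[of y "Suc r"]
  proof eventually_elim
    case (elim e)
    have "(?x e, \<lambda>j. ?y e (skip i' j)) \<in> grid J1 J2 k r" for i'
      using elim by (auto simp: grid_def skip_def)
    then show ?case
      using elim i lagrange_diff[of "?y e ` {..Suc r}" "?y e i" "?y e (Suc i)"]
      by (simp add: hg_integral_distinct[OF J(1,2) f] hg_integral_distinct[OF J(1,2) f'] skip_points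
          lagrange_diff_left[symmetric] del: hg_integral.simps Cm_on.simps)
  qed
  ultimately show "((\<lambda>e. hg_integral k r f (?x e) (\<lambda>j. ?y e (skip (Suc i) j)) - hg_integral k r f (?x e) (\<lambda>j. ?y e (skip i j)))
    \<longlongrightarrow> (y i - y (Suc i)) * hg_integral k (Suc r) f x y) (at_right 0)"
    by (simp add: tendsto_cong del: hg_integral.simps)
qed simp

text \<open>A continuous function which is the Lagrange sum at distinct nodes is the extension by
  continuity, hence the divided difference.\<close>

lemma divdiff_eqI:
  assumes "(G \<longlongrightarrow> G x) (nhds x)"
    and "eventually (\<lambda>z. inj_on z {..k} \<longrightarrow> G z = lagrange g (z ` {..k})) (nhds x)"
  shows "divdiff k g x = G x"
proof (cases "inj_on x {..k}")
  case True
  then show ?thesis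
    using eventually_nhds_x_imp_x[OF assms(2)] by (simp add: divdiff_def divdiff_distinct_eq_lagrange)
next
  case False
  let ?F = "at x within {z. inj_on z {..k}}"
  \<comment> \<open>The limit that defines \<open>divdiff\<close> is meaningful only because
    distinct nodes accumulate at \<open>x\<close>, and \<open>spread\<close> provides them.\<close>
  have "eventually (\<lambda>e. spread x e \<in> {z. inj_on z {..k}} - {x}) (at_right 0)"
    using spread_inj[of x k] by eventually_elim (use False in auto)
  with spread_tendsto have spread: "filterlim (spread x) ?F (at_right 0)"
    by (auto simp: filterlim_at elim: eventually_mono)
  have "?F \<noteq> bot"
  proof
    assume "?F = bot"
    with spread show False by (simp add: filterlim_def bot_unique filtermap_bot_iff)
  qed
  moreover have "(divdiff_distinct k g \<longlongrightarrow> G x) ?F"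
  proof (rule Lim_transform_eventually)
    show "(G \<longlongrightarrow> G x) ?F"
      using assms(1) by (rule filterlim_mono) (auto simp: at_within_def)
    have "eventually (\<lambda>z. inj_on z {..k} \<longrightarrow> G z = lagrange g (z ` {..k})) ?F"
      using assms(2) by (rule filter_leD[rotated]) (auto simp: at_within_def)
    moreover have "eventually (\<lambda>z. inj_on z {..k}) ?F"
      by (auto simp: eventually_at_filter)
    ultimately show "eventually (\<lambda>z. G z = divdiff_distinct k g z) ?F"
      by eventually_elim (simp add: divdiff_distinct_eq_lagrange)
  qed
  ultimately show ?thesis using False by (simp add: divdiff_def tendsto_Lim)
qed

text \<open>The nested definition takes two limits in succession, whereas the iterated integral is
  jointly continuous. The inner limit identifies the divided difference in \<open>y\<close> at each
  fixed \<open>u\<close>. For distinct \<open>x\<close> and arbitrary \<open>y\<close> the outer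
  Lagrange sum is then obtained by approximating \<open>y\<close> by distinct nodes, and the outer
  limit removes the restriction on \<open>x\<close>.\<close>

lemma divdiff2_eq_hg_integral:
  assumes J: "is_interval J1" "is_interval J2" "open J1" "open J2"
    and f: "Cm_on (k + r) (J1 \<times> J2) f"
    and xy: "(x, y) \<in> grid J1 J2 k r"
  shows "divdiff2 k r f x y = hg_integral k r f x y"
proof -
  have f0: "Cm_on (0 + r) (J1 \<times> J2) f" using f by (rule Cm_on_le) simp
  have near: "eventually (\<lambda>z. \<forall>i\<le>k. z i \<in> J1) (nhds x)"  "eventually (\<lambda>z. \<forall>i\<le>r. z i \<in> J2) (nhds y)"
  proof -
    have "eventually (\<lambda>z. (z, y) \<in> grid J1 J2 k r) (nhds x)"
      by (rule topological_tendstoD[OF tendsto_Pair[OF filterlim_ident tendsto_const] open_grid[OF J(3,4)] xy])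
    then show "eventually (\<lambda>z. \<forall>i\<le>k. z i \<in> J1) (nhds x)"
      by eventually_elim (simp add: grid_def)
    have "eventually (\<lambda>z. (x, z) \<in> grid J1 J2 k r) (nhds y)"
      by (rule topological_tendstoD[OF tendsto_Pair[OF tendsto_const filterlim_ident] open_grid[OF J(3,4)] xy])
    then show "eventually (\<lambda>z. \<forall>i\<le>r. z i \<in> J2) (nhds y)"
      by eventually_elim (simp add: grid_def)
  qed
  have inner: "divdiff r (\<lambda>v. f (u, v)) y = hg_integral 0 r f (\<lambda>_. u) y" if "u \<in> J1" for u
  proof (rule divdiff_eqI)
    have g: "(\<lambda>_. u, y) \<in> grid J1 J2 0 r" using xy that by (auto simp: grid_def)
    show "((\<lambda>z. hg_integral 0 r f (\<lambda>_. u) z) \<longlongrightarrow> hg_integral 0 r f (\<lambda>_. u) y) (nhds y)"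
      by (rule hg_integral_tendsto[OF J f0 _ _ g]) (auto intro!: filterlim_ident)
    show "\<forall>\<^sub>F z in nhds y. inj_on z {..r} \<longrightarrow> hg_integral 0 r f (\<lambda>_. u) z = lagrange (\<lambda>v. f (u, v)) (z ` {..r})"
      using near(2) by eventually_elim
       (auto simp: hg_integral_distinct[OF J(1,2) f0] grid_def that)
  qed
  have outer: "hg_integral k r f z y = lagrange (\<lambda>u. hg_integral 0 r f (\<lambda>_. u) y) (z ` {..k})"
    if z: "inj_on z {..k}" "\<forall>i\<le>k. z i \<in> J1" for z
  proof (rule tendsto_unique[of "at_right (0::real)"])
    let ?y = "spread y"
    have t: "(?y \<longlongrightarrow> y) (at_right 0)" by (rule spread_tendsto)
    have g: "(z, y) \<in> grid J1 J2 k r" "\<And>u. u \<in> z ` {..k} \<Longrightarrow> (\<lambda>_. u, y) \<in> grid J1 J2 0 r"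
      using z xy by (auto simp: grid_def)
    show "((\<lambda>e. hg_integral k r f z (?y e)) \<longlongrightarrow> hg_integral k r f z y) (at_right 0)"
      by (rule hg_integral_tendsto[OF J f tendsto_const t g(1)])
    have "((\<lambda>e. lagrange (\<lambda>u. hg_integral 0 r f (\<lambda>_. u) (?y e)) (z ` {..k}))
        \<longlongrightarrow> lagrange (\<lambda>u. hg_integral 0 r f (\<lambda>_. u) y) (z ` {..k})) (at_right 0)"
      unfolding lagrange_def divide_inverse
      by (intro tendsto_sum tendsto_mult hg_integral_tendsto[OF J f0 tendsto_const t] g tendsto_const)
    moreover have "eventually (\<lambda>e. \<forall>i\<le>r. ?y e i \<in> J2) (at_right 0)"
      using filterlim_iff[THEN iffD1, OF t] near(2) by auto
    then have "eventually (\<lambda>e. hg_integral k r f z (?y e)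
         = lagrange (\<lambda>u. hg_integral 0 r f (\<lambda>_. u) (?y e)) (z ` {..k})) (at_right 0)"
      using spread_inj[of y r]
    proof eventually_elim
      case (elim e)
      have "hg_integral 0 r f (\<lambda>_. u) (?y e) = lagrange (\<lambda>v. f (u, v)) (?y e ` {..r})" if "u \<in> z ` {..k}" for u
        using that z elim by (subst hg_integral_distinct[OF J(1,2) f0]) (auto simp: grid_def)
      then have "lagrange (\<lambda>u. hg_integral 0 r f (\<lambda>_. u) (?y e)) (z ` {..k})
        = lagrange (\<lambda>u. lagrange (\<lambda>v. f (u, v)) (?y e ` {..r})) (z ` {..k})"
        unfolding lagrange_def[where A = "z ` {..k}"] by (intro sum.cong refl) simp
      then show ?case
        using z elim by (subst hg_integral_distinct[OF J(1,2) f]) (auto simp: grid_def)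
    qed
    ultimately show "((\<lambda>e. hg_integral k r f z (?y e)) \<longlongrightarrow> lagrange (\<lambda>u. hg_integral 0 r f (\<lambda>_. u) y) (z ` {..k})) (at_right 0)"
      by (simp add: tendsto_cong del: hg_integral.simps)
  qed simp
  show ?thesis
    unfolding divdiff2_def
  proof (rule divdiff_eqI)
    show "((\<lambda>z. hg_integral k r f z y) \<longlongrightarrow> hg_integral k r f x y) (nhds x)"
      by (rule hg_integral_tendsto[OF J f _ tendsto_const xy]) (rule filterlim_ident)
    show "\<forall>\<^sub>F z in nhds x. inj_on z {..k} \<longrightarrow>
        hg_integral k r f z y = lagrange (\<lambda>u. divdiff r (\<lambda>v. f (u, v)) y) (z ` {..k})"
      using near(1)
    proof eventually_elim
      case (elim z)
      then have "lagrange (\<lambda>u. divdiff r (\<lambda>v. f (u, v)) y) (z ` {..k})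
         = lagrange (\<lambda>u. hg_integral 0 r f (\<lambda>_. u) y) (z ` {..k})"
        unfolding lagrange_def by (intro sum.cong refl) (auto simp: inner)
      with outer elim show ?case by simp
    qed
  qed
qed

section \<open>Spectral projections of a commuting pair\<close>

text \<open>An orthonormal basis, as the columns of a unitary matrix, with a pair of numbers attached to
  each of its vectors.\<close>

type_synonym 'n eigendata = "(complex^'n^'n) \<times> ('n \<Rightarrow> real \<times> real)"

lemma bounded_bilinear_matrix_mult:
  "bounded_bilinear ((**) :: complex^'n^'n \<Rightarrow> complex^'n^'n \<Rightarrow> complex^'n^'n)"
  unfolding bilinear_conv_bounded_bilinear[symmetric] bilinear_def
  by (auto intro!: linearI simp: matrix_matrix_mult_def vec_eq_iff sum.distrib
      scaleR_sum_right algebra_simps)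

interpretation mm: bounded_bilinear "(**) :: complex^'n^'n \<Rightarrow> complex^'n^'n \<Rightarrow> complex^'n^'n"
  by (rule bounded_bilinear_matrix_mult)

text \<open>The orthogonal projection onto the line spanned by column \<open>a\<close> of
  \<open>U\<close>, when \<open>U\<close> is unitary.\<close>

definition proj :: "complex^'n^'n \<Rightarrow> 'n \<Rightarrow> complex^'n^'n" where
  "proj U a = (\<chi> i j. U $ i $ a * cnj (U $ j $ a))"

lemma sum_proj_diag: "(\<Sum>a\<in>UNIV. d a *\<^sub>R proj U a) = U ** diag d ** cadjoint U"
proof -
  have "(\<Sum>k\<in>UNIV. (\<Sum>l\<in>UNIV. U $ i $ l * (if l = k then complex_of_real (d l) else 0)) * cnj (U $ j $ k))
    = (\<Sum>a\<in>UNIV. d a *\<^sub>R (U $ i $ a * cnj (U $ j $ a)))" for i j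
    by (intro sum.cong refl) (simp add: if_distrib[of "\<lambda>z. _ * z"] sum.delta' scaleR_conv_of_real algebra_simps cong: if_cong)
  then show ?thesis
    by (simp add: vec_eq_iff matrix_matrix_mult_def diag_def cadjoint_def proj_def)
qed

lemma diag_one: "diag (\<lambda>_. 1) = mat 1"
  by (simp add: diag_def mat_def vec_eq_iff)

lemma sum_proj: "unitary U \<Longrightarrow> (\<Sum>a\<in>UNIV. proj U a) = mat 1"
  using sum_proj_diag[of "\<lambda>_. 1" U] by (simp add: diag_one unitary_def)

definition diagonalizes :: "complex^'n^'n \<Rightarrow> complex^'n^'n \<Rightarrow> 'n eigendata \<Rightarrow> bool" where
  "diagonalizes S T c \<longleftrightarrow> unitary (fst c) \<and>
     cadjoint (fst c) ** S ** fst c = diag (\<lambda>a. fst (snd c a)) \<and>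
     cadjoint (fst c) ** T ** fst c = diag (\<lambda>a. snd (snd c a))"

lemma proj_eigen:
  assumes U: "unitary U" and S: "cadjoint U ** S ** U = diag x"
  shows "S ** proj U a = x a *\<^sub>R proj U a" "proj U a ** S = x a *\<^sub>R proj U a"
proof -
  have "U ** (cadjoint U ** S ** U) = (U ** cadjoint U) ** S ** U" by (simp only: matrix_mul_assoc)
  then have 1: "S ** U = U ** diag x" using U S by (simp add: unitary_def)
  have "(cadjoint U ** S ** U) ** cadjoint U = cadjoint U ** S ** (U ** cadjoint U)"
    by (simp only: matrix_mul_assoc)
  then have 2: "cadjoint U ** S = diag x ** cadjoint U" using U S by (simp add: unitary_def)
  have 3: "(\<Sum>k\<in>UNIV. S $ i $ k * U $ k $ a) = U $ i $ a * complex_of_real (x a)" for i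
    using arg_cong[OF 1, of "\<lambda>M. M $ i $ a"]
    by (simp add: matrix_matrix_mult_def diag_def if_distrib[of "\<lambda>z. _ * z"] sum.delta' cong: if_cong)
  have 4: "(\<Sum>k\<in>UNIV. cnj (U $ k $ a) * S $ k $ j) = complex_of_real (x a) * cnj (U $ j $ a)" for j
    using arg_cong[OF 2, of "\<lambda>M. M $ a $ j"]
    by (simp add: matrix_matrix_mult_def diag_def cadjoint_def if_distrib[of "\<lambda>z. z * _"] sum.delta cong: if_cong)
  have "(\<Sum>k\<in>UNIV. S $ i $ k * (U $ k $ a * cnj (U $ j $ a))) = x a *\<^sub>R (U $ i $ a * cnj (U $ j $ a))" for i j
    using 3[of i] by (simp add: scaleR_conv_of_real mult.assoc[symmetric] sum_distrib_right[symmetric])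
  then show "S ** proj U a = x a *\<^sub>R proj U a"
    by (simp add: matrix_matrix_mult_def proj_def vec_eq_iff)
  have "(\<Sum>k\<in>UNIV. U $ i $ a * cnj (U $ k $ a) * S $ k $ j) = x a *\<^sub>R (U $ i $ a * cnj (U $ j $ a))" for i j
    using 4[of j] by (simp add: scaleR_conv_of_real mult.assoc sum_distrib_left[symmetric])
  then show "proj U a ** S = x a *\<^sub>R proj U a"
    by (simp add: matrix_matrix_mult_def proj_def vec_eq_iff)
qed

lemma diagonalizes_proj:
  assumes "diagonalizes S T c"
  shows "S ** proj (fst c) a = fst (snd c a) *\<^sub>R proj (fst c) a"
    "proj (fst c) a ** S = fst (snd c a) *\<^sub>R proj (fst c) a"
    "T ** proj (fst c) a = snd (snd c a) *\<^sub>R proj (fst c) a"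
    "proj (fst c) a ** T = snd (snd c a) *\<^sub>R proj (fst c) a"
  using assms proj_eigen unfolding diagonalizes_def by blast+

text \<open>Inserting the resolution of the identity of the other basis brings both sums to the same
  index set.\<close>

lemma proj_sum_diff:
  fixes R R' :: "'n \<Rightarrow> complex^'n^'n"
  assumes "unitary U" "unitary V"
  shows "(\<Sum>a\<in>UNIV. proj U a ** R a) - (\<Sum>b\<in>UNIV. proj V b ** R' b)
    = (\<Sum>a\<in>UNIV. \<Sum>b\<in>UNIV. proj U a ** proj V b ** (R a - R' b))"
proof -
  have "(\<Sum>a\<in>UNIV. \<Sum>b\<in>UNIV. proj U a ** proj V b ** R a)
      = (\<Sum>a\<in>UNIV. proj U a ** (\<Sum>b\<in>UNIV. proj V b) ** R a)"
    by (simp add: mm.sum_left mm.sum_right)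
  then have 1: "(\<Sum>a\<in>UNIV. proj U a ** R a) = (\<Sum>a\<in>UNIV. \<Sum>b\<in>UNIV. proj U a ** proj V b ** R a)"
    by (simp add: sum_proj[OF assms(2)])
  have "(\<Sum>a\<in>UNIV. \<Sum>b\<in>UNIV. proj U a ** proj V b ** R' b)
      = (\<Sum>b\<in>UNIV. (\<Sum>a\<in>UNIV. proj U a) ** proj V b ** R' b)"
    by (subst sum.swap) (simp add: mm.sum_left)
  then have 2: "(\<Sum>b\<in>UNIV. proj V b ** R' b) = (\<Sum>a\<in>UNIV. \<Sum>b\<in>UNIV. proj U a ** proj V b ** R' b)"
    by (simp add: sum_proj[OF assms(1)])
  show ?thesis unfolding 1 2 by (simp add: sum_subtractf mm.diff_right)
qed

text \<open>Joint eigenvectors for different joint eigenvalues are orthogonal.\<close>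

lemma proj_mult_eq_0:
  assumes "diagonalizes S T c" "diagonalizes S T d" "snd c a \<noteq> snd d b"
  shows "proj (fst c) a ** proj (fst d) b = 0"
proof -
  let ?P = "proj (fst c) a" and ?Q = "proj (fst d) b"
  have "?P ** S ** ?Q = ?P ** (S ** ?Q)" "?P ** T ** ?Q = ?P ** (T ** ?Q)"
    by (simp_all only: matrix_mul_assoc)
  then have "fst (snd c a) *\<^sub>R (?P ** ?Q) = fst (snd d b) *\<^sub>R (?P ** ?Q)"
    "snd (snd c a) *\<^sub>R (?P ** ?Q) = snd (snd d b) *\<^sub>R (?P ** ?Q)"
    by (simp_all add: diagonalizes_proj[OF assms(1)] diagonalizes_proj[OF assms(2)] mm.scaleR_left mm.scaleR_right)
  then show ?thesis using assms(3) by (auto simp: prod_eq_iff)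
qed

text \<open>The functional calculus does not see the choice of eigenbasis, here with matrix-valued
  functions \<open>R\<close>.\<close>

lemma proj_sum_unique:
  fixes R :: "real \<times> real \<Rightarrow> complex^'n^'n"
  assumes "diagonalizes S T c" "diagonalizes S T d"
  shows "(\<Sum>a\<in>UNIV. proj (fst c) a ** R (snd c a)) = (\<Sum>b\<in>UNIV. proj (fst d) b ** R (snd d b))"
proof -
  have "proj (fst c) a ** proj (fst d) b ** (R (snd c a) - R (snd d b)) = 0" for a b
    using proj_mult_eq_0[OF assms, of a b] by (cases "snd c a = snd d b") auto
  then have "(\<Sum>a\<in>UNIV. proj (fst c) a ** R (snd c a)) - (\<Sum>b\<in>UNIV. proj (fst d) b ** R (snd d b)) = 0"
    using assms proj_sum_diff[of "fst c" "fst d" "\<lambda>a. R (snd c a)" "\<lambda>b. R (snd d b)"]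
    by (simp add: diagonalizes_def)
  then show ?thesis by simp
qed

lemma proj_nonzero:
  assumes "unitary U"
  shows "proj U a \<noteq> 0"
proof
  assume 0: "proj U a = 0"
  have "U $ i $ a = 0" for i
    using arg_cong[OF 0, of "\<lambda>M. M $ i $ i"] by (simp add: proj_def)
  then have "(cadjoint U ** U) $ a $ a = 0" by (simp add: matrix_matrix_mult_def)
  then show False using assms by (simp add: unitary_def mat_def)
qed

text \<open>The joint spectrum does not depend on the diagonalization: projections that belong to a new
  joint eigenvalue would annihilate a resolution of the identity.\<close>

lemma diagonalizes_points:
  assumes "diagonalizes S T c" "diagonalizes S T d"
  shows "\<exists>a. snd c a = snd d b"
proof (rule ccontr)
  assume "\<nexists>a. snd c a = snd d b"
  then have "(\<Sum>a\<in>UNIV. proj (fst c) a ** proj (fst d) b) = 0"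
    by (intro sum.neutral ballI proj_mult_eq_0[OF assms]) auto
  then have "(\<Sum>a\<in>UNIV. proj (fst c) a) ** proj (fst d) b = 0" by (simp add: mm.sum_left)
  with assms proj_nonzero show False by (auto simp: diagonalizes_def sum_proj)
qed

section \<open>Spectral sums\<close>

text \<open>The sum of \<open>\<Phi> [p\<^sub>a\<^sub>0, \<dots>, p\<^sub>a\<^sub>j] P\<^sub>a\<^sub>0
  X\<^sub>1 P\<^sub>a\<^sub>1 \<cdots> X\<^sub>j P\<^sub>a\<^sub>j\<close> over all index tuples, a
  finite-dimensional multiple operator integral with symbol \<open>\<Phi>\<close>. Every factor has
  its own basis, because the difference of two such sums mixes the bases of two points of the curve.\<close>

fun spectral_sum :: "((real \<times> real) list \<Rightarrow> real) \<Rightarrow> 'n eigendata \<Rightarrow> ((complex^'n^'n) \<times> 'n eigendata) list \<Rightarrow> complex^'n^'n" where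
  "spectral_sum \<Phi> c [] = (\<Sum>a\<in>UNIV. proj (fst c) a ** (\<Phi> [snd c a] *\<^sub>R mat 1))"
| "spectral_sum \<Phi> c ((X, d) # ds) = (\<Sum>a\<in>UNIV. proj (fst c) a ** (X ** spectral_sum (\<lambda>qs. \<Phi> (snd c a # qs)) d ds))"

lemma list_all2_map_same:
  "(\<And>x. x \<in> set xs \<Longrightarrow> P (f x) (g x)) \<Longrightarrow> list_all2 P (map f xs) (map g xs)"
  by (induction xs) auto

lemma spectral_sum_unique:
  assumes "diagonalizes S T c" "diagonalizes S T c'"
    and "list_all2 (\<lambda>(X, d) (X', d'). X = X' \<and> diagonalizes S T d \<and> diagonalizes S T d') ds ds'"
  shows "spectral_sum \<Phi> c ds = spectral_sum \<Phi> c' ds'"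
  using assms
proof (induction ds arbitrary: ds' \<Phi> c c')
  case Nil
  then show ?case using proj_sum_unique[of S T c c' "\<lambda>q. \<Phi> [q] *\<^sub>R mat 1"] by simp
next
  case (Cons Xd ds)
  obtain X d where Xd: "Xd = (X, d)" by (cases Xd)
  with Cons.prems(3) obtain d' ds'' where ds': "ds' = (X, d') # ds''"
    "diagonalizes S T d" "diagonalizes S T d'"
    "list_all2 (\<lambda>(X, d) (X', d'). X = X' \<and> diagonalizes S T d \<and> diagonalizes S T d') ds ds''"
    by (auto simp: list_all2_Cons1)
  have "spectral_sum \<Psi> d ds = spectral_sum \<Psi> d' ds''" for \<Psi> using Cons.IH ds'(2-4) by blast
  then show ?case
    using proj_sum_unique[OF Cons.prems(1,2), of "\<lambda>q. X ** spectral_sum (\<lambda>qs. \<Phi> (q # qs)) d ds"] Xd ds' by simp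
qed

text \<open>Only the values of the symbol at the attached points, which are assumed to lie in
  \<open>Q\<close>, enter the sum.\<close>

lemma spectral_sum_cong:
  assumes "\<And>qs. length qs = Suc (length ds) \<Longrightarrow> set qs \<subseteq> Q \<Longrightarrow> \<Phi> qs = \<Psi> qs"
    and "range (snd c) \<subseteq> Q" "\<forall>(X, d)\<in>set ds. range (snd d) \<subseteq> Q"
  shows "spectral_sum \<Phi> c ds = spectral_sum \<Psi> c ds"
  using assms
proof (induction ds arbitrary: \<Phi> \<Psi> c)
  case Nil
  have "\<Phi> [snd c a] = \<Psi> [snd c a]" for a using Nil.prems(2) by (intro Nil.prems(1)) auto
  then show ?case by simp
next
  case (Cons Xd ds)
  obtain X d where [simp]: "Xd = (X, d)" by (cases Xd)
  have "spectral_sum (\<lambda>qs. \<Phi> (snd c a # qs)) d ds = spectral_sum (\<lambda>qs. \<Psi> (snd c a # qs)) d ds" for a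
    using Cons.prems by (intro Cons.IH Cons.prems(1)) auto
  then show ?case by simp
qed

lemma spectral_sum_linear:
  "spectral_sum (\<lambda>qs. u * \<Phi> qs + v * \<Psi> qs) c ds = u *\<^sub>R spectral_sum \<Phi> c ds + v *\<^sub>R spectral_sum \<Psi> c ds"
proof (induction ds arbitrary: \<Phi> \<Psi> c)
  case Nil
  then show ?case by (simp add: scaleR_sum_right sum.distrib mm.scaleR_right mm.add_right scaleR_add_left)
next
  case (Cons Xd ds)
  then show ?case
    by (cases Xd) (simp add: scaleR_sum_right sum.distrib mm.scaleR_right mm.add_right)
qed

lemma spectral_sum_scale_head: "spectral_sum \<Phi> c ((u *\<^sub>R X, d) # ds) = u *\<^sub>R spectral_sum \<Phi> c ((X, d) # ds)"
  by (simp add: scaleR_sum_right mm.scaleR_right mm.scaleR_left)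

lemma spectral_sum_diff_head:
  "spectral_sum \<Phi> c ((X, d) # ds) - spectral_sum \<Phi> c ((Y, d) # ds) = spectral_sum \<Phi> c ((X - Y, d) # ds)"
  by (simp add: mm.diff_right mm.diff_left sum_subtractf)

text \<open>What follows the first projection, as a function of the point attached to that projection.
  Changing the first basis only affects this point.\<close>

definition spectral_tail :: "((real \<times> real) list \<Rightarrow> real) \<Rightarrow> real \<times> real \<Rightarrow> ((complex^'n^'n) \<times> 'n eigendata) list \<Rightarrow> complex^'n^'n" where
  "spectral_tail \<Phi> q ds = (case ds of [] \<Rightarrow> \<Phi> [q] *\<^sub>R mat 1
     | (X, d) # ds' \<Rightarrow> X ** spectral_sum (\<lambda>qs. \<Phi> (q # qs)) d ds')"

lemma spectral_sum_tail: "spectral_sum \<Phi> c ds = (\<Sum>a\<in>UNIV. proj (fst c) a ** spectral_tail \<Phi> (snd c a) ds)"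
  by (cases ds) (auto simp: spectral_tail_def)

lemma spectral_tail_diff:
  assumes "\<And>qs. length qs = length ds \<Longrightarrow> set qs \<subseteq> Q \<Longrightarrow>
      \<Phi> (p # qs) - \<Phi> (q # qs) = u * A (p # q # qs) + v * B (p # q # qs)"
    and "\<forall>(X, d)\<in>set ds. range (snd d) \<subseteq> Q"
  shows "spectral_tail \<Phi> p ds - spectral_tail \<Phi> q ds = u *\<^sub>R spectral_tail (\<lambda>qs. A (p # qs)) q ds + v *\<^sub>R spectral_tail (\<lambda>qs. B (p # qs)) q ds"
proof (cases ds)
  case Nil
  then show ?thesis using assms(1)[of "[]"]
    by (simp add: spectral_tail_def scaleR_diff_left[symmetric] scaleR_add_left[symmetric])
next
  case (Cons Xd ds')
  obtain X d where [simp]: "Xd = (X, d)" by (cases Xd)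
  have "spectral_sum (\<lambda>qs. \<Phi> (p # qs)) d ds' - spectral_sum (\<lambda>qs. \<Phi> (q # qs)) d ds'
      = spectral_sum (\<lambda>qs. 1 * \<Phi> (p # qs) + (-1) * \<Phi> (q # qs)) d ds'"
    unfolding spectral_sum_linear by simp
  also have "\<dots> = spectral_sum (\<lambda>qs. u * A (p # q # qs) + v * B (p # q # qs)) d ds'"
  proof (rule spectral_sum_cong[where Q = Q])
    fix qs :: "(real \<times> real) list" assume "length qs = Suc (length ds')" "set qs \<subseteq> Q"
    then show "1 * \<Phi> (p # qs) + (-1) * \<Phi> (q # qs) = u * A (p # q # qs) + v * B (p # q # qs)"
      using assms(1)[of qs] Cons by simp
  qed (use assms(2) Cons in auto)
  finally show ?thesis
    using Cons by (simp add: spectral_tail_def spectral_sum_linear mm.add_right mm.scaleR_right flip: mm.diff_right)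
qed

text \<open>The exact difference of two spectral sums that differ in the first basis: inserting both
  resolutions of the identity turns \<open>\<Phi>\<close> at \<open>p\<close> minus
  \<open>\<Phi>\<close> at \<open>q\<close> into a combination with coefficients \<open>x\<^sub>p -
  x\<^sub>q\<close> and \<open>y\<^sub>p - y\<^sub>q\<close>, and these are absorbed by the
  projections as \<open>S - S0\<close> and \<open>T - T0\<close>.\<close>

lemma spectral_sum_perturb:
  fixes c c0 :: "('n::finite) eigendata"
  assumes c: "diagonalizes S T c" "range (snd c) \<subseteq> Q" and c0: "diagonalizes S0 T0 c0" "range (snd c0) \<subseteq> Q"
    and ds: "\<forall>(X, d)\<in>set ds. range (snd d) \<subseteq> Q"
    and \<Phi>: "\<And>p q qs. length qs = length ds \<Longrightarrow> set (p # q # qs) \<subseteq> Q \<Longrightarrow>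
      \<Phi> (p # qs) - \<Phi> (q # qs) = (fst p - fst q) * A (p # q # qs) + (snd p - snd q) * B (p # q # qs)"
  shows "spectral_sum \<Phi> c ds - spectral_sum \<Phi> c0 ds = spectral_sum A c ((S - S0, c0) # ds) + spectral_sum B c ((T - T0, c0) # ds)"
proof -
  let ?P = "proj (fst c)" and ?Q = "proj (fst c0)"
  have "spectral_sum \<Phi> c ds - spectral_sum \<Phi> c0 ds = (\<Sum>a\<in>UNIV. \<Sum>b\<in>UNIV. ?P a ** ?Q b **
      (spectral_tail \<Phi> (snd c a) ds - spectral_tail \<Phi> (snd c0 b) ds))"
    unfolding spectral_sum_tail[of _ _ ds] using c c0 by (subst proj_sum_diff) (auto simp: diagonalizes_def)
  also have "\<dots> = (\<Sum>a\<in>UNIV. \<Sum>b\<in>UNIV.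
      ?P a ** ((S - S0) ** (?Q b ** spectral_tail (\<lambda>qs. A (snd c a # qs)) (snd c0 b) ds)) +
      ?P a ** ((T - T0) ** (?Q b ** spectral_tail (\<lambda>qs. B (snd c a # qs)) (snd c0 b) ds)))"
  proof (intro sum.cong refl)
    fix a b
    let ?p = "snd c a" and ?q = "snd c0 b"
    let ?A = "spectral_tail (\<lambda>qs. A (?p # qs)) ?q ds" and ?B = "spectral_tail (\<lambda>qs. B (?p # qs)) ?q ds"
    have "spectral_tail \<Phi> ?p ds - spectral_tail \<Phi> ?q ds = (fst ?p - fst ?q) *\<^sub>R ?A + (snd ?p - snd ?q) *\<^sub>R ?B"
      using c c0 ds by (intro spectral_tail_diff[where Q = Q] \<Phi>) auto
    moreover have "?P a ** ((S - S0) ** (?Q b ** Z)) = (fst ?p - fst ?q) *\<^sub>R (?P a ** ?Q b ** Z)"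
      for Z :: "complex^'n^'n"
    proof -
      have "?P a ** ((S - S0) ** (?Q b ** Z)) = ((?P a ** S) ** ?Q b - ?P a ** (S0 ** ?Q b)) ** Z"
        by (simp add: mm.diff_left mm.diff_right matrix_mul_assoc)
      then show ?thesis
        by (simp add: diagonalizes_proj[OF c(1)] diagonalizes_proj[OF c0(1)] mm.scaleR_left mm.scaleR_right
            scaleR_diff_left[symmetric])
    qed
    moreover have "?P a ** ((T - T0) ** (?Q b ** Z)) = (snd ?p - snd ?q) *\<^sub>R (?P a ** ?Q b ** Z)"
      for Z :: "complex^'n^'n"
    proof -
      have "?P a ** ((T - T0) ** (?Q b ** Z)) = ((?P a ** T) ** ?Q b - ?P a ** (T0 ** ?Q b)) ** Z"
        by (simp add: mm.diff_left mm.diff_right matrix_mul_assoc)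
      then show ?thesis
        by (simp add: diagonalizes_proj[OF c(1)] diagonalizes_proj[OF c0(1)] mm.scaleR_left mm.scaleR_right
            scaleR_diff_left[symmetric])
    qed
    ultimately show "?P a ** ?Q b ** (spectral_tail \<Phi> ?p ds - spectral_tail \<Phi> ?q ds)
      = ?P a ** ((S - S0) ** (?Q b ** ?A)) + ?P a ** ((T - T0) ** (?Q b ** ?B))"
      by (simp add: mm.add_right mm.scaleR_right)
  qed
  also have "\<dots> = spectral_sum A c ((S - S0, c0) # ds) + spectral_sum B c ((T - T0, c0) # ds)"
    by (simp add: spectral_sum_tail[of _ _ ds] sum.distrib mm.sum_right)
  finally show ?thesis .
qed

section \<open>Limits of spectral sums along a curve\<close>

definition eigendata_tendsto :: "('t \<Rightarrow> ('n::finite) eigendata) \<Rightarrow> 'n eigendata \<Rightarrow> 't filter \<Rightarrow> bool" where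
  "eigendata_tendsto c c' F \<longleftrightarrow> ((\<lambda>t. fst (c t)) \<longlongrightarrow> fst c') F \<and> (\<forall>a. ((\<lambda>t. snd (c t) a) \<longlongrightarrow> snd c' a) F)"

lemma proj_tendsto:
  assumes "(U \<longlongrightarrow> U') F"
  shows "((\<lambda>t. proj (U t) a) \<longlongrightarrow> proj U' a) F"
  unfolding proj_def
  by (intro vec_tendstoI) (auto intro!: tendsto_intros tendsto_vec_nth assms)

text \<open>The symbols \<open>\<Phi> t\<close> may vary with \<open>t\<close>, since peeling off the
  first factor inserts its moving eigenvalue into the symbol.\<close>

lemma spectral_sum_tendsto:
  assumes "eigendata_tendsto c c' F" "range (snd c') \<subseteq> Q"
    and "list_all2 (\<lambda>(X, d) (X', d'). (X \<longlongrightarrow> X') F \<and> eigendata_tendsto d d' F \<and> range (snd d') \<subseteq> Q) D L"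
    and "\<And>qs q. length q = Suc (length D) \<Longrightarrow> set q \<subseteq> Q \<Longrightarrow> (\<And>t. length (qs t) = length q) \<Longrightarrow>
       (\<And>i. i < length q \<Longrightarrow> ((\<lambda>t. qs t ! i) \<longlongrightarrow> q ! i) F) \<Longrightarrow> ((\<lambda>t. \<Phi> t (qs t)) \<longlongrightarrow> \<Phi>' q) F"
  shows "((\<lambda>t. spectral_sum (\<Phi> t) (c t) (map (\<lambda>(X, d). (X t, d t)) D)) \<longlongrightarrow> spectral_sum \<Phi>' c' L) F"
  using assms
proof (induction D arbitrary: L c c' \<Phi> \<Phi>')
  case Nil
  have "((\<lambda>t. \<Phi> t [snd (c t) a]) \<longlongrightarrow> \<Phi>' [snd c' a]) F" for a
    using Nil.prems(1,2) by (intro Nil.prems(4)) (auto simp: eigendata_tendsto_def)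
  then show ?case using Nil.prems(1,3)
    by (auto simp: eigendata_tendsto_def intro!: tendsto_sum mm.tendsto proj_tendsto tendsto_scaleR)
next
  case (Cons Xd D)
  obtain X d where [simp]: "Xd = (X, d)" by (cases Xd)
  from Cons.prems(3) obtain X' d' L' where L: "L = (X', d') # L'" and X: "(X \<longlongrightarrow> X') F"
    and d: "eigendata_tendsto d d' F" "range (snd d') \<subseteq> Q" and
    D: "list_all2 (\<lambda>(X, d) (X', d'). (X \<longlongrightarrow> X') F \<and> eigendata_tendsto d d' F \<and> range (snd d') \<subseteq> Q) D L'"
    by (auto simp: list_all2_Cons1)
  have "((\<lambda>t. spectral_sum (\<lambda>qs. \<Phi> t (snd (c t) a # qs)) (d t) (map (\<lambda>(X, d). (X t, d t)) D))
     \<longlongrightarrow> spectral_sum (\<lambda>qs. \<Phi>' (snd c' a # qs)) d' L') F" for a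
  proof (rule Cons.IH[OF d D])
    fix qs q
    assume *: "length q = Suc (length D)" "set q \<subseteq> Q" "\<And>t. length (qs t) = length q"
       "\<And>i. i < length q \<Longrightarrow> ((\<lambda>t. qs t ! i) \<longlongrightarrow> q ! i) F"
    have "((\<lambda>t. (snd (c t) a # qs t) ! i) \<longlongrightarrow> (snd c' a # q) ! i) F" if "i < Suc (length q)" for i
      using Cons.prems(1) that *(4) by (cases i) (auto simp: eigendata_tendsto_def)
    then show "((\<lambda>t. \<Phi> t (snd (c t) a # qs t)) \<longlongrightarrow> \<Phi>' (snd c' a # q)) F"
      using Cons.prems(2) * by (intro Cons.prems(4)) auto
  qed
  then show ?case using Cons.prems(1) X L
    by (auto simp: eigendata_tendsto_def intro!: tendsto_sum mm.tendsto proj_tendsto)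
qed

lemma cadjoint_tendsto:
  assumes "(U \<longlongrightarrow> U') F"
  shows "((\<lambda>t. cadjoint (U t)) \<longlongrightarrow> cadjoint U') F"
  unfolding cadjoint_def
  by (intro vec_tendstoI) (auto intro!: tendsto_intros tendsto_vec_nth assms)

lemma bounded_unitary: "bounded (Collect (unitary :: complex^'n^'n \<Rightarrow> bool))"
proof (rule boundedI)
  fix U :: "complex^'n^'n" assume "U \<in> Collect unitary"
  then have U: "unitary U" by simp
  have "norm (U $ i $ j) \<le> 1" for i j
  proof -
    have "complex_of_real (\<Sum>k\<in>UNIV. (norm (U $ k $ j))\<^sup>2) = (cadjoint U ** U) $ j $ j"
      unfolding of_real_sum complex_norm_square
      by (simp add: matrix_matrix_mult_def cadjoint_def mult.commute)
    also have "\<dots> = 1" using U by (simp add: unitary_def mat_def)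
    finally have "(\<Sum>k\<in>UNIV. (norm (U $ k $ j))\<^sup>2) = 1" using of_real_eq_1_iff by blast
    moreover have "(norm (U $ i $ j))\<^sup>2 \<le> (\<Sum>k\<in>UNIV. (norm (U $ k $ j))\<^sup>2)"
      by (rule member_le_sum) auto
    ultimately show ?thesis by (simp add: power2_le_imp_le[of _ 1])
  qed
  then have "norm (U $ i) \<le> (\<Sum>j\<in>(UNIV :: 'n set). 1)" for i
    unfolding norm_vec_def by (intro order.trans[OF L2_set_le_sum] sum_mono) auto
  then show "norm U \<le> (\<Sum>i\<in>(UNIV :: 'n set). \<Sum>j\<in>(UNIV :: 'n set). 1)"
    unfolding norm_vec_def[of U] by (intro order.trans[OF L2_set_le_sum] sum_mono) auto
qed

text \<open>Diagonal matrices form a closed set, and their entries converge with them.\<close>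

lemma diag_tendsto_imp:
  assumes "((\<lambda>n. diag (x n)) \<longlongrightarrow> M) F" "F \<noteq> bot"
  shows "M = diag (\<lambda>a. Re (M $ a $ a))" "((\<lambda>n. x n a) \<longlongrightarrow> Re (M $ a $ a)) F"
proof -
  have e: "((\<lambda>n. diag (x n) $ i $ j) \<longlongrightarrow> M $ i $ j) F" for i j
    by (intro tendsto_vec_nth assms)
  show x: "((\<lambda>n. x n a) \<longlongrightarrow> Re (M $ a $ a)) F" for a
    using tendsto_Re[OF e[of a a]] by (simp add: diag_def)
  have "((\<lambda>n. diag (x n) $ i $ j) \<longlongrightarrow> diag (\<lambda>a. Re (M $ a $ a)) $ i $ j) F" for i j
    using tendsto_of_real[OF x[of i], where 'a = complex] by (cases "i = j") (auto simp: diag_def)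
  from tendsto_unique[OF assms(2) e this] show "M = diag (\<lambda>a. Re (M $ a $ a))"
    unfolding vec_eq_iff by blast
qed

lemma tendsto_subsequence_principle:
  fixes h :: "nat \<Rightarrow> 'a :: metric_space"
  assumes "\<And>r :: nat \<Rightarrow> nat. strict_mono r \<Longrightarrow> \<exists>r' :: nat \<Rightarrow> nat. strict_mono r' \<and> (\<lambda>n. h (r (r' n))) \<longlonglongrightarrow> L"
  shows "h \<longlonglongrightarrow> L"
proof (rule ccontr)
  assume "\<not> h \<longlonglongrightarrow> L"
  then obtain e where e: "e > 0" "\<not> (\<exists>N. \<forall>n\<ge>N. dist (h n) L < e)"
    unfolding lim_sequentially by blast
  then have "infinite {n. dist (h n) L \<ge> e}"
    unfolding infinite_nat_iff_unbounded_le by (auto simp: not_less)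
  then obtain r :: "nat \<Rightarrow> nat" where r: "strict_mono r" "\<And>n. r n \<in> {n. dist (h n) L \<ge> e}"
    using infinite_enumerate by blast
  from assms[OF r(1)] obtain r' :: "nat \<Rightarrow> nat" where "(\<lambda>n. h (r (r' n))) \<longlonglongrightarrow> L" by blast
  from metric_LIMSEQ_D[OF this e(1)] obtain N where "dist (h (r (r' N))) L < e" by blast
  with r(2)[of "r' N"] show False by simp
qed

text \<open>Compactness of the unitary group supplies a limiting basis. The eigenvalues then converge of
  their own accord, being the diagonal entries of \<open>U\<^sup>* S U\<close> and \<open>U\<^sup>*
  T U\<close>.\<close>

lemma diagonalizes_subsequence:
  assumes c: "\<And>n. diagonalizes (S n) (T n) (c n)" and S: "S \<longlonglongrightarrow> S0" and T: "T \<longlonglongrightarrow> T0"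
  shows "\<exists>c' (r :: nat \<Rightarrow> nat). strict_mono r \<and> eigendata_tendsto (\<lambda>n. c (r n)) c' sequentially \<and> diagonalizes S0 T0 c'"
proof -
  have "bounded (range (\<lambda>n. fst (c n)))"
    using c by (intro bounded_subset[OF bounded_unitary]) (auto simp: diagonalizes_def)
  from bounded_imp_convergent_subsequence[OF this] obtain V r
    where r: "strict_mono (r :: nat \<Rightarrow> nat)" and V: "((\<lambda>n. fst (c n)) \<circ> r) \<longlonglongrightarrow> V" by blast
  let ?U = "\<lambda>n. fst (c (r n))"
  have V: "?U \<longlonglongrightarrow> V" using V by (simp add: comp_def)
  note V' = cadjoint_tendsto[OF V]
  have u: "cadjoint (?U n) ** ?U n = mat 1" "?U n ** cadjoint (?U n) = mat 1" for n
    using c[of "r n"] by (auto simp: diagonalizes_def unitary_def)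
  have "cadjoint V ** V = mat 1"
    using LIMSEQ_unique[OF mm.tendsto[OF V' V]] u by (simp add: tendsto_const)
  moreover have "V ** cadjoint V = mat 1"
    using LIMSEQ_unique[OF mm.tendsto[OF V V']] u by (simp add: tendsto_const)
  ultimately have uV: "unitary V" by (simp add: unitary_def)
  have Sr: "(\<lambda>n. S (r n)) \<longlonglongrightarrow> S0" "(\<lambda>n. T (r n)) \<longlonglongrightarrow> T0"
    using LIMSEQ_subseq_LIMSEQ[OF S r] LIMSEQ_subseq_LIMSEQ[OF T r] by (simp_all add: comp_def)
  let ?x = "\<lambda>a. Re ((cadjoint V ** S0 ** V) $ a $ a)" and ?y = "\<lambda>a. Re ((cadjoint V ** T0 ** V) $ a $ a)"
  have "(\<lambda>n. diag (\<lambda>a. fst (snd (c (r n)) a))) \<longlonglongrightarrow> cadjoint V ** S0 ** V"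
    using mm.tendsto[OF mm.tendsto[OF V' Sr(1)] V] c by (simp add: diagonalizes_def)
  note x = diag_tendsto_imp[OF this sequentially_bot]
  have "(\<lambda>n. diag (\<lambda>a. snd (snd (c (r n)) a))) \<longlonglongrightarrow> cadjoint V ** T0 ** V"
    using mm.tendsto[OF mm.tendsto[OF V' Sr(2)] V] c by (simp add: diagonalizes_def)
  note y = diag_tendsto_imp[OF this sequentially_bot]
  let ?c = "(V, \<lambda>a. (?x a, ?y a))"
  have "diagonalizes S0 T0 ?c" using uV x(1) y(1) unfolding diagonalizes_def fst_conv snd_conv by blast
  moreover have "eigendata_tendsto (\<lambda>n. c (r n)) ?c sequentially"
  proof -
    have "(\<lambda>n. snd (c (r n)) a) \<longlonglongrightarrow> (?x a, ?y a)" for a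
      using tendsto_Pair[OF x(2)[of a] y(2)[of a]] by simp
    with V show ?thesis unfolding eigendata_tendsto_def by simp
  qed
  ultimately show ?thesis using r by blast
qed

text \<open>Sequential continuity is the right notion here, because limits along the curve are taken
  along subsequences.\<close>

definition symbol_cont :: "(real \<times> real) set \<Rightarrow> nat \<Rightarrow> ((real \<times> real) list \<Rightarrow> real) \<Rightarrow> bool" where
  "symbol_cont Q n \<Phi> \<longleftrightarrow> (\<forall>q qs. length q = n \<longrightarrow> set q \<subseteq> Q \<longrightarrow> (\<forall>k :: nat. length (qs k) = n) \<longrightarrow>
      (\<forall>i<n. (\<lambda>k. qs k ! i) \<longlonglongrightarrow> q ! i) \<longrightarrow> (\<lambda>k. \<Phi> (qs k)) \<longlonglongrightarrow> \<Phi> q)"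

text \<open>The eigenbases \<open>c t\<close> need not converge, since inside a degenerate eigenspace
  they may rotate arbitrarily. But every sequence of times has a subsequence along which they do
  converge, to a diagonalization of the pair at \<open>t0\<close> that possibly differs from
  \<open>c t0\<close>, and by \<open>spectral_sum_unique\<close> the limit of the sums is the same for all of
  them. The flags \<open>b\<close> mark the bases that move with \<open>t\<close>, the others being
  frozen at \<open>t0\<close>.\<close>

lemma spectral_sum_curve_tendsto:
  fixes S T :: "real \<Rightarrow> complex^'n^'n"
  assumes c: "\<And>t. t \<in> I \<Longrightarrow> diagonalizes (S t) (T t) (c t)" and Q: "\<And>t. t \<in> I \<Longrightarrow> range (snd (c t)) \<subseteq> Q"
    and t0: "t0 \<in> I" and S: "(S \<longlongrightarrow> S t0) (at t0 within I)" and T: "(T \<longlongrightarrow> T t0) (at t0 within I)"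
    and D: "\<forall>(X, X', b)\<in>set D. (X \<longlongrightarrow> X') (at t0 within I)"
    and \<Phi>: "symbol_cont Q (Suc (length D)) \<Phi>"
  shows "((\<lambda>t. spectral_sum \<Phi> (c (if b then t else t0)) (map (\<lambda>(X, X', b). (X t, c (if b then t else t0))) D))
     \<longlongrightarrow> spectral_sum \<Phi> (c t0) (map (\<lambda>(X, X', b). (X', c t0)) D)) (at t0 within I)"
    (is "(?h \<longlongrightarrow> ?L) _")
  unfolding tendsto_at_iff_sequentially comp_def
proof (intro allI impI)
  fix \<tau> assume \<tau>: "\<forall>i. \<tau> i \<in> I - {t0}" "\<tau> \<longlonglongrightarrow> t0"
  have \<tau>F: "filterlim \<tau> (at t0 within I) sequentially"
    using \<tau> by (auto simp: filterlim_at)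
  show "(\<lambda>n. ?h (\<tau> n)) \<longlonglongrightarrow> ?L"
  proof (rule tendsto_subsequence_principle)
    fix r :: "nat \<Rightarrow> nat" assume r: "strict_mono r"
    have rF: "filterlim (\<lambda>n. \<tau> (r n)) (at t0 within I) sequentially"
      using filterlim_compose[OF \<tau>F filterlim_subseq[OF r]] .
    have ST: "(\<lambda>n. S (\<tau> (r n))) \<longlonglongrightarrow> S t0" "(\<lambda>n. T (\<tau> (r n))) \<longlonglongrightarrow> T t0"
      using filterlim_compose[OF S rF] filterlim_compose[OF T rF] by auto
    have "diagonalizes (S (\<tau> (r n))) (T (\<tau> (r n))) (c (\<tau> (r n)))" for n using c \<tau> by auto
    from diagonalizes_subsequence[OF this ST] obtain c' r' where r': "strict_mono (r' :: nat \<Rightarrow> nat)"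
      and c': "eigendata_tendsto (\<lambda>n. c (\<tau> (r (r' n)))) c' sequentially" "diagonalizes (S t0) (T t0) c'" by blast
    let ?t = "\<lambda>n. \<tau> (r (r' n))"
    have tF: "filterlim ?t (at t0 within I) sequentially"
      using filterlim_compose[OF rF filterlim_subseq[OF r']] .
    have Q': "range (snd c') \<subseteq> Q"
    proof
      fix q assume "q \<in> range (snd c')"
      then obtain b where "q = snd c' b" by blast
      moreover obtain a where "snd (c t0) a = snd c' b"
        using diagonalizes_points[OF c[OF t0] c'(2), of b] by blast
      ultimately have "q = snd (c t0) a" by simp
      with Q[OF t0] show "q \<in> Q" by blast
    qed
    let ?c = "\<lambda>b. if b then c' else c t0"
    have sl: "eigendata_tendsto (\<lambda>n. c (if b then ?t n else t0)) (?c b) sequentially" for b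
      using c'(1) by (auto simp: eigendata_tendsto_def)
    have Qb: "range (snd (?c b)) \<subseteq> Q" for b using Q' Q[OF t0] by auto
    let ?D = "map (\<lambda>(X, X', b). (\<lambda>n. X (?t n), \<lambda>n. c (if b then ?t n else t0))) D"
    have "((\<lambda>n. spectral_sum \<Phi> (c (if b then ?t n else t0)) (map (\<lambda>(X, d). (X n, d n)) ?D))
       \<longlonglongrightarrow> spectral_sum \<Phi> (?c b) (map (\<lambda>(X, X', b). (X', ?c b)) D))"
    proof (rule spectral_sum_tendsto[OF sl Qb])
      show "list_all2 (\<lambda>(X, d) (X', d'). X \<longlonglongrightarrow> X' \<and> eigendata_tendsto d d' sequentially \<and> range (snd d') \<subseteq> Q)
          ?D (map (\<lambda>(X, X', b). (X', ?c b)) D)"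
      proof (rule list_all2_map_same, goal_cases)
        case (1 z)
        obtain X X' b where z: "z = (X, X', b)" by (cases z)
        with 1 have "(\<lambda>n. X (?t n)) \<longlonglongrightarrow> X'"
          using D by (intro filterlim_compose[OF _ tF]) auto
        with sl[of b] Qb[of b] z show ?case by (simp split del: if_split)
      qed
    next
      fix qs q assume "length q = Suc (length ?D)" "set q \<subseteq> Q" "\<And>n. length (qs n) = length q"
        "\<And>i. i < length q \<Longrightarrow> (\<lambda>n. qs n ! i) \<longlonglongrightarrow> q ! i"
      then show "(\<lambda>n. \<Phi> (qs n)) \<longlonglongrightarrow> \<Phi> q"
        using \<Phi> unfolding symbol_cont_def by auto
    qed
    moreover have "spectral_sum \<Phi> (?c b) (map (\<lambda>(X, X', b). (X', ?c b)) D) = ?L"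
      using c[OF t0] c'(2)
      by (intro spectral_sum_unique[of "S t0" "T t0"] list_all2_map_same) (auto split: prod.splits)
    ultimately have "(\<lambda>n. ?h (?t n)) \<longlonglongrightarrow> ?L"
      by (simp add: comp_def case_prod_unfold split del: if_split)
    with r' show "\<exists>r'. strict_mono r' \<and> (\<lambda>n. ?h (\<tau> (r (r' n)))) \<longlonglongrightarrow> ?L" by blast
  qed
qed

section \<open>Differentiating a spectral sum\<close>

lemma has_vector_derivative_iff_slope:
  "(g has_vector_derivative D) (at t within I) \<longleftrightarrow> ((\<lambda>s. (g s - g t) /\<^sub>R (s - t)) \<longlongrightarrow> D) (at t within I)"
proof -
  have "norm ((1 / norm (s - t)) *\<^sub>R (g s - (g t + (s - t) *\<^sub>R D))) = norm ((g s - g t) /\<^sub>R (s - t) - D)"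
    if "s \<noteq> t" for s
  proof -
    have "(g s - g t) /\<^sub>R (s - t) - D = (1 / (s - t)) *\<^sub>R (g s - (g t + (s - t) *\<^sub>R D))"
      unfolding diff_diff_eq[symmetric] scaleR_diff_right[of _ _ "(s - t) *\<^sub>R D"]
      using that by (simp add: inverse_eq_divide)
    then show ?thesis by simp
  qed
  then have "eventually (\<lambda>s. norm ((1 / norm (s - t)) *\<^sub>R (g s - (g t + (s - t) *\<^sub>R D)))
      = norm ((g s - g t) /\<^sub>R (s - t) - D)) (at t within I)"
    by (auto simp: eventually_at_filter)
  note cong = tendsto_cong[OF this, of 0]
  have "(g has_vector_derivative D) (at t within I) \<longleftrightarrow>
      ((\<lambda>s. norm ((1 / norm (s - t)) *\<^sub>R (g s - (g t + (s - t) *\<^sub>R D)))) \<longlongrightarrow> 0) (at t within I)"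
    unfolding tendsto_norm_zero_iff has_vector_derivative_def has_derivative_within
    by (simp only: bounded_linear_scaleR_left simp_thms)
  also have "\<dots> \<longleftrightarrow> ((\<lambda>s. (g s - g t) /\<^sub>R (s - t)) \<longlongrightarrow> D) (at t within I)"
    by (rule trans[OF cong trans[OF tendsto_norm_zero_iff LIM_zero_iff]])
  finally show ?thesis .
qed

lemma has_vector_derivative_mult_id:
  fixes K :: "'a :: real_normed_vector"
  assumes "(k \<longlongrightarrow> K) (at t within I)"
  shows "((\<lambda>s. (s - t) *\<^sub>R k s) has_vector_derivative K) (at t within I)"
  unfolding has_vector_derivative_iff_slope
  by (rule tendsto_cong[THEN iffD1, OF _ assms]) (auto simp: eventually_at_filter)

definition spectral_sum_at :: "((real \<times> real) list \<Rightarrow> real) \<Rightarrow> 'n::finite eigendata \<Rightarrow> (complex^'n^'n) list \<Rightarrow> complex^'n^'n" where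
  "spectral_sum_at \<Phi> c Ms = spectral_sum \<Phi> c (map (\<lambda>M. (M, c)) Ms)"

text \<open>Replacing the entry at position \<open>i\<close> of the argument list changes
  \<open>\<Phi>\<close> by multiples of \<open>A i\<close> and \<open>B i\<close>, evaluated at the
  list that contains both the new and the old entry. So \<open>A i\<close> and \<open>B i\<close>
  act as divided differences of \<open>\<Phi>\<close> in that position.\<close>

definition symbol_diff where
  "symbol_diff Q n \<Phi> A B \<longleftrightarrow> (\<forall>pre p q suf. length pre + length suf = n \<longrightarrow> set (pre @ p # q # suf) \<subseteq> Q \<longrightarrow>
     \<Phi> (pre @ p # suf) - \<Phi> (pre @ q # suf) =
       (fst p - fst q) * A (length pre) (pre @ p # q # suf) +
       (snd p - snd q) * (B (length pre) (pre @ p # q # suf) :: real))"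

lemma symbol_cont_Cons:
  assumes "symbol_cont Q (Suc n) \<Phi>" "q0 \<in> Q"
  shows "symbol_cont Q n (\<lambda>qs. \<Phi> (q0 # qs))"
  unfolding symbol_cont_def
proof (intro allI impI)
  fix q qs assume *: "length q = n" "set q \<subseteq> Q" "\<forall>k::nat. length (qs k) = n" "\<forall>i<n. (\<lambda>k. qs k ! i) \<longlonglongrightarrow> q ! i"
  have "(\<lambda>k. (q0 # qs k) ! i) \<longlonglongrightarrow> (q0 # q) ! i" if "i < Suc n" for i
    using that *(4) by (cases i) auto
  with * assms show "(\<lambda>k. \<Phi> (q0 # qs k)) \<longlonglongrightarrow> \<Phi> (q0 # q)"
    unfolding symbol_cont_def by simp
qed

lemma symbol_diff_Cons:
  assumes "symbol_diff Q (Suc n) \<Phi> A B" "q0 \<in> Q"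
  shows "symbol_diff Q n (\<lambda>qs. \<Phi> (q0 # qs)) (\<lambda>i qs. A (Suc i) (q0 # qs)) (\<lambda>i qs. B (Suc i) (q0 # qs))"
  unfolding symbol_diff_def
proof (intro allI impI)
  fix pre p q suf assume *: "length pre + length suf = n" "set (pre @ p # q # suf) \<subseteq> Q"
  then show "\<Phi> (q0 # pre @ p # suf) - \<Phi> (q0 # pre @ q # suf) =
    (fst p - fst q) * A (Suc (length pre)) (q0 # pre @ p # q # suf) +
    (snd p - snd q) * B (Suc (length pre)) (q0 # pre @ p # q # suf)"
    using assms(1)[unfolded symbol_diff_def, rule_format, of "q0 # pre" suf p q] assms(2) by simp
qed

text \<open>The passage from \<open>t\<close> to \<open>t0\<close> is made from left to right: first the
  leading basis, then the leading matrix, and the rest by induction for the symbol with the first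
  point fixed at its value at \<open>t0\<close>. Each of the first two changes is \<open>t -
  t0\<close> times a spectral sum in which \<open>slope\<close> stands for a difference quotient,
  and such sums converge by \<open>spectral_sum_curve_tendsto\<close>. Fixing the first point at
  \<open>t0\<close>, and not at \<open>t\<close>, is what makes the induction hypothesis applicable.\<close>

lemma spectral_sum_at_has_derivative:
  fixes S T :: "real \<Rightarrow> complex^'n^'n"
  assumes c: "\<And>t. t \<in> I \<Longrightarrow> diagonalizes (S t) (T t) (c t)" and Q: "\<And>t. t \<in> I \<Longrightarrow> range (snd (c t)) \<subseteq> Q"
    and t0: "t0 \<in> I"
    and S: "(S has_vector_derivative S') (at t0 within I)" and T: "(T has_vector_derivative T') (at t0 within I)"
  shows "\<forall>(X, X')\<in>set Xs. (X has_vector_derivative X') (at t0 within I) \<Longrightarrow>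
    symbol_cont Q (Suc (length Xs)) \<Phi> \<Longrightarrow> symbol_diff Q (length Xs) \<Phi> A B \<Longrightarrow>
    (\<And>i. i \<le> length Xs \<Longrightarrow> symbol_cont Q (Suc (Suc (length Xs))) (A i)) \<Longrightarrow>
    (\<And>i. i \<le> length Xs \<Longrightarrow> symbol_cont Q (Suc (Suc (length Xs))) (B i)) \<Longrightarrow>
    Ms = map (\<lambda>(X, X'). X t0) Xs \<Longrightarrow>
    ((\<lambda>t. spectral_sum_at \<Phi> (c t) (map (\<lambda>(X, X'). X t) Xs)) has_vector_derivative
      ((\<Sum>i\<le>length Xs. spectral_sum_at (A i) (c t0) (take i Ms @ S' # drop i Ms)) +
       (\<Sum>i\<le>length Xs. spectral_sum_at (B i) (c t0) (take i Ms @ T' # drop i Ms)) +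
       (\<Sum>i<length Xs. spectral_sum_at \<Phi> (c t0) (take i Ms @ snd (Xs ! i) # drop (Suc i) Ms)))) (at t0 within I)"
proof (induction Xs arbitrary: \<Phi> A B Ms)
  have cont: "(X \<longlongrightarrow> X t0) (at t0 within I)" if "(X has_vector_derivative X') (at t0 within I)" for X X'
    using has_vector_derivative_continuous[OF that] by (simp add: continuous_within)
  define slope where "slope X t = (X t - X t0) /\<^sub>R (t - t0)" for X :: "real \<Rightarrow> complex^'n^'n" and t
  have slope: "(slope X \<longlongrightarrow> X') (at t0 within I)" if "(X has_vector_derivative X') (at t0 within I)" for X X'
    using that unfolding slope_def[abs_def] by (simp add: has_vector_derivative_iff_slope)
  have slope_eq: "X t - X t0 = (t - t0) *\<^sub>R slope X t" for X t
    by (cases "t = t0") (simp_all add: slope_def)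
  \<comment> \<open>The contribution of the leading basis, after \<open>spectral_sum_perturb\<close> has
    turned it into spectral sums with the increments of \<open>S\<close> and \<open>T\<close>.\<close>
  have move: "((\<lambda>t. spectral_sum A (c t) ((S t - S t0, c t0) # map (\<lambda>M. (M, c t)) (map (\<lambda>(X, X'). X t) Xs)) +
       spectral_sum B (c t) ((T t - T t0, c t0) # map (\<lambda>M. (M, c t)) (map (\<lambda>(X, X'). X t) Xs)))
      has_vector_derivative
        (spectral_sum_at A (c t0) (S' # map (\<lambda>(X, X'). X t0) Xs) + spectral_sum_at B (c t0) (T' # map (\<lambda>(X, X'). X t0) Xs)))
        (at t0 within I)"
    if Xs: "\<forall>(X, X')\<in>set Xs. (X has_vector_derivative X') (at t0 within I)"
      and A: "symbol_cont Q (Suc (Suc (length Xs))) A" and B: "symbol_cont Q (Suc (Suc (length Xs))) B"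
    for Xs :: "((real \<Rightarrow> complex^'n^'n) \<times> (complex^'n^'n)) list" and A B
  proof -
    let ?D = "\<lambda>X X'. (X, X', False) # map (\<lambda>(X, X'). (X, X t0, True)) Xs"
    have D: "\<forall>(X, X', b)\<in>set (?D (slope X) X'). (X \<longlongrightarrow> X') (at t0 within I)"
      if "(X has_vector_derivative X') (at t0 within I)" for X X'
    proof -
      have "(Y \<longlongrightarrow> Y t0) (at t0 within I)" if "(Y, Y') \<in> set Xs" for Y Y'
        by (rule cont[of Y Y']) (use Xs that in auto)
      with slope[OF that] show ?thesis by auto
    qed
    have eq: "map (\<lambda>(X, X', b). (X t, c (if b then t else t0))) (?D (slope X) X')
        = (slope X t, c t0) # map (\<lambda>M. (M, c t)) (map (\<lambda>(X, X'). X t) Xs)"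
      "map (\<lambda>(X, X', b). (X', c t0)) (?D (slope X) X')
        = map (\<lambda>M. (M, c t0)) (X' # map (\<lambda>(X, X'). X t0) Xs)" for X X' t
      by (auto simp: case_prod_beta)
    have "((\<lambda>t. spectral_sum A (c t) ((slope S t, c t0) # map (\<lambda>M. (M, c t)) (map (\<lambda>(X, X'). X t) Xs)))
       \<longlongrightarrow> spectral_sum_at A (c t0) (S' # map (\<lambda>(X, X'). X t0) Xs)) (at t0 within I)"
      using spectral_sum_curve_tendsto[OF c Q t0 cont[OF S] cont[OF T] D[OF S], of A True] A
      unfolding eq spectral_sum_at_def by simp
    moreover have "((\<lambda>t. spectral_sum B (c t) ((slope T t, c t0) # map (\<lambda>M. (M, c t)) (map (\<lambda>(X, X'). X t) Xs)))
       \<longlongrightarrow> spectral_sum_at B (c t0) (T' # map (\<lambda>(X, X'). X t0) Xs)) (at t0 within I)"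
      using spectral_sum_curve_tendsto[OF c Q t0 cont[OF S] cont[OF T] D[OF T], of B True] B
      unfolding eq spectral_sum_at_def by simp
    ultimately show ?thesis
      unfolding slope_eq[of S] slope_eq[of T] spectral_sum_scale_head
      by (intro has_vector_derivative_add has_vector_derivative_mult_id)
  qed
  have perturb: "spectral_sum \<Phi> (c t) (map (\<lambda>M. (M, c t)) Ms) = spectral_sum (A 0) (c t) ((S t - S t0, c t0) # map (\<lambda>M. (M, c t)) Ms) +
       spectral_sum (B 0) (c t) ((T t - T t0, c t0) # map (\<lambda>M. (M, c t)) Ms) +
       spectral_sum \<Phi> (c t0) (map (\<lambda>M. (M, c t)) Ms)"
    if "t \<in> I" "symbol_diff Q (length Ms) \<Phi> A B" for t \<Phi> A B Ms
  proof -
    have "spectral_sum \<Phi> (c t) (map (\<lambda>M. (M, c t)) Ms) - spectral_sum \<Phi> (c t0) (map (\<lambda>M. (M, c t)) Ms)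
      = spectral_sum (A 0) (c t) ((S t - S t0, c t0) # map (\<lambda>M. (M, c t)) Ms) +
       spectral_sum (B 0) (c t) ((T t - T t0, c t0) # map (\<lambda>M. (M, c t)) Ms)"
    proof (rule spectral_sum_perturb[OF c[OF that(1)] Q[OF that(1)] c[OF t0] Q[OF t0]])
      show "\<forall>(X, d)\<in>set (map (\<lambda>M. (M, c t)) Ms). range (snd d) \<subseteq> Q"
        using Q[OF that(1)] by auto
      fix p q qs assume "length qs = length (map (\<lambda>M. (M, c t)) Ms)" "set (p # q # qs) \<subseteq> Q"
      then show "\<Phi> (p # qs) - \<Phi> (q # qs) = (fst p - fst q) * A 0 (p # q # qs) + (snd p - snd q) * B 0 (p # q # qs)"
        using that(2)[unfolded symbol_diff_def, rule_format, of "[]" qs p q] by simp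
    qed
    then show ?thesis by (simp add: algebra_simps)
  qed
  {
    case Nil
    have "((\<lambda>t. spectral_sum \<Phi> (c t0) []) has_vector_derivative 0) (at t0 within I)"
      by (rule has_vector_derivative_const)
    from has_vector_derivative_add[OF move[of "[]" "A 0" "B 0"] this]
    have "((\<lambda>t. spectral_sum (A 0) (c t) [(S t - S t0, c t0)] + spectral_sum (B 0) (c t) [(T t - T t0, c t0)] + spectral_sum \<Phi> (c t0) [])
        has_vector_derivative spectral_sum_at (A 0) (c t0) [S'] + spectral_sum_at (B 0) (c t0) [T']) (at t0 within I)"
      using Nil by simp
    then have "((\<lambda>t. spectral_sum \<Phi> (c t) []) has_vector_derivative
        spectral_sum_at (A 0) (c t0) [S'] + spectral_sum_at (B 0) (c t0) [T']) (at t0 within I)"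
      by (rule has_vector_derivative_transform[OF t0, rotated])
        (use perturb[of _ "[]" \<Phi> A B] Nil in simp)
    then show ?case using Nil by (simp add: spectral_sum_at_def del: spectral_sum.simps)
  next
    case (Cons XX Xs)
    obtain X X' where XX: "XX = (X, X')" by (cases XX)
    let ?M = "\<lambda>t. map (\<lambda>(X, X'). X t) Xs"
    let ?P = "proj (fst (c t0))" and ?p = "snd (c t0)"
    have X: "(X has_vector_derivative X') (at t0 within I)" using Cons.prems(1) XX by auto
    have Xs: "\<forall>(X, X')\<in>set Xs. (X has_vector_derivative X') (at t0 within I)" using Cons.prems(1) by auto
    have p: "?p a \<in> Q" for a using Q[OF t0] by auto
    let ?IH = "\<lambda>a. (\<Sum>i\<le>length Xs. spectral_sum_at (\<lambda>qs. A (Suc i) (?p a # qs)) (c t0) (take i (?M t0) @ S' # drop i (?M t0))) +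
       (\<Sum>i\<le>length Xs. spectral_sum_at (\<lambda>qs. B (Suc i) (?p a # qs)) (c t0) (take i (?M t0) @ T' # drop i (?M t0))) +
       (\<Sum>i<length Xs. spectral_sum_at (\<lambda>qs. \<Phi> (?p a # qs)) (c t0) (take i (?M t0) @ snd (Xs ! i) # drop (Suc i) (?M t0)))"
    have IH: "((\<lambda>t. spectral_sum_at (\<lambda>qs. \<Phi> (?p a # qs)) (c t) (?M t)) has_vector_derivative ?IH a) (at t0 within I)" for a
      using Cons.prems p by (intro Cons.IH Xs symbol_cont_Cons symbol_diff_Cons refl) auto
    \<comment> \<open>The part in which the leading basis and the leading matrix are already
      frozen at \<open>t0\<close>. It is linear in the shorter sums of the induction hypothesis.\<close>
    define G where "G t = (\<Sum>a\<in>UNIV. ?P a ** (X t0 ** spectral_sum_at (\<lambda>qs. \<Phi> (?p a # qs)) (c t) (?M t)))" for t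
    have G: "(G has_vector_derivative (\<Sum>a\<in>UNIV. ?P a ** (X t0 ** ?IH a))) (at t0 within I)"
      unfolding G_def
      by (intro has_vector_derivative_sum bounded_linear.has_vector_derivative[OF mm.bounded_linear_right] IH)
    let ?D = "(slope X, X', True) # map (\<lambda>(X, X'). (X, X t0, True)) Xs"
    have D: "\<forall>(X, X', b)\<in>set ?D. (X \<longlongrightarrow> X') (at t0 within I)"
    proof -
      have "(Y \<longlongrightarrow> Y t0) (at t0 within I)" if "(Y, Y') \<in> set Xs" for Y Y'
        by (rule cont[of Y Y']) (use Xs that in auto)
      with slope[OF X] show ?thesis by auto
    qed
    have eq: "map (\<lambda>(X, X', b). (X t, c (if b then t else t0))) ?D
        = (slope X t, c t) # map (\<lambda>M. (M, c t)) (?M t)"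
      "map (\<lambda>(X, X', b). (X', c t0)) ?D = map (\<lambda>M. (M, c t0)) (X' # ?M t0)" for t
      by (auto simp: case_prod_beta)
    have "((\<lambda>t. spectral_sum \<Phi> (c t0) ((slope X t, c t) # map (\<lambda>M. (M, c t)) (?M t)))
       \<longlongrightarrow> spectral_sum_at \<Phi> (c t0) (X' # ?M t0)) (at t0 within I)"
      using spectral_sum_curve_tendsto[OF c Q t0 cont[OF S] cont[OF T] D, of \<Phi> False] Cons.prems(2)
      unfolding eq spectral_sum_at_def by simp
    from has_vector_derivative_mult_id[OF this]
    have H: "((\<lambda>t. spectral_sum \<Phi> (c t0) ((X t - X t0, c t) # map (\<lambda>M. (M, c t)) (?M t))) has_vector_derivative
         spectral_sum_at \<Phi> (c t0) (X' # ?M t0)) (at t0 within I)"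
      unfolding slope_eq[of X] spectral_sum_scale_head .
    have "spectral_sum \<Phi> (c t0) (map (\<lambda>M. (M, c t)) (X t # ?M t)) =
       spectral_sum \<Phi> (c t0) ((X t - X t0, c t) # map (\<lambda>M. (M, c t)) (?M t)) + G t" for t
      unfolding spectral_sum_diff_head[symmetric] by (simp add: G_def spectral_sum_at_def)
    with perturb[of _ "X _ # ?M _" \<Phi> A B] Cons.prems(3)
    have split: "spectral_sum_at \<Phi> (c t) (map (\<lambda>(X, X'). X t) (XX # Xs)) =
       spectral_sum (A 0) (c t) ((S t - S t0, c t0) # map (\<lambda>M. (M, c t)) (map (\<lambda>(X, X'). X t) (XX # Xs))) +
       spectral_sum (B 0) (c t) ((T t - T t0, c t0) # map (\<lambda>M. (M, c t)) (map (\<lambda>(X, X'). X t) (XX # Xs))) +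
       (spectral_sum \<Phi> (c t0) ((X t - X t0, c t) # map (\<lambda>M. (M, c t)) (?M t)) + G t)"
      if "t \<in> I" for t using that by (simp add: spectral_sum_at_def XX del: spectral_sum.simps)
    have "((\<lambda>t. spectral_sum_at \<Phi> (c t) (map (\<lambda>(X, X'). X t) (XX # Xs))) has_vector_derivative
      (spectral_sum_at (A 0) (c t0) (S' # Ms) + spectral_sum_at (B 0) (c t0) (T' # Ms)) +
      (spectral_sum_at \<Phi> (c t0) (X' # ?M t0) + (\<Sum>a\<in>UNIV. ?P a ** (X t0 ** ?IH a)))) (at t0 within I)"
      unfolding Cons.prems(6)
      by (rule has_vector_derivative_transform[OF t0 split
           has_vector_derivative_add[OF move has_vector_derivative_add[OF H G]]])
        (use Cons.prems in auto)
    moreover have "(\<Sum>a\<in>UNIV. ?P a ** (X t0 ** ?IH a)) =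
      (\<Sum>i\<le>length Xs. spectral_sum_at (A (Suc i)) (c t0) (take (Suc i) Ms @ S' # drop (Suc i) Ms)) +
      (\<Sum>i\<le>length Xs. spectral_sum_at (B (Suc i)) (c t0) (take (Suc i) Ms @ T' # drop (Suc i) Ms)) +
      (\<Sum>i<length Xs. spectral_sum_at \<Phi> (c t0) (take (Suc i) Ms @ snd ((XX # Xs) ! Suc i) # drop (Suc (Suc i)) Ms))"
    proof -
      have *: "(\<Sum>a\<in>UNIV. ?P a ** (X t0 ** (\<Sum>i\<in>N. spectral_sum_at (\<lambda>qs. Y i (?p a # qs)) (c t0) (Z i))))
         = (\<Sum>i\<in>N. spectral_sum_at (Y i) (c t0) (X t0 # Z i))" for Y Z and N :: "nat set"
        by (simp add: mm.sum_right spectral_sum_at_def) (rule sum.swap)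
      show ?thesis
        by (simp add: mm.add_right sum.distrib *[of "\<lambda>i. A (Suc i)"] *[of "\<lambda>i. B (Suc i)"] *[of "\<lambda>_. \<Phi>"] Cons.prems(6) XX)
    qed
    ultimately show ?case
      by (simp add: sum.atMost_Suc_shift sum.lessThan_Suc_shift XX Cons.prems(6) add_ac del: sum.atMost_Suc sum.lessThan_Suc)
  }
qed

section \<open>Divided differences as symbols\<close>

text \<open>The divided difference of order \<open>(k, r)\<close> as a symbol. The entry at position
  \<open>k\<close> contributes to both groups of nodes, its first component as the last
  \<open>x\<close>-node and its second component as the first \<open>y\<close>-node.\<close>

definition hg_symbol :: "(real \<times> real \<Rightarrow> real) \<Rightarrow> nat \<Rightarrow> nat \<Rightarrow> (real \<times> real) list \<Rightarrow> real" where
  "hg_symbol f k r qs = hg_integral k r f (\<lambda>i. fst (qs ! i)) (\<lambda>i. snd (qs ! (k + i)))"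

lemma tendsto_coordinatewise:
  fixes X :: "'t \<Rightarrow> nat \<Rightarrow> real"
  assumes "\<And>i. ((\<lambda>n. X n i) \<longlongrightarrow> x i) F"
  shows "(X \<longlongrightarrow> x) F"
  using assms limitin_componentwise[of "\<lambda>_. euclidean" UNIV X x F]
  by (simp add: euclidean_product_topology)

text \<open>The nodes are read off through \<open>min\<close> so that entries past the end of a list,
  about which nothing is known, never enter.\<close>

lemma hg_symbol_cont:
  assumes J: "is_interval J1" "is_interval J2" "open J1" "open J2"
    and f: "Cm_on (k + r) (J1 \<times> J2) f"
  shows "symbol_cont (J1 \<times> J2) (Suc (k + r)) (hg_symbol f k r)"
  unfolding symbol_cont_def
proof (intro allI impI)
  fix q and qs :: "nat \<Rightarrow> (real \<times> real) list"
  assume q: "length q = Suc (k + r)" "set q \<subseteq> J1 \<times> J2"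
    and qs: "\<forall>n. length (qs n) = Suc (k + r)" "\<forall>i<Suc (k + r). (\<lambda>n. qs n ! i) \<longlonglongrightarrow> q ! i"
  let ?x = "\<lambda>q i. fst (q ! min i k) :: real" and ?y = "\<lambda>q i. snd (q ! (k + min i r)) :: real"
  have eq: "hg_symbol f k r p = hg_integral k r f (?x p) (?y p)" for p
    unfolding hg_symbol_def by (rule hg_integral_cong) auto
  have "(\<lambda>n. ?x (qs n)) \<longlonglongrightarrow> ?x q"
    using qs by (intro tendsto_coordinatewise tendsto_fst) auto
  moreover have "(\<lambda>n. ?y (qs n)) \<longlonglongrightarrow> ?y q"
    using qs by (intro tendsto_coordinatewise tendsto_snd) auto
  moreover have "(?x q, ?y q) \<in> grid J1 J2 k r"
  proof -
    have "q ! i \<in> J1 \<times> J2" if "i < Suc (k + r)" for i using q that by (metis nth_mem subsetD)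
    then show ?thesis by (auto simp: grid_def mem_Times_iff)
  qed
  ultimately show "(\<lambda>n. hg_symbol f k r (qs n)) \<longlonglongrightarrow> hg_symbol f k r q"
    unfolding eq by (rule hg_integral_tendsto[OF J f])
qed

text \<open>An entry before position \<open>k\<close> supplies only an \<open>x\<close>-node and an entry
  after it only a \<open>y\<close>-node. The entry at position \<open>k\<close> supplies one of
  each, and its two components are changed one after the other: first the \<open>y\<close>-node at
  the new \<open>x\<close>-node, then the \<open>x\<close>-node at the old \<open>y\<close>-node. In
  this order both resulting divided differences have their nodes arranged as in the list with both
  entries.\<close>

lemma hg_symbol_diff:
  assumes J: "is_interval J1" "is_interval J2" "open J1" "open J2"
    and f: "Cm_on (Suc (k + r)) (J1 \<times> J2) f"
  shows "symbol_diff (J1 \<times> J2) (k + r) (hg_symbol f k r)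
    (\<lambda>i. if i \<le> k then hg_symbol f (Suc k) r else (\<lambda>_. 0)) (\<lambda>i. if k \<le> i then hg_symbol f k (Suc r) else (\<lambda>_. 0))"
  unfolding symbol_diff_def
proof (intro allI impI)
  fix pre suf :: "(real \<times> real) list" and p q
  assume len: "length pre + length suf = k + r" and Q: "set (pre @ p # q # suf) \<subseteq> J1 \<times> J2"
  define w where "w = pre @ p # q # suf"
  define i where "i = length pre"
  define X where "X j = fst (w ! j)" for j
  have w: "w ! i = p" "w ! Suc i = q" by (simp_all add: w_def i_def nth_append)
  have skip1: "(pre @ p # suf) ! j = w ! skip (Suc i) j" for j
    by (auto simp: w_def i_def nth_append skip_def nth_Cons' not_less less_Suc_eq)
  have skip2: "(pre @ q # suf) ! j = w ! skip i j" for j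
    by (auto simp: w_def i_def nth_append skip_def nth_Cons' not_less less_Suc_eq Suc_diff_le)
  have wJ: "fst (w ! j) \<in> J1" "snd (w ! j) \<in> J2" if "j \<le> Suc (k + r)" for j
  proof -
    have "w ! j \<in> set w" using that len by (intro nth_mem) (simp add: w_def)
    then show "fst (w ! j) \<in> J1" "snd (w ! j) \<in> J2" using Q by (auto simp: w_def mem_Times_iff)
  qed
  have f1: "Cm_on (Suc k + r) (J1 \<times> J2) f" and f2: "Cm_on (k + Suc r) (J1 \<times> J2) f"
    using f by (simp_all del: Cm_on.simps)
  have gx: "(X, \<lambda>j. snd (w ! (Suc k + j))) \<in> grid J1 J2 (Suc k) r"
    and gy: "(X, \<lambda>j. snd (w ! (k + j))) \<in> grid J1 J2 k (Suc r)"
    using wJ by (auto simp: grid_def X_def)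
  note dx = hg_integral_diff_x[OF J f1 gx] and dy = hg_integral_diff_y[OF J f2 gy]
  have ir: "i \<le> k + r" using len by (simp add: i_def)
  consider "i < k" | "i = k" | "k < i" by linarith
  then have "hg_symbol f k r (pre @ p # suf) - hg_symbol f k r (pre @ q # suf) =
     (fst p - fst q) * (if i \<le> k then hg_symbol f (Suc k) r else (\<lambda>_. 0)) w +
     (snd p - snd q) * (if k \<le> i then hg_symbol f k (Suc r) else (\<lambda>_. 0)) w"
  proof cases
    case 1
    have "hg_symbol f k r (pre @ p # suf) = hg_integral k r f (\<lambda>j. X (skip (Suc i) j)) (\<lambda>j. snd (w ! (Suc k + j)))"
      unfolding hg_symbol_def skip1 using 1 by (intro hg_integral_cong) (auto simp: X_def skip_def)
    moreover have "hg_symbol f k r (pre @ q # suf) = hg_integral k r f (\<lambda>j. X (skip i j)) (\<lambda>j. snd (w ! (Suc k + j)))"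
      unfolding hg_symbol_def skip2 using 1 by (intro hg_integral_cong) (auto simp: X_def skip_def)
    ultimately show ?thesis
      using dx[of i] 1 w by (simp add: X_def[abs_def] hg_symbol_def del: hg_integral.simps)
  next
    case 2
    let ?Y = "\<lambda>j. snd (w ! (k + j))"
    have "hg_symbol f k r (pre @ p # suf) = hg_integral k r f (\<lambda>j. X (skip (Suc i) j)) (\<lambda>j. ?Y (skip (Suc 0) j))"
      unfolding hg_symbol_def skip1 using 2 by (intro hg_integral_cong) (auto simp: X_def skip_def)
    also have "\<dots> = hg_integral k r f X (\<lambda>j. ?Y (skip (Suc 0) j))"
      using 2 by (intro hg_integral_cong) (auto simp: X_def skip_def)
    finally have 21: "hg_symbol f k r (pre @ p # suf) = hg_integral k r f X (\<lambda>j. ?Y (skip (Suc 0) j))" .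
    have 22: "hg_symbol f k r (pre @ q # suf) = hg_integral k r f (\<lambda>j. X (skip i j)) (\<lambda>j. snd (w ! (Suc k + j)))"
      unfolding hg_symbol_def skip2 using 2 by (intro hg_integral_cong) (auto simp: X_def skip_def)
    have 23: "hg_integral k r f X (\<lambda>j. ?Y (skip 0 j)) = hg_integral k r f (\<lambda>j. X (skip (Suc i) j)) (\<lambda>j. snd (w ! (Suc k + j)))"
      using 2 by (intro hg_integral_cong) (auto simp: X_def skip_def)
    show ?thesis
      using dx[of i] dy[of 0] 2 w unfolding 21 22 23 by (simp add: X_def[abs_def] hg_symbol_def del: hg_integral.simps)
  next
    case 3
    let ?Y = "\<lambda>j. snd (w ! (k + j))"
    have "hg_symbol f k r (pre @ p # suf) = hg_integral k r f X (\<lambda>j. ?Y (skip (Suc (i - k)) j))"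
      unfolding hg_symbol_def skip1 using 3 by (intro hg_integral_cong) (auto simp: X_def skip_def)
    moreover have "hg_symbol f k r (pre @ q # suf) = hg_integral k r f X (\<lambda>j. ?Y (skip (i - k) j))"
      unfolding hg_symbol_def skip2 using 3 by (intro hg_integral_cong) (auto simp: X_def skip_def)
    ultimately show ?thesis
      using dy[of "i - k"] 3 w ir by (simp add: X_def[abs_def] hg_symbol_def del: hg_integral.simps)
  qed
  then show "hg_symbol f k r (pre @ p # suf) - hg_symbol f k r (pre @ q # suf) =
     (fst p - fst q) * (if length pre \<le> k then hg_symbol f (Suc k) r else (\<lambda>_. 0)) (pre @ p # q # suf) +
     (snd p - snd q) * (if k \<le> length pre then hg_symbol f k (Suc r) else (\<lambda>_. 0)) (pre @ p # q # suf)"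
    by (simp only: i_def w_def)
qed

lemma spectral_sum_at_0: "spectral_sum_at (\<lambda>_. 0) c Ms = 0"
  using spectral_sum_linear[of 0 "\<lambda>_. 0" 0 "\<lambda>_. 0" c "map (\<lambda>M. (M, c)) Ms"] by (simp add: spectral_sum_at_def)

section \<open>Counting compositions\<close>

definition compositions :: "nat \<Rightarrow> nat list set" where
  "compositions l = {a. sum_list a = l \<and> (\<forall>i\<in>set a. 1 \<le> i)}"

definition weight :: "nat list \<Rightarrow> real" where
  "weight a = 1 / prod_list (map fact a)"

lemma length_le_sum_list: "\<forall>i\<in>set a. 1 \<le> i \<Longrightarrow> length a \<le> sum_list a" for a :: "nat list"
  by (induction a) auto

lemma finite_compositions: "finite (compositions l)"
proof (rule finite_subset)
  show "compositions l \<subseteq> {a. set a \<subseteq> {..l} \<and> length a \<le> l}"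
    by (auto simp: compositions_def intro: member_le_sum_list length_le_sum_list)
qed (rule finite_lists_length_le, simp)

lemma sum_cut_points:
  "(\<Sum>a\<in>compositions l. \<Sum>i\<le>length a. F (take i a) (drop i a)) = (\<Sum>(u, v)\<in>{(u, v). u @ v \<in> compositions l}. F u v)"
  for F :: "nat list \<Rightarrow> nat list \<Rightarrow> 'v :: comm_monoid_add"
  by (subst sum.Sigma[OF finite_compositions], simp)
    (rule sum.reindex_bij_witness[where i = "\<lambda>(u, v). (u @ v, length u)" and j = "\<lambda>(a, i). (take i a, drop i a)"],
     auto)

lemma sum_marked_parts:
  "(\<Sum>a\<in>compositions l. \<Sum>i<length a. F (take i a) (a ! i) (drop (Suc i) a))
    = (\<Sum>(u, h, v)\<in>{(u, h, v). u @ h # v \<in> compositions l}. F u h v)"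
  for F :: "nat list \<Rightarrow> nat \<Rightarrow> nat list \<Rightarrow> 'v :: comm_monoid_add"
  by (subst sum.Sigma[OF finite_compositions], simp)
    (rule sum.reindex_bij_witness[where i = "\<lambda>(u, h, v). (u @ h # v, length u)"
        and j = "\<lambda>(a, i). (take i a, a ! i, drop (Suc i) a)"],
     auto simp: id_take_nth_drop[symmetric])

lemma finite_marked: "finite {(u, h, v). u @ h # v \<in> compositions l}"
proof -
  have "{(u, h, v). u @ h # v \<in> compositions l} \<subseteq>
      (\<lambda>(a, i). (take i a, a ! i, drop (Suc i) a)) ` (SIGMA a:compositions l. {..<length a})"
  proof clarify
    fix u h v assume "u @ h # v \<in> compositions l"
    then show "(u, h, v) \<in> (\<lambda>(a, i). (take i a, a ! i, drop (Suc i) a)) ` (SIGMA a:compositions l. {..<length a})"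
      by (intro image_eqI[of _ _ "(u @ h # v, length u)"]) auto
  qed
  then show ?thesis by (rule finite_subset) (auto intro: finite_compositions)
qed

text \<open>A composition of \<open>l + 1\<close> with a marked part arises either by inserting a new
  part 1 or by increasing a part of a composition of \<open>l\<close>, and it tells which. Marking a
  part \<open>h\<close> with multiplicity \<open>h\<close> gives each composition the total
  multiplicity \<open>l + 1\<close>, and \<open>h / h! = 1 / (h - 1)!\<close> returns the weight of
  the composition before the step.\<close>

lemma sum_compositions_Suc:
  fixes G :: "nat list \<Rightarrow> 'v :: real_vector"
  shows "(\<Sum>a\<in>compositions l. weight a *\<^sub>R ((\<Sum>i\<le>length a. G (take i a @ 1 # drop i a)) +
       (\<Sum>i<length a. G (take i a @ Suc (a ! i) # drop (Suc i) a))))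
    = real (Suc l) *\<^sub>R (\<Sum>a\<in>compositions (Suc l). weight a *\<^sub>R G a)"
proof -
  define H where "H u h v = (real h * weight (u @ h # v)) *\<^sub>R G (u @ h # v)" for u h v
  let ?N = "{(u, v). u @ v \<in> compositions l}" and ?M = "\<lambda>l. {(u, h, v). u @ h # v \<in> compositions l}"
  have H1: "H u 1 v = weight (u @ v) *\<^sub>R G (u @ 1 # v)" for u v
    by (simp add: H_def weight_def)
  have HS: "H u (Suc h) v = weight (u @ h # v) *\<^sub>R G (u @ Suc h # v)" for u h v
  proof -
    have "c * (1 / (x * ((c * y) * z))) = 1 / (x * (y * z))" if "c \<noteq> 0" for c x y z :: real
      using that by simp
    from this[of "real (Suc h)"] have "real (Suc h) * weight (u @ Suc h # v) = weight (u @ h # v)"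
      by (simp add: weight_def del: of_nat_Suc)
    then show ?thesis by (simp only: H_def)
  qed
  have "real (Suc l) *\<^sub>R (\<Sum>a\<in>compositions (Suc l). weight a *\<^sub>R G a)
      = (\<Sum>a\<in>compositions (Suc l). \<Sum>i<length a. H (take i a) (a ! i) (drop (Suc i) a))"
  proof (unfold scaleR_sum_right, intro sum.cong refl)
    fix a assume "a \<in> compositions (Suc l)"
    then have "real (Suc l) = (\<Sum>i<length a. real (a ! i))"
      unfolding compositions_def by (simp add: sum_list_sum_nth atLeast0LessThan flip: of_nat_sum)
    then show "real (Suc l) *\<^sub>R weight a *\<^sub>R G a = (\<Sum>i<length a. H (take i a) (a ! i) (drop (Suc i) a))"
      by (simp add: H_def id_take_nth_drop[symmetric] scaleR_sum_left sum_distrib_right flip: scaleR_scaleR)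
  qed
  also have "\<dots> = (\<Sum>(u, h, v)\<in>?M (Suc l). H u h v)" by (rule sum_marked_parts)
  also have "?M (Suc l) = (\<lambda>(u, v). (u, 1, v)) ` ?N \<union> (\<lambda>(u, h, v). (u, Suc h, v)) ` ?M l"
  proof (intro equalityI subsetI)
    fix z assume "z \<in> ?M (Suc l)"
    then obtain u h v where z: "z = (u, h, v)" "u @ h # v \<in> compositions (Suc l)" by auto
    then obtain h' where h: "h = Suc h'" by (cases h) (auto simp: compositions_def)
    show "z \<in> (\<lambda>(u, v). (u, 1, v)) ` ?N \<union> (\<lambda>(u, h, v). (u, Suc h, v)) ` ?M l"
    proof (cases h')
      case 0
      then show ?thesis using z h by (auto simp: compositions_def image_iff)
    next
      case (Suc h'')
      then have "(u, h', v) \<in> ?M l" using z h by (auto simp: compositions_def)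
      then have "(\<lambda>(u, h, v). (u, Suc h, v)) (u, h', v) \<in> (\<lambda>(u, h, v). (u, Suc h, v)) ` ?M l" by (rule imageI)
      then show ?thesis using z h by simp
    qed
  qed (auto simp: compositions_def)
  also have "(\<Sum>(u, h, v)\<in>\<dots>. H u h v) = (\<Sum>(u, v)\<in>?N. H u 1 v) + (\<Sum>(u, h, v)\<in>?M l. H u (Suc h) v)"
  proof (subst sum.union_disjoint)
    have "?N \<subseteq> (\<lambda>(a, i). (take i a, drop i a)) ` (SIGMA a:compositions l. {..length a})"
    proof clarify
      fix u v assume "u @ v \<in> compositions l"
      then show "(u, v) \<in> (\<lambda>(a, i). (take i a, drop i a)) ` (SIGMA a:compositions l. {..length a})"
        by (intro image_eqI[of _ _ "(u @ v, length u)"]) auto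
    qed
    then have "finite ?N" by (rule finite_subset) (auto intro: finite_compositions)
    then show "finite ((\<lambda>(u, v). (u, 1 :: nat, v)) ` ?N)" by simp
    show "finite ((\<lambda>(u, h, v). (u, Suc h, v)) ` ?M l)" using finite_marked by simp
    show "(\<lambda>(u, v). (u, 1, v)) ` ?N \<inter> (\<lambda>(u, h, v). (u, Suc h, v)) ` ?M l = {}"
      by (auto simp: compositions_def)
    show "(\<Sum>(u, h, v)\<in>(\<lambda>(u, v). (u, 1, v)) ` ?N. H u h v) + (\<Sum>(u, h, v)\<in>(\<lambda>(u, h, v). (u, Suc h, v)) ` ?M l. H u h v)
      = (\<Sum>(u, v)\<in>?N. H u 1 v) + (\<Sum>(u, h, v)\<in>?M l. H u (Suc h) v)"
      by (subst (1 2) sum.reindex) (auto simp: inj_on_def case_prod_unfold)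
  qed
  also have "(\<Sum>(u, v)\<in>?N. H u 1 v) = (\<Sum>a\<in>compositions l. \<Sum>i\<le>length a. H (take i a) 1 (drop i a))"
    by (rule sum_cut_points[symmetric])
  also have "(\<Sum>(u, h, v)\<in>?M l. H u (Suc h) v)
      = (\<Sum>a\<in>compositions l. \<Sum>i<length a. H (take i a) (Suc (a ! i)) (drop (Suc i) a))"
    by (rule sum_marked_parts[symmetric])
  finally show ?thesis
    unfolding H1 HS by (simp add: scaleR_add_right scaleR_sum_right sum.distrib id_take_nth_drop[symmetric])
qed

text \<open>Unlike \<open>index_set\<close>, the pair of empty compositions is admitted, so that the case
  \<open>l = 0\<close> is the function itself and can start the induction.\<close>

definition composition_pairs :: "nat \<Rightarrow> (nat list \<times> nat list) set" where
  "composition_pairs l = {(a, b). sum_list a + sum_list b = l \<and> (\<forall>i\<in>set a \<union> set b. 1 \<le> i)}"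

lemma index_set_eq_composition_pairs: "1 \<le> l \<Longrightarrow> index_set l = composition_pairs l"
  by (auto simp: index_set_def composition_pairs_def Suc_le_eq)

lemma sum_composition_pairs:
  fixes F :: "nat list \<Rightarrow> nat list \<Rightarrow> 'v :: comm_monoid_add"
  shows "(\<Sum>(a, b)\<in>composition_pairs l. F a b) = (\<Sum>u\<le>l. \<Sum>a\<in>compositions u. \<Sum>b\<in>compositions (l - u). F a b)"
proof -
  have "composition_pairs l = (\<Union>u\<in>{..l}. compositions u \<times> compositions (l - u))"
    by (auto simp: composition_pairs_def compositions_def)
  also have "(\<Sum>(a, b)\<in>\<dots>. F a b) = (\<Sum>u\<le>l. \<Sum>(a, b)\<in>compositions u \<times> compositions (l - u). F a b)"
    by (rule sum.UNION_disjoint) (simp, simp add: finite_compositions, auto simp: compositions_def)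
  finally show ?thesis by (simp add: sum.cartesian_product)
qed

text \<open>The preceding identity in each component, sorted by the sum \<open>u\<close> of the first
  composition. The factors \<open>u\<close> and \<open>l + 1 - u\<close> combine to \<open>l +
  1\<close>.\<close>

lemma sum_composition_pairs_Suc:
  fixes G :: "nat list \<Rightarrow> nat list \<Rightarrow> 'v :: real_vector"
  shows "(\<Sum>(a, b)\<in>composition_pairs l. (weight a * weight b) *\<^sub>R
      ((\<Sum>i\<le>length a. G (take i a @ 1 # drop i a) b) + (\<Sum>i\<le>length b. G a (take i b @ 1 # drop i b)) +
       (\<Sum>i<length a. G (take i a @ Suc (a ! i) # drop (Suc i) a) b) +
       (\<Sum>i<length b. G a (take i b @ Suc (b ! i) # drop (Suc i) b))))
    = real (Suc l) *\<^sub>R (\<Sum>(a, b)\<in>composition_pairs (Suc l). (weight a * weight b) *\<^sub>R G a b)"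
proof -
  define g where "g u v = (\<Sum>a\<in>compositions u. \<Sum>b\<in>compositions v. (weight a * weight b) *\<^sub>R G a b)" for u v
  let ?A = "\<lambda>a b. (\<Sum>i\<le>length a. G (take i a @ 1 # drop i a) b) + (\<Sum>i<length a. G (take i a @ Suc (a ! i) # drop (Suc i) a) b)"
  let ?B = "\<lambda>a b. (\<Sum>i\<le>length b. G a (take i b @ 1 # drop i b)) + (\<Sum>i<length b. G a (take i b @ Suc (b ! i) # drop (Suc i) b))"
  have A: "(\<Sum>a\<in>compositions u. \<Sum>b\<in>compositions v. (weight a * weight b) *\<^sub>R ?A a b) = real (Suc u) *\<^sub>R g (Suc u) v" for u v
  proof -
    have "(\<Sum>a\<in>compositions u. \<Sum>b\<in>compositions v. (weight a * weight b) *\<^sub>R ?A a b)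
        = (\<Sum>b\<in>compositions v. weight b *\<^sub>R (\<Sum>a\<in>compositions u. weight a *\<^sub>R ?A a b))"
      by (subst sum.swap) (simp only: scaleR_sum_right scaleR_scaleR mult.commute)
    also have "\<dots> = (\<Sum>b\<in>compositions v. weight b *\<^sub>R real (Suc u) *\<^sub>R (\<Sum>a\<in>compositions (Suc u). weight a *\<^sub>R G a b))"
      by (subst sum_compositions_Suc) (rule refl)
    also have "\<dots> = real (Suc u) *\<^sub>R (\<Sum>b\<in>compositions v. \<Sum>a\<in>compositions (Suc u). (weight a * weight b) *\<^sub>R G a b)"
      by (simp only: scaleR_sum_right scaleR_scaleR mult.left_commute mult.commute)
    finally show ?thesis unfolding g_def by (subst sum.swap)
  qed
  have B: "(\<Sum>a\<in>compositions u. \<Sum>b\<in>compositions v. (weight a * weight b) *\<^sub>R ?B a b) = real (Suc v) *\<^sub>R g u (Suc v)" for u v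
  proof -
    have "(\<Sum>a\<in>compositions u. \<Sum>b\<in>compositions v. (weight a * weight b) *\<^sub>R ?B a b)
        = (\<Sum>a\<in>compositions u. weight a *\<^sub>R (\<Sum>b\<in>compositions v. weight b *\<^sub>R ?B a b))"
      by (simp only: scaleR_sum_right scaleR_scaleR)
    also have "\<dots> = (\<Sum>a\<in>compositions u. weight a *\<^sub>R real (Suc v) *\<^sub>R (\<Sum>b\<in>compositions (Suc v). weight b *\<^sub>R G a b))"
      by (subst sum_compositions_Suc) (rule refl)
    also have "\<dots> = real (Suc v) *\<^sub>R (\<Sum>a\<in>compositions u. \<Sum>b\<in>compositions (Suc v). (weight a * weight b) *\<^sub>R G a b)"
      by (simp only: scaleR_sum_right scaleR_scaleR mult.left_commute mult.commute)
    finally show ?thesis unfolding g_def .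
  qed
  have "(\<Sum>(a, b)\<in>composition_pairs l. (weight a * weight b) *\<^sub>R
      ((\<Sum>i\<le>length a. G (take i a @ 1 # drop i a) b) + (\<Sum>i\<le>length b. G a (take i b @ 1 # drop i b)) +
       (\<Sum>i<length a. G (take i a @ Suc (a ! i) # drop (Suc i) a) b) +
       (\<Sum>i<length b. G a (take i b @ Suc (b ! i) # drop (Suc i) b))))
    = (\<Sum>(a, b)\<in>composition_pairs l. (weight a * weight b) *\<^sub>R ?A a b + (weight a * weight b) *\<^sub>R ?B a b)"
    by (simp add: scaleR_add_right add_ac)
  also have "\<dots> = (\<Sum>u\<le>l. real (Suc u) *\<^sub>R g (Suc u) (l - u) + real (Suc (l - u)) *\<^sub>R g u (Suc (l - u)))"
    unfolding sum_composition_pairs A[symmetric] B[symmetric] by (simp only: sum.distrib)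
  also have "\<dots> = (\<Sum>u\<le>l. real (Suc u) *\<^sub>R g (Suc u) (Suc l - Suc u)) + (\<Sum>u\<le>l. real (Suc l - u) *\<^sub>R g u (Suc l - u))"
    by (simp only: sum.distrib diff_Suc_Suc) (simp add: Suc_diff_le)
  also have "(\<Sum>u\<le>l. real (Suc u) *\<^sub>R g (Suc u) (Suc l - Suc u)) = (\<Sum>u\<le>Suc l. real u *\<^sub>R g u (Suc l - u))"
    by (subst sum.atMost_Suc_shift) simp
  also have "(\<Sum>u\<le>l. real (Suc l - u) *\<^sub>R g u (Suc l - u)) = (\<Sum>u\<le>Suc l. real (Suc l - u) *\<^sub>R g u (Suc l - u))"
    by simp
  also have "(\<Sum>u\<le>Suc l. real u *\<^sub>R g u (Suc l - u)) + (\<Sum>u\<le>Suc l. real (Suc l - u) *\<^sub>R g u (Suc l - u))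
      = (\<Sum>u\<le>Suc l. real (Suc l) *\<^sub>R g u (Suc l - u))"
    unfolding sum.distrib[symmetric] scaleR_add_left[symmetric]
    by (intro sum.cong refl) (simp flip: of_nat_add)
  also have "\<dots> = real (Suc l) *\<^sub>R (\<Sum>(a, b)\<in>composition_pairs (Suc l). (weight a * weight b) *\<^sub>R G a b)"
    unfolding sum_composition_pairs g_def scaleR_sum_right ..
  finally show ?thesis .
qed

section \<open>The derivatives of the matrix function\<close>

text \<open>The summand of the formula that belongs to a pair of compositions, in the original basis and
  without its weight. \<open>X i\<close> and \<open>Y i\<close> stand for the derivatives of order
  \<open>i\<close>.\<close>

definition formula_term :: "(real \<times> real \<Rightarrow> real) \<Rightarrow> 'n::finite eigendata \<Rightarrow> (nat \<Rightarrow> complex^'n^'n) \<Rightarrow>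
    (nat \<Rightarrow> complex^'n^'n) \<Rightarrow> nat list \<Rightarrow> nat list \<Rightarrow> complex^'n^'n" where
  "formula_term f c X Y a b = spectral_sum_at (hg_symbol f (length a) (length b)) c (map X a @ map Y b)"

lemma prod_lessThan_add:
  "(\<Prod>i<k + r. g i) = (\<Prod>i<k. g i) * (\<Prod>i<r. g (k + i) :: 'v :: comm_monoid_mult)" for k r :: nat
  by (induction r) (auto simp: mult_ac)

lemma sum_lessThan_add:
  "(\<Sum>i<k + r. g i) = (\<Sum>i<k. g i) + (\<Sum>i<r. g (k + i) :: 'v :: comm_monoid_add)" for k r :: nat
  by (induction r) (auto simp: add_ac)

text \<open>Inserting \<open>S'\<close> at a position up to \<open>k\<close> inserts a part 1 into
  \<open>a\<close>, and inserting \<open>T'\<close> at a position from \<open>k\<close> on inserts a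
  part 1 into \<open>b\<close>. Differentiating a factor increases the part that records its order.\<close>

lemma formula_term_has_derivative:
  fixes DS DT :: "nat \<Rightarrow> real \<Rightarrow> complex^'n^'n"
  assumes J: "is_interval J1" "is_interval J2" "open J1" "open J2"
    and f: "Cm_on (Suc (length a + length b)) (J1 \<times> J2) f"
    and c: "\<And>t. t \<in> I \<Longrightarrow> diagonalizes (DS 0 t) (DT 0 t) (c t)"
    and Q: "\<And>t. t \<in> I \<Longrightarrow> range (snd (c t)) \<subseteq> J1 \<times> J2"
    and t: "t \<in> I"
    and DS: "\<And>i. i = 0 \<or> i \<in> set a \<Longrightarrow> (DS i has_vector_derivative DS (Suc i) t) (at t within I)"
    and DT: "\<And>i. i = 0 \<or> i \<in> set b \<Longrightarrow> (DT i has_vector_derivative DT (Suc i) t) (at t within I)"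
  defines "E \<equiv> formula_term f (c t) (\<lambda>i. DS i t) (\<lambda>i. DT i t)"
  shows "((\<lambda>t. formula_term f (c t) (\<lambda>i. DS i t) (\<lambda>i. DT i t) a b) has_vector_derivative
    (\<Sum>i\<le>length a. E (take i a @ 1 # drop i a) b) + (\<Sum>i\<le>length b. E a (take i b @ 1 # drop i b)) +
    (\<Sum>i<length a. E (take i a @ Suc (a ! i) # drop (Suc i) a) b) +
    (\<Sum>i<length b. E a (take i b @ Suc (b ! i) # drop (Suc i) b))) (at t within I)"
proof -
  let ?k = "length a" and ?r = "length b" and ?Q = "J1 \<times> J2"
  let ?Xs = "map (\<lambda>i. (DS i, DS (Suc i) t)) a @ map (\<lambda>i. (DT i, DT (Suc i) t)) b"
  let ?Ms = "map (\<lambda>i. DS i t) a @ map (\<lambda>i. DT i t) b"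
  let ?\<Phi> = "hg_symbol f ?k ?r"
  let ?A = "\<lambda>i. if i \<le> ?k then hg_symbol f (Suc ?k) ?r else (\<lambda>_. 0)"
  let ?B = "\<lambda>i. if ?k \<le> i then hg_symbol f ?k (Suc ?r) else (\<lambda>_. 0)"
  have f0: "Cm_on (?k + ?r) ?Q f" using f by (rule Cm_on_SucD)
  have f1: "Cm_on (Suc ?k + ?r) ?Q f" "Cm_on (?k + Suc ?r) ?Q f" using f by (simp_all del: Cm_on.simps)
  have cont0: "symbol_cont ?Q n (\<lambda>_. 0)" for n by (simp add: symbol_cont_def)
  have "((\<lambda>t. spectral_sum_at ?\<Phi> (c t) (map (\<lambda>(X, X'). X t) ?Xs)) has_vector_derivative
      ((\<Sum>i\<le>length ?Xs. spectral_sum_at (?A i) (c t) (take i ?Ms @ DS (Suc 0) t # drop i ?Ms)) +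
       (\<Sum>i\<le>length ?Xs. spectral_sum_at (?B i) (c t) (take i ?Ms @ DT (Suc 0) t # drop i ?Ms)) +
       (\<Sum>i<length ?Xs. spectral_sum_at ?\<Phi> (c t) (take i ?Ms @ snd (?Xs ! i) # drop (Suc i) ?Ms)))) (at t within I)"
  proof (rule spectral_sum_at_has_derivative[OF c Q t])
    show "(DS 0 has_vector_derivative DS (Suc 0) t) (at t within I)"
      "(DT 0 has_vector_derivative DT (Suc 0) t) (at t within I)" by (auto intro: DS DT)
    show "\<forall>(X, X')\<in>set ?Xs. (X has_vector_derivative X') (at t within I)" by (auto intro: DS DT)
    show "symbol_cont ?Q (Suc (length ?Xs)) ?\<Phi>" using hg_symbol_cont[OF J f0] by simp
    show "symbol_diff ?Q (length ?Xs) ?\<Phi> ?A ?B" using hg_symbol_diff[OF J f] by simp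
    show "symbol_cont ?Q (Suc (Suc (length ?Xs))) (?A i)" for i
      using hg_symbol_cont[OF J f1(1)] cont0 by simp
    show "symbol_cont ?Q (Suc (Suc (length ?Xs))) (?B i)" for i
      using hg_symbol_cont[OF J f1(2)] cont0 by simp
    show "?Ms = map (\<lambda>(X, X'). X t) ?Xs" by simp
  qed
  moreover have "(\<Sum>i\<le>length ?Xs. spectral_sum_at (?A i) (c t) (take i ?Ms @ DS (Suc 0) t # drop i ?Ms))
      = (\<Sum>i\<le>?k. E (take i a @ 1 # drop i a) b)"
    by (intro sum.mono_neutral_cong_right) (auto simp: E_def formula_term_def spectral_sum_at_0 take_map drop_map min_def)
  moreover have "(\<Sum>i\<le>length ?Xs. spectral_sum_at (?B i) (c t) (take i ?Ms @ DT (Suc 0) t # drop i ?Ms))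
      = (\<Sum>i\<le>?r. E a (take i b @ 1 # drop i b))"
  proof -
    have "(\<Sum>i\<le>length ?Xs. spectral_sum_at (?B i) (c t) (take i ?Ms @ DT (Suc 0) t # drop i ?Ms))
        = (\<Sum>i\<in>(\<lambda>i. ?k + i) ` {..?r}. spectral_sum_at (?B i) (c t) (take i ?Ms @ DT (Suc 0) t # drop i ?Ms))"
    proof (intro sum.mono_neutral_right ballI)
      fix i assume "i \<in> {..length ?Xs} - (\<lambda>i. ?k + i) ` {..?r}"
      then have "\<not> ?k \<le> i" by (auto simp: image_iff le_iff_add)
      then show "spectral_sum_at (?B i) (c t) (take i ?Ms @ DT (Suc 0) t # drop i ?Ms) = 0"
        by (simp add: spectral_sum_at_0)
    qed auto
    also have "\<dots> = (\<Sum>i\<le>?r. E a (take i b @ 1 # drop i b))"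
      by (subst sum.reindex)
        (auto simp: E_def formula_term_def take_map drop_map min_def intro!: sum.cong)
    finally show ?thesis .
  qed
  moreover have "(\<Sum>i<length ?Xs. spectral_sum_at ?\<Phi> (c t) (take i ?Ms @ snd (?Xs ! i) # drop (Suc i) ?Ms))
     = (\<Sum>i<?k. E (take i a @ Suc (a ! i) # drop (Suc i) a) b) +
       (\<Sum>i<?r. E a (take i b @ Suc (b ! i) # drop (Suc i) b))"
  proof -
    have "(\<Sum>i<?k. spectral_sum_at ?\<Phi> (c t) (take i ?Ms @ snd (?Xs ! i) # drop (Suc i) ?Ms))
      = (\<Sum>i<?k. E (take i a @ Suc (a ! i) # drop (Suc i) a) b)"
      by (intro sum.cong refl)
        (auto simp: E_def formula_term_def take_map drop_map nth_append min_def Suc_diff_Suc)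
    moreover have "(\<Sum>i<?r. spectral_sum_at ?\<Phi> (c t) (take (?k + i) ?Ms @ snd (?Xs ! (?k + i)) # drop (Suc (?k + i)) ?Ms))
      = (\<Sum>i<?r. E a (take i b @ Suc (b ! i) # drop (Suc i) b))"
      by (intro sum.cong refl)
        (auto simp: E_def formula_term_def take_map drop_map nth_append min_def Suc_diff_Suc)
    ultimately show ?thesis by (simp only: length_append length_map sum_lessThan_add)
  qed
  ultimately show ?thesis
    by (simp add: formula_term_def comp_def add_ac)
qed

text \<open>The derivatives are passed to the components by the two projections. That \<open>at t within
  I\<close> is nontrivial makes them unique, so that \<open>vector_derivative\<close> returns these
  values.\<close>

lemma higher_vderiv_Pair:
  fixes S :: "real \<Rightarrow> 'a::real_normed_vector" and T :: "real \<Rightarrow> 'b::real_normed_vector"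
  assumes bot: "\<And>t. t \<in> I \<Longrightarrow> at t within I \<noteq> bot"
    and diff: "times_differentiable_on m I (\<lambda>t. (S t, T t))"
  shows "k \<le> m \<Longrightarrow> t \<in> I \<Longrightarrow> higher_vderiv k I (\<lambda>t. (S t, T t)) t = (higher_vderiv k I S t, higher_vderiv k I T t)"
    and "k < m \<Longrightarrow> t \<in> I \<Longrightarrow> (higher_vderiv k I S has_vector_derivative higher_vderiv (Suc k) I S t) (at t within I)"
    and "k < m \<Longrightarrow> t \<in> I \<Longrightarrow> (higher_vderiv k I T has_vector_derivative higher_vderiv (Suc k) I T t) (at t within I)"
proof -
  let ?P = "\<lambda>k. higher_vderiv k I (\<lambda>t. (S t, T t))"
  have step: "(higher_vderiv k I S has_vector_derivative fst (?P (Suc k) t)) (at t within I)"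
      "(higher_vderiv k I T has_vector_derivative snd (?P (Suc k) t)) (at t within I)"
    if "k < m" "t \<in> I" "\<And>t. t \<in> I \<Longrightarrow> ?P k t = (higher_vderiv k I S t, higher_vderiv k I T t)" for k t
  proof -
    have P: "(?P k has_vector_derivative ?P (Suc k) t) (at t within I)"
      using diff that unfolding times_differentiable_on_def by (simp add: vector_derivative_works)
    show "(higher_vderiv k I S has_vector_derivative fst (?P (Suc k) t)) (at t within I)"
      by (rule has_vector_derivative_transform[OF \<open>t \<in> I\<close> _ bounded_linear.has_vector_derivative[OF bounded_linear_fst P]])
        (simp add: that(3))
    show "(higher_vderiv k I T has_vector_derivative snd (?P (Suc k) t)) (at t within I)"
      by (rule has_vector_derivative_transform[OF \<open>t \<in> I\<close> _ bounded_linear.has_vector_derivative[OF bounded_linear_snd P]])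
        (simp add: that(3))
  qed
  have all: "t \<in> I \<Longrightarrow> ?P k t = (higher_vderiv k I S t, higher_vderiv k I T t)" if "k \<le> m" for k t
    using that
  proof (induction k arbitrary: t)
    case (Suc k)
    then have "?P k t = (higher_vderiv k I S t, higher_vderiv k I T t)" if "t \<in> I" for t using that by simp
    note s = step[OF _ Suc.prems(1) this]
    have "higher_vderiv (Suc k) I S t = fst (?P (Suc k) t)" "higher_vderiv (Suc k) I T t = snd (?P (Suc k) t)"
      using Suc.prems s by (auto intro!: vector_derivative_within bot)
    then show ?case by simp
  qed simp
  show "?P k t = (higher_vderiv k I S t, higher_vderiv k I T t)" if "k \<le> m" "t \<in> I" using all that by blast
  have "?P (Suc k) t = (higher_vderiv (Suc k) I S t, higher_vderiv (Suc k) I T t)" if "k < m" "t \<in> I"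
    using all[of "Suc k"] that by simp
  then show "k < m \<Longrightarrow> t \<in> I \<Longrightarrow> (higher_vderiv k I S has_vector_derivative higher_vderiv (Suc k) I S t) (at t within I)"
    "k < m \<Longrightarrow> t \<in> I \<Longrightarrow> (higher_vderiv k I T has_vector_derivative higher_vderiv (Suc k) I T t) (at t within I)"
    using step[of k t] all[of k] by auto
qed

text \<open>The description in the definition of \<open>matfun\<close> determines the matrix by
  \<open>proj_sum_unique\<close>, and a spectral sum with a single projection satisfies it.\<close>

lemma matfun_eq_formula_term:
  assumes "diagonalizes S T c"
  shows "matfun f (S, T) = formula_term f c X Y [] []"
proof -
  have sum: "(\<Sum>a\<in>UNIV. proj V a ** (g a *\<^sub>R mat 1)) = V ** diag g ** cadjoint V" for V :: "complex^'n^'n" and g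
    by (simp add: mm.scaleR_right flip: sum_proj_diag)
  have conj: "cadjoint V ** (V ** M ** cadjoint V) ** V = M" "V ** (cadjoint V ** M ** V) ** cadjoint V = M"
    if "unitary V" for V M :: "complex^'n^'n"
  proof -
    have "cadjoint V ** (V ** M ** cadjoint V) ** V = (cadjoint V ** V) ** M ** (cadjoint V ** V)"
      by (simp only: matrix_mul_assoc)
    then show "cadjoint V ** (V ** M ** cadjoint V) ** V = M" using that by (simp add: unitary_def)
    have "V ** (cadjoint V ** M ** V) ** cadjoint V = (V ** cadjoint V) ** M ** (V ** cadjoint V)"
      by (simp only: matrix_mul_assoc)
    then show "V ** (cadjoint V ** M ** V) ** cadjoint V = M" using that by (simp add: unitary_def)
  qed
  have F: "formula_term f c X Y [] [] = fst c ** diag (\<lambda>a. f (snd c a)) ** cadjoint (fst c)"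
    by (simp add: formula_term_def spectral_sum_at_def hg_symbol_def sum)
  show ?thesis
    unfolding matfun_def prod.case F
  proof (rule the_equality)
    have "S = fst c ** diag (\<lambda>a. fst (snd c a)) ** cadjoint (fst c)"
      "T = fst c ** diag (\<lambda>a. snd (snd c a)) ** cadjoint (fst c)"
      using assms conj(2)[of "fst c" S] conj(2)[of "fst c" T] by (simp_all add: diagonalizes_def)
    then show "\<exists>V x y. unitary V \<and> S = V ** diag x ** cadjoint V \<and> T = V ** diag y ** cadjoint V \<and>
       fst c ** diag (\<lambda>a. f (snd c a)) ** cadjoint (fst c) = V ** diag (\<lambda>i. f (x i, y i)) ** cadjoint V"
      using assms by (intro exI[of _ "fst c"] exI[of _ "\<lambda>a. fst (snd c a)"] exI[of _ "\<lambda>a. snd (snd c a)"])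
        (simp add: diagonalizes_def)
  next
    fix M assume "\<exists>V x y. unitary V \<and> S = V ** diag x ** cadjoint V \<and> T = V ** diag y ** cadjoint V \<and>
        M = V ** diag (\<lambda>i. f (x i, y i)) ** cadjoint V"
    then obtain V x y where V: "unitary V" "S = V ** diag x ** cadjoint V" "T = V ** diag y ** cadjoint V"
        "M = V ** diag (\<lambda>i. f (x i, y i)) ** cadjoint V" by blast
    then have "diagonalizes S T (V, \<lambda>a. (x a, y a))" by (simp add: diagonalizes_def conj)
    from proj_sum_unique[OF this assms, of "\<lambda>q. f q *\<^sub>R mat 1"]
    show "M = fst c ** diag (\<lambda>a. f (snd c a)) ** cadjoint (fst c)"
      by (simp add: V(4) sum)
  qed
qed

lemma conj_proj_nth:
  assumes "unitary U"
  shows "(cadjoint U ** (proj U a' ** M) ** U) $ a $ b = (if a = a' then (cadjoint U ** M ** U) $ a $ b else 0)"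
proof -
  have "(\<Sum>i\<in>UNIV. cnj (U $ i $ a) * (U $ i $ a' * cnj (U $ j $ a')))
      = (if a = a' then cnj (U $ j $ a) else 0)" for j
  proof -
    have "(\<Sum>i\<in>UNIV. cnj (U $ i $ a) * (U $ i $ a' * cnj (U $ j $ a')))
      = (cadjoint U ** U) $ a $ a' * cnj (U $ j $ a')"
      by (simp add: matrix_matrix_mult_def cadjoint_def sum_distrib_right mult.assoc)
    then show ?thesis using assms by (simp add: unitary_def mat_def)
  qed
  then have row: "(cadjoint U ** proj U a') $ a $ j = (if a = a' then cadjoint U $ a $ j else 0)" for j
    by (simp add: matrix_matrix_mult_def cadjoint_def proj_def)
  have "cadjoint U ** (proj U a' ** M) ** U = (cadjoint U ** proj U a') ** (M ** U)"
    "cadjoint U ** M ** U = cadjoint U ** (M ** U)"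
    by (simp_all only: matrix_mul_assoc)
  then show ?thesis using row by (simp add: matrix_matrix_mult_def[of "cadjoint U ** proj U a'"]
      matrix_matrix_mult_def[of "cadjoint U" "M ** U"])
qed

lemma sum_lists_Suc:
  "(\<Sum>s\<in>{s :: ('n::finite) list. length s = Suc n}. F s) = (\<Sum>a\<in>UNIV. \<Sum>s\<in>{s. length s = n}. F (a # s))"
  for F :: "('n::finite) list \<Rightarrow> 'v :: comm_monoid_add"
proof -
  have fin: "finite {s :: 'n list. length s = n}" using finite_lists_length_eq[of "UNIV :: 'n set" n] by simp
  have "{s :: 'n list. length s = Suc n} = (\<lambda>(a, s). a # s) ` (UNIV \<times> {s. length s = n})"
    by (auto simp: length_Suc_conv image_iff)
  then show ?thesis
    by (simp add: sum.reindex inj_on_def sum.cartesian_product case_prod_unfold)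
qed

text \<open>In the eigenbasis the projections become matrix units, so the spectral sum becomes a sum over
  paths of indices from \<open>a\<close> to \<open>b\<close>.\<close>

lemma conj_spectral_sum_at_nth:
  fixes U :: "complex^'n^'n"
  assumes U: "unitary U"
  shows "(cadjoint U ** spectral_sum_at \<Phi> (U, p) (M # Ms) ** U) $ a $ b =
    (\<Sum>s\<in>{s. length s = length Ms}. complex_of_real (\<Phi> (map p (a # s @ [b]))) *
      (\<Prod>i<Suc (length Ms). (cadjoint U ** (M # Ms) ! i ** U) $ ((a # s @ [b]) ! i) $ ((a # s @ [b]) ! Suc i)))"
proof (induction Ms arbitrary: \<Phi> M a)
  have step: "(cadjoint U ** spectral_sum_at \<Phi> (U, p) (M # Ms) ** U) $ a $ b =
     (\<Sum>a'\<in>UNIV. (cadjoint U ** M ** U) $ a $ a' * (cadjoint U ** spectral_sum_at (\<lambda>qs. \<Phi> (p a # qs)) (U, p) Ms ** U) $ a' $ b)"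
    for \<Phi> M Ms a
  proof -
    have "(cadjoint U ** spectral_sum_at \<Phi> (U, p) (M # Ms) ** U) $ a $ b =
      (cadjoint U ** (M ** spectral_sum_at (\<lambda>qs. \<Phi> (p a # qs)) (U, p) Ms) ** U) $ a $ b"
      by (simp add: spectral_sum_at_def mm.sum_left mm.sum_right conj_proj_nth[OF U])
    also have "cadjoint U ** (M ** spectral_sum_at (\<lambda>qs. \<Phi> (p a # qs)) (U, p) Ms) ** U
        = cadjoint U ** M ** (U ** cadjoint U) ** spectral_sum_at (\<lambda>qs. \<Phi> (p a # qs)) (U, p) Ms ** U"
      using U by (simp add: unitary_def matrix_mul_assoc)
    also have "\<dots> = (cadjoint U ** M ** U) ** (cadjoint U ** spectral_sum_at (\<lambda>qs. \<Phi> (p a # qs)) (U, p) Ms ** U)"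
      by (simp only: matrix_mul_assoc)
    finally show ?thesis by (simp only: matrix_matrix_mult_def[of "cadjoint U ** M ** U"] vec_lambda_beta)
  qed
  {
    case Nil
    have "(cadjoint U ** spectral_sum_at (\<lambda>qs. \<Phi> (p a # qs)) (U, p) [] ** U) $ a' $ b
        = (if a' = b then complex_of_real (\<Phi> [p a, p b]) else 0)" for a'
    proof -
      have "(cadjoint U ** spectral_sum_at (\<lambda>qs. \<Phi> (p a # qs)) (U, p) [] ** U) $ a' $ b
         = \<Phi> [p a, p a'] *\<^sub>R (cadjoint U ** U) $ a' $ b"
        by (simp add: spectral_sum_at_def mm.sum_left mm.sum_right mm.scaleR_left mm.scaleR_right
            conj_proj_nth[OF U, of _ "mat 1", simplified] if_distrib[of "\<lambda>z. _ *\<^sub>R z"] sum.delta cong: if_cong)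
      then show ?thesis using U by (simp add: unitary_def mat_def scaleR_conv_of_real)
    qed
    then show ?case
      by (subst step) (simp add: if_distrib[of "\<lambda>z. _ * z"] sum.delta' mult.commute cong: if_cong)
  next
    case (Cons M' Ms)
    have "(cadjoint U ** spectral_sum_at \<Phi> (U, p) (M # M' # Ms) ** U) $ a $ b =
      (\<Sum>a'\<in>UNIV. (cadjoint U ** M ** U) $ a $ a' *
        (\<Sum>s\<in>{s. length s = length Ms}. complex_of_real (\<Phi> (p a # map p (a' # s @ [b]))) *
      (\<Prod>i<Suc (length Ms). (cadjoint U ** (M' # Ms) ! i ** U) $ ((a' # s @ [b]) ! i) $ ((a' # s @ [b]) ! Suc i))))"
      unfolding step[of \<Phi> M "M' # Ms"] Cons.IH ..
    also have "\<dots> = (\<Sum>s\<in>{s. length s = Suc (length Ms)}. complex_of_real (\<Phi> (map p (a # s @ [b]))) *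
      (\<Prod>i<Suc (Suc (length Ms)). (cadjoint U ** (M # M' # Ms) ! i ** U) $ ((a # s @ [b]) ! i) $ ((a # s @ [b]) ! Suc i)))"
      unfolding sum_lists_Suc sum_distrib_left
      by (intro sum.cong refl, subst prod.lessThan_Suc_shift[of _ "Suc (length Ms)"])
        (simp add: mult_ac del: prod.lessThan_Suc)
    finally show ?case by simp
  }
qed

lemma conj_formula_term_nth:
  fixes U :: "complex^'n^'n"
  assumes J: "is_interval J1" "is_interval J2" "open J1" "open J2"
    and f: "Cm_on (length a + length b) (J1 \<times> J2) f"
    and U: "unitary U" and Q: "\<And>s. x s \<in> J1" "\<And>s. y s \<in> J2"
    and ne: "1 \<le> length a + length b"
  shows "cadjoint U ** formula_term f (U, \<lambda>s. (x s, y s)) X Y a b ** U =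
    (\<Sum>s\<in>{s. length s = length a + length b - 1}.
       (\<chi> p q. complex_of_real (dd_entry f x y (length a) (length a + length b) (p # s @ [q]))) \<odot>
       (\<chi> p q. deriv_entry (\<lambda>i. cadjoint U ** X i ** U) (\<lambda>i. cadjoint U ** Y i ** U) a b (p # s @ [q])))"
proof -
  let ?k = "length a" and ?r = "length b"
  let ?Ms = "map X a @ map Y b" and ?p = "\<lambda>s. (x s, y s)"
  let ?N = "\<lambda>i. cadjoint U ** ?Ms ! i ** U"
  obtain M Ms where Ms: "?Ms = M # Ms" using ne by (cases ?Ms) auto
  have len: "Suc (length Ms) = ?k + ?r" using arg_cong[OF Ms, of length] by simp
  have "(cadjoint U ** formula_term f (U, ?p) X Y a b ** U) $ p $ q =
    (\<Sum>s\<in>{s. length s = ?k + ?r - 1}. complex_of_real (dd_entry f x y ?k (?k + ?r) (p # s @ [q])) *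
      deriv_entry (\<lambda>i. cadjoint U ** X i ** U) (\<lambda>i. cadjoint U ** Y i ** U) a b (p # s @ [q]))" for p q
  proof -
    have "(cadjoint U ** formula_term f (U, ?p) X Y a b ** U) $ p $ q =
      (\<Sum>s\<in>{s. length s = length Ms}. complex_of_real (hg_symbol f ?k ?r (map ?p (p # s @ [q]))) *
        (\<Prod>i<?k + ?r. ?N i $ ((p # s @ [q]) ! i) $ ((p # s @ [q]) ! Suc i)))"
      unfolding formula_term_def Ms conj_spectral_sum_at_nth[OF U] len[symmetric] ..
    also have "\<dots> = (\<Sum>s\<in>{s. length s = ?k + ?r - 1}. complex_of_real (dd_entry f x y ?k (?k + ?r) (p # s @ [q])) *
      deriv_entry (\<lambda>i. cadjoint U ** X i ** U) (\<lambda>i. cadjoint U ** Y i ** U) a b (p # s @ [q]))"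
    proof (intro sum.cong)
      show "{s :: 'n list. length s = length Ms} = {s. length s = ?k + ?r - 1}" using len by auto
      fix s :: "'n list" assume s: "s \<in> {s. length s = ?k + ?r - 1}"
      define w where "w = p # s @ [q]"
      have lw: "length w = Suc (?k + ?r)" using s ne by (simp add: w_def)
      have g: "(\<lambda>i. x (w ! i), \<lambda>i. y (w ! (?k + i))) \<in> grid J1 J2 ?k ?r"
        using Q by (simp add: grid_def)
      have "hg_symbol f ?k ?r (map ?p w) = hg_integral ?k ?r f (\<lambda>i. x (w ! i)) (\<lambda>i. y (w ! (?k + i)))"
        unfolding hg_symbol_def using lw by (intro hg_integral_cong) auto
      also have "\<dots> = dd_entry f x y ?k (?k + ?r) w"
        using divdiff2_eq_hg_integral[OF J f g] by (simp add: dd_entry_def)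
      finally have "hg_symbol f ?k ?r (map ?p w) = dd_entry f x y ?k (?k + ?r) w" .
      moreover have "(\<Prod>i<?k + ?r. ?N i $ (w ! i) $ (w ! Suc i)) =
         deriv_entry (\<lambda>i. cadjoint U ** X i ** U) (\<lambda>i. cadjoint U ** Y i ** U) a b w"
        unfolding prod_lessThan_add deriv_entry_def
        by (intro arg_cong2[of _ _ _ _ "(*)"] prod.cong refl) (auto simp: nth_append)
      ultimately show "complex_of_real (hg_symbol f ?k ?r (map ?p (p # s @ [q]))) *
        (\<Prod>i<?k + ?r. ?N i $ ((p # s @ [q]) ! i) $ ((p # s @ [q]) ! Suc i)) =
         complex_of_real (dd_entry f x y ?k (?k + ?r) (p # s @ [q])) *
      deriv_entry (\<lambda>i. cadjoint U ** X i ** U) (\<lambda>i. cadjoint U ** Y i ** U) a b (p # s @ [q])"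
        unfolding w_def by simp
    qed
    finally show ?thesis .
  qed
  then show ?thesis by (simp add: vec_eq_iff schur_def)
qed

text \<open>In the induction step the order rises from \<open>l\<close> to \<open>l + 1\<close>: the
  parts of the compositions are at most \<open>l < m\<close>, so every factor can still be
  differentiated, and a divided difference of order at most \<open>l\<close> still leaves one
  derivative of \<open>f\<close> to spare.\<close>

lemma higher_vderiv_matfun:
  fixes S T :: "real \<Rightarrow> complex^'n^'n"
  assumes J: "is_interval J1" "is_interval J2" "open J1" "open J2"
    and f: "Cm_on m (J1 \<times> J2) f"
    and bot: "\<And>t. t \<in> I \<Longrightarrow> at t within I \<noteq> bot"
    and diff: "times_differentiable_on m I (\<lambda>t. (S t, T t))"
    and c: "\<And>t. t \<in> I \<Longrightarrow> diagonalizes (S t) (T t) (c t)"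
    and Q: "\<And>t. t \<in> I \<Longrightarrow> range (snd (c t)) \<subseteq> J1 \<times> J2"
  defines "E \<equiv> \<lambda>a b t. formula_term f (c t) (\<lambda>i. higher_vderiv i I S t) (\<lambda>i. higher_vderiv i I T t) a b"
  defines "G \<equiv> \<lambda>l t. (fact l :: real) *\<^sub>R (\<Sum>(a, b)\<in>composition_pairs l. (weight a * weight b) *\<^sub>R E a b t)"
  shows "l < m \<Longrightarrow> t \<in> I \<Longrightarrow> (G l has_vector_derivative G (Suc l) t) (at t within I)"
    and "l \<le> m \<Longrightarrow> t \<in> I \<Longrightarrow> higher_vderiv l I (\<lambda>t. matfun f (S t, T t)) t = G l t"
proof -
  show deriv: "(G l has_vector_derivative G (Suc l) t) (at t within I)" if l: "l < m" and t: "t \<in> I" for l t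
  proof -
    let ?D = "\<lambda>a b. (\<Sum>i\<le>length a. E (take i a @ 1 # drop i a) b t) + (\<Sum>i\<le>length b. E a (take i b @ 1 # drop i b) t) +
       (\<Sum>i<length a. E (take i a @ Suc (a ! i) # drop (Suc i) a) b t) +
       (\<Sum>i<length b. E a (take i b @ Suc (b ! i) # drop (Suc i) b) t)"
    have D: "(E a b has_vector_derivative ?D a b) (at t within I)" if "(a, b) \<in> composition_pairs l" for a b
      unfolding E_def
    proof (rule formula_term_has_derivative[OF J])
      have "length a + length b \<le> l"
        using that length_le_sum_list[of a] length_le_sum_list[of b] by (auto simp: composition_pairs_def)
      then show "Cm_on (Suc (length a + length b)) (J1 \<times> J2) f" using l by (intro Cm_on_le[OF f]) simp
      show "diagonalizes (higher_vderiv 0 I S t) (higher_vderiv 0 I T t) (c t)" if "t \<in> I" for t using c that by simp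
      show "range (snd (c t)) \<subseteq> J1 \<times> J2" if "t \<in> I" for t using Q that .
      show "t \<in> I" by (rule t)
      have le: "i \<le> l" if "i = 0 \<or> i \<in> set a \<union> set b" for i
        using that \<open>(a, b) \<in> composition_pairs l\<close> member_le_sum_list[of i a] member_le_sum_list[of i b]
        by (auto simp: composition_pairs_def)
      show "(higher_vderiv i I S has_vector_derivative higher_vderiv (Suc i) I S t) (at t within I)"
        if "i = 0 \<or> i \<in> set a" for i
      proof -
        have "i < m" using le[of i] l that by auto
        from higher_vderiv_Pair(2)[OF bot diff this t] show ?thesis by blast
      qed
      show "(higher_vderiv i I T has_vector_derivative higher_vderiv (Suc i) I T t) (at t within I)"
        if "i = 0 \<or> i \<in> set b" for i
      proof -
        have "i < m" using le[of i] l that by auto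
        from higher_vderiv_Pair(3)[OF bot diff this t] show ?thesis by blast
      qed
    qed
    have "(G l has_vector_derivative fact l *\<^sub>R (\<Sum>(a, b)\<in>composition_pairs l. (weight a * weight b) *\<^sub>R ?D a b)) (at t within I)"
      unfolding G_def case_prod_unfold
      by (intro bounded_linear.has_vector_derivative[OF bounded_linear_scaleR_right] has_vector_derivative_sum D) auto
    also have "fact l *\<^sub>R (\<Sum>(a, b)\<in>composition_pairs l. (weight a * weight b) *\<^sub>R ?D a b) = G (Suc l) t"
      by (subst sum_composition_pairs_Suc) (simp add: G_def mult.commute)
    finally show ?thesis .
  qed
  show "higher_vderiv l I (\<lambda>t. matfun f (S t, T t)) t = G l t" if "l \<le> m" "t \<in> I" for l t
    using that
  proof (induction l arbitrary: t)
    case 0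
    have "(a, b) \<in> composition_pairs 0 \<longleftrightarrow> a = [] \<and> b = []" for a b
      by (cases a; cases b) (auto simp: composition_pairs_def)
    then have "composition_pairs 0 = {([], [])}" by auto
    then show ?case using matfun_eq_formula_term[OF c[OF 0(2)]] by (simp add: G_def E_def weight_def)
  next
    case (Suc l)
    have "(higher_vderiv l I (\<lambda>t. matfun f (S t, T t)) has_vector_derivative G (Suc l) t) (at t within I)"
      by (rule has_vector_derivative_transform[OF Suc.prems(2) _ deriv]) (use Suc in auto)
    then show ?case using Suc.prems by (simp add: vector_derivative_within[OF bot])
  qed
qed

theorem theorem4p1:
  fixes f :: "real \<times> real \<Rightarrow> real"
    and S T U :: "real \<Rightarrow> complex^'n^'n"
    and x y :: "real \<Rightarrow> 'n \<Rightarrow> real"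
    and \<Gamma> \<Delta> :: "nat \<Rightarrow> complex^'n^'n"
    and I J\<^sub>1 J\<^sub>2 :: "real set"
    and l m :: nat and t\<^sub>0 :: real
  assumes "open J\<^sub>1" "is_interval J\<^sub>1" "open J\<^sub>2" "is_interval J\<^sub>2"
    and "Cm_on m (J\<^sub>1 \<times> J\<^sub>2) f"
    and "is_interval I" "interior I \<noteq> {}"
    and "\<forall>t\<in>I. (S t, T t) \<in> CS2"
    and "Cm_curve m I (\<lambda>t. (S t, T t))"
    and "\<forall>t\<in>I. unitary (U t) \<and>
           cadjoint (U t) ** S t ** U t = diag (x t) \<and>
           cadjoint (U t) ** T t ** U t = diag (y t)"
    and "\<forall>t\<in>I. \<forall>s. (x t s, y t s) \<in> J\<^sub>1 \<times> J\<^sub>2"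
    and "1 \<le> l" "l \<le> m" "t\<^sub>0 \<in> I"
    and "\<Gamma> = (\<lambda>i. cadjoint (U t\<^sub>0) ** higher_vderiv i I S t\<^sub>0 ** U t\<^sub>0)"
    and "\<Delta> = (\<lambda>i. cadjoint (U t\<^sub>0) ** higher_vderiv i I T t\<^sub>0 ** U t\<^sub>0)"
  shows "times_differentiable_on l I (\<lambda>t. matfun f (S t, T t)) \<and>
    higher_vderiv l I (\<lambda>t. matfun f (S t, T t)) t\<^sub>0 =
      U t\<^sub>0 **
      (\<Sum>(a, b) \<in> index_set l. \<Sum>s \<in> {s. length s = length a + length b - 1}.
         (fact l / (prod_list (map fact a) * prod_list (map fact b))) *\<^sub>R
         ((\<chi> p q. complex_of_real
              (dd_entry f (x t\<^sub>0) (y t\<^sub>0) (length a) (length a + length b) (p # s @ [q]))) \<odot>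
          (\<chi> p q. deriv_entry \<Gamma> \<Delta> a b (p # s @ [q]))))
      ** cadjoint (U t\<^sub>0)"
proof
  note J = assms(2,4,1,3)
  let ?F = "\<lambda>t. matfun f (S t, T t)"
  define c where "c t = (U t, \<lambda>s. (x t s, y t s))" for t
  have c: "diagonalizes (S t) (T t) (c t)" if "t \<in> I" for t
    using assms(10) that by (simp add: diagonalizes_def c_def)
  have Q: "range (snd (c t)) \<subseteq> J\<^sub>1 \<times> J\<^sub>2" if "t \<in> I" for t
    using assms(11) that by (auto simp: c_def)
  \<comment> \<open>An interval with interior has no isolated points, so derivatives within it are
    unique, also at its endpoints.\<close>
  have bot: "at t within I \<noteq> bot" if "t \<in> I" for t
  proof -
    have "connected I" using assms(6) by (rule is_interval_connected)
    moreover have "\<not> (\<exists>z. I = {z})" using assms(7) by auto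
    ultimately show ?thesis
      using that connected_imp_perfect[of I t] by (auto simp: trivial_limit_within)
  qed
  have diff: "times_differentiable_on m I (\<lambda>t. (S t, T t))" using assms(9) by (simp add: Cm_curve_def)
  define E where "E = (\<lambda>a b t. formula_term f (c t) (\<lambda>i. higher_vderiv i I S t) (\<lambda>i. higher_vderiv i I T t) a b)"
  define G where "G = (\<lambda>l t. (fact l :: real) *\<^sub>R (\<Sum>(a, b)\<in>composition_pairs l. (weight a * weight b) *\<^sub>R E a b t))"
  have deriv: "(G k has_vector_derivative G (Suc k) t) (at t within I)" if "k < m" "t \<in> I" for k t
    unfolding G_def E_def by (rule higher_vderiv_matfun(1)[OF J assms(5) bot diff c Q that])
  have F_eq: "higher_vderiv k I ?F t = G k t" if "k \<le> m" "t \<in> I" for k t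
    unfolding G_def E_def by (rule higher_vderiv_matfun(2)[OF J assms(5) bot diff c Q that])
  show "times_differentiable_on l I ?F"
    unfolding times_differentiable_on_def
  proof (intro allI impI ballI)
    fix k t assume k: "k < l" and t: "t \<in> I"
    have "(higher_vderiv k I ?F has_vector_derivative G (Suc k) t) (at t within I)"
      by (rule has_vector_derivative_transform[OF t _ deriv]) (use k t assms(13) F_eq in auto)
    then show "higher_vderiv k I ?F differentiable at t within I"
      by (rule differentiableI_vector)
  qed
  let ?U = "U t\<^sub>0"
  have U: "unitary ?U" using assms(10,14) by blast
  have entry: "cadjoint ?U ** E a b t\<^sub>0 ** ?U =
    (\<Sum>s\<in>{s. length s = length a + length b - 1}.
       (\<chi> p q. complex_of_real (dd_entry f (x t\<^sub>0) (y t\<^sub>0) (length a) (length a + length b) (p # s @ [q]))) \<odot>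
       (\<chi> p q. deriv_entry \<Gamma> \<Delta> a b (p # s @ [q])))" if "(a, b) \<in> composition_pairs l" for a b
    unfolding E_def c_def assms(15,16)
  proof (rule conj_formula_term_nth[OF J _ U])
    have "length a + length b \<le> l"
      using that length_le_sum_list[of a] length_le_sum_list[of b] by (auto simp: composition_pairs_def)
    then show "Cm_on (length a + length b) (J\<^sub>1 \<times> J\<^sub>2) f" using assms(13) by (intro Cm_on_le[OF assms(5)]) simp
    show "x t\<^sub>0 s \<in> J\<^sub>1" "y t\<^sub>0 s \<in> J\<^sub>2" for s using assms(11,14) by auto
    show "1 \<le> length a + length b" using that assms(12) by (cases a; cases b) (auto simp: composition_pairs_def)
  qed
  have "higher_vderiv l I ?F t\<^sub>0 = G l t\<^sub>0" using F_eq assms(13,14) by blast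
  also have "\<dots> = (?U ** cadjoint ?U) ** G l t\<^sub>0 ** (?U ** cadjoint ?U)"
    using U by (simp add: unitary_def)
  also have "\<dots> = ?U ** (cadjoint ?U ** G l t\<^sub>0 ** ?U) ** cadjoint ?U"
    by (simp only: matrix_mul_assoc)
  also have "cadjoint ?U ** G l t\<^sub>0 ** ?U = (\<Sum>(a, b)\<in>composition_pairs l. (fact l * (weight a * weight b)) *\<^sub>R (cadjoint ?U ** E a b t\<^sub>0 ** ?U))"
    by (simp add: G_def mm.scaleR_left mm.scaleR_right mm.sum_left mm.sum_right scaleR_sum_right case_prod_unfold)
  also have "\<dots> = (\<Sum>(a, b) \<in> index_set l. \<Sum>s \<in> {s. length s = length a + length b - 1}.
         (fact l / (prod_list (map fact a) * prod_list (map fact b))) *\<^sub>R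
         ((\<chi> p q. complex_of_real
              (dd_entry f (x t\<^sub>0) (y t\<^sub>0) (length a) (length a + length b) (p # s @ [q]))) \<odot>
          (\<chi> p q. deriv_entry \<Gamma> \<Delta> a b (p # s @ [q]))))"
    unfolding index_set_eq_composition_pairs[OF assms(12)]
  proof (intro sum.cong refl, clarify)
    fix a b assume "(a, b) \<in> composition_pairs l"
    then show "(fact l * (weight a * weight b)) *\<^sub>R (cadjoint ?U ** E a b t\<^sub>0 ** ?U) =
      (\<Sum>s \<in> {s. length s = length a + length b - 1}.
         (fact l / (prod_list (map fact a) * prod_list (map fact b))) *\<^sub>R
         ((\<chi> p q. complex_of_real
              (dd_entry f (x t\<^sub>0) (y t\<^sub>0) (length a) (length a + length b) (p # s @ [q]))) \<odot>
          (\<chi> p q. deriv_entry \<Gamma> \<Delta> a b (p # s @ [q]))))"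
      unfolding entry[OF \<open>(a, b) \<in> composition_pairs l\<close>] scaleR_sum_right[symmetric] by (simp add: weight_def)
  qed
  finally show "higher_vderiv l I ?F t\<^sub>0 =
      ?U **
      (\<Sum>(a, b) \<in> index_set l. \<Sum>s \<in> {s. length s = length a + length b - 1}.
         (fact l / (prod_list (map fact a) * prod_list (map fact b))) *\<^sub>R
         ((\<chi> p q. complex_of_real
              (dd_entry f (x t\<^sub>0) (y t\<^sub>0) (length a) (length a + length b) (p # s @ [q]))) \<odot>
          (\<chi> p q. deriv_entry \<Gamma> \<Delta> a b (p # s @ [q]))))
      ** cadjoint ?U" .
qed

end
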